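(* Let $\mathrm{St}(n,p)=\{X\in\mathbb R^{n\times p}\mid X^\top X=I_p\}$ be the Stiefel manifold. For $2\le p\le n-2$: 1. In the canonical metric (the metric $g$ described in the context with $\beta=\frac12$), $$\mathrm{inj}_{\mathrm{St}(n,p)}\le t^{\mathrm r}\sqrt2\approx 0.91326189159122\,\pi,$$ where $t^{\mathrm r}$ is the smallest positive solution of $\frac{\sin t}{t}+\cos t=0$. 2. In the Euclidean metric (the metric $g$ described in the context with $\beta=1$), $$\mathrm{inj}_{\mathrm{St}(n,p)}\le\pi.$$ For $p=n-1$ (with $n\ge2$), $\mathrm{inj}_{\mathrm{St}(n,n-1)}=\pi$ in the canonical metric and $\mathrm{inj}_{\mathrm{St}(n,n-1)}\le\pi$ in the Euclidean metric. For $p=1$ (with $n\ge2$), $\mathrm{inj}_{\mathrm{St}(n,1)}=\pi$ (in both the canonical and the Euclidean metric, which coincide for $p=1$).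
   Context: Notation: $\mathrm O(n)$ is the orthogonal group; $\mathcal S_{\mathrm{skew}}(p)$ is the set of real skew-symmetric $p\times p$ matrices; $I_{n\times p}:=\begin{bmatrix}I_p\\0_{(n-p)\times p}\end{bmatrix}$. Every $X\in\mathrm{St}(n,p)$ can be written $X=QI_{n\times p}$ with $Q\in\mathrm O(n)$, and then $\mathrm T_X\mathrm{St}(n,p)=\left\{Q\begin{bmatrix}A\\H\end{bmatrix}\mid A\in\mathcal S_{\mathrm{skew}}(p),\ H\in\mathbb R^{(n-p)\times p}\right\}$. Metric: for $\beta>0$, and tangent vectors $\xi_{\mathrm a}=Q\begin{bmatrix}A_{\mathrm a}\\H_{\mathrm a}\end{bmatrix}$, $\xi_{\mathrm b}=Q\begin{bmatrix}A_{\mathrm b}\\H_{\mathrm b}\end{bmatrix}$ at $QI_{n\times p}$, $$g_{QI_{n\times p}}(\xi_{\mathrm a},\xi_{\mathrm b})=\beta\,\mathrm{trace}(A_{\mathrm a}^\top A_{\mathrm b})+\mathrm{trace}(H_{\mathrm a}^\top H_{\mathrm b}),$$ which does not depend on the choice of $Q$. The canonical metric is the case $\beta=\frac12$ and the Euclidean metric is the case $\beta=1$. For $p=1$ the $A$-term vanishes and $g$ does not depend on $\beta$. Injectivity radius: let $\mathcal M$ be a complete Riemannian manifold with induced distance $d$. For a unit tangent vector $\xi$ at $x$, let $\gamma_\xi$ be the geodesic with $\gamma_\xi(0)=x$, $\gamma_\xi'(0)=\xi$, and let the cut time be $t_{\mathrm c}(\xi):=\sup\{t>0\mid d(x,\gamma_\xi(t))=t\}$.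 The injectivity radius of $x$ is $\mathrm{inj}_{\mathcal M}(x):=\inf\{t_{\mathrm c}(\xi)\mid \xi\in\mathrm T_x\mathcal M,\ \|\xi\|=1\}$ (equivalently, the largest $r$ such that the Riemannian exponential at $x$ is a diffeomorphism of the open ball of radius $r$ in $\mathrm T_x\mathcal M$ onto its image), and the injectivity radius of $\mathcal M$ is $\mathrm{inj}_{\mathcal M}:=\inf_{x\in\mathcal M}\mathrm{inj}_{\mathcal M}(x)$. *)

theory Defs
  imports "HOL-Analysis.Analysis"
begin

section \<open>Riemannian geometry of a submanifold of a Euclidean space\<close>

text \<open>
  A Riemannian manifold is given as a closed connected submanifold \<open>M\<close> of a Euclidean space,
  its tangent spaces \<open>T x\<close> (linear subspaces of the ambient space) and a metric
  \<open>g x\<close>, which is only meaningful on \<open>T x\<close> for \<open>x \<in> M\<close>.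
\<close>

primrec C_upto :: "nat \<Rightarrow> ('a::real_normed_vector \<Rightarrow> 'b::real_normed_vector) \<Rightarrow> bool" where
  "C_upto 0 f = continuous_on UNIV f"
| "C_upto (Suc k) f =
    ((\<forall>x. f differentiable (at x)) \<and> (\<forall>v. C_upto k (\<lambda>x. frechet_derivative f (at x) v)))"

definition smooth :: "('a::real_normed_vector \<Rightarrow> 'b::real_normed_vector) \<Rightarrow> bool" where
  "smooth f \<longleftrightarrow> (\<forall>k. C_upto k f)"

definition curve_length ::
    "('a::euclidean_space \<Rightarrow> 'a \<Rightarrow> 'a \<Rightarrow> real) \<Rightarrow> (real \<Rightarrow> 'a) \<Rightarrow> real" where
  "curve_length g c = integral {0..1}
     (\<lambda>t. sqrt (g (c t) (vector_derivative c (at t)) (vector_derivative c (at t))))"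

text \<open>
  The library's piecewise \<open>C\<^sup>1\<close> paths may have unbounded speed near the finitely many break points.
  Integrability of the speed is therefore required explicitly: without it the integral,
  hence the length, would be the junk value 0.
\<close>

definition admissible_path ::
    "'a::euclidean_space set \<Rightarrow> ('a \<Rightarrow> 'a \<Rightarrow> 'a \<Rightarrow> real) \<Rightarrow> (real \<Rightarrow> 'a) \<Rightarrow> bool" where
  "admissible_path M g c \<longleftrightarrow> c piecewise_C1_differentiable_on {0..1} \<and> path_image c \<subseteq> M \<and>
     (\<lambda>t. sqrt (g (c t) (vector_derivative c (at t)) (vector_derivative c (at t))))
       integrable_on {0..1}"

definition riemannian_dist ::
    "'a::euclidean_space set \<Rightarrow> ('a \<Rightarrow> 'a \<Rightarrow> 'a \<Rightarrow> real) \<Rightarrow> 'a \<Rightarrow> 'a \<Rightarrow> real" where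
  "riemannian_dist M g x y =
     Inf {curve_length g c | c. admissible_path M g c \<and> pathstart c = x \<and> pathfinish c = y}"

text \<open>The derivative at \<open>x \<in> M\<close>, in the direction \<open>v \<in> T x\<close>, of a function on \<open>M\<close>.\<close>

definition tangent_derivative ::
    "'a::euclidean_space set \<Rightarrow> ('a \<Rightarrow> real) \<Rightarrow> 'a \<Rightarrow> 'a \<Rightarrow> real" where
  "tangent_derivative M f x v = (THE d. \<forall>c::real \<Rightarrow> 'a.
     c 0 = x \<and> (\<forall>s. c s \<in> M) \<and> (c has_vector_derivative v) (at 0)
       \<longrightarrow> ((\<lambda>s. f (c s)) has_real_derivative d) (at 0))"

text \<open>
  Since \<open>M\<close> is closed, every smooth vector field on \<open>M\<close> is the restriction of a smooth map of the
  ambient space. The values at points of \<open>M\<close> of the constructions below depend only on this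
  restriction.
\<close>

definition tangent_field ::
    "'a::euclidean_space set \<Rightarrow> ('a \<Rightarrow> 'a set) \<Rightarrow> ('a \<Rightarrow> 'a) \<Rightarrow> bool" where
  "tangent_field M T X \<longleftrightarrow> smooth X \<and> (\<forall>x\<in>M. X x \<in> T x)"

definition lie_bracket ::
    "('a::euclidean_space \<Rightarrow> 'a) \<Rightarrow> ('a \<Rightarrow> 'a) \<Rightarrow> 'a \<Rightarrow> 'a" where
  "lie_bracket X Y x = frechet_derivative Y (at x) (X x) - frechet_derivative X (at x) (Y x)"

text \<open>
  The right-hand side of Koszul's formula for \<open>2 g(\<nabla>\<^sub>X Y, Z)\<close>. The Levi-Civita derivative
  \<open>\<nabla>\<^sub>v Y\<close> at \<open>x\<close> is the tangent vector determined by it, for fields \<open>X\<close> with \<open>X x = v\<close>.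
\<close>

definition koszul ::
    "'a::euclidean_space set \<Rightarrow> ('a \<Rightarrow> 'a \<Rightarrow> 'a \<Rightarrow> real) \<Rightarrow>
     ('a \<Rightarrow> 'a) \<Rightarrow> ('a \<Rightarrow> 'a) \<Rightarrow> ('a \<Rightarrow> 'a) \<Rightarrow> 'a \<Rightarrow> real" where
  "koszul M g X Y Z x =
     tangent_derivative M (\<lambda>y. g y (Y y) (Z y)) x (X x)
   + tangent_derivative M (\<lambda>y. g y (X y) (Z y)) x (Y x)
   - tangent_derivative M (\<lambda>y. g y (X y) (Y y)) x (Z x)
   + g x (lie_bracket X Y x) (Z x)
   - g x (lie_bracket X Z x) (Y x)
   - g x (lie_bracket Y Z x) (X x)"

definition levi_civita ::
    "'a::euclidean_space set \<Rightarrow> ('a \<Rightarrow> 'a set) \<Rightarrow> ('a \<Rightarrow> 'a \<Rightarrow> 'a \<Rightarrow> real) \<Rightarrow>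
     'a \<Rightarrow> 'a \<Rightarrow> ('a \<Rightarrow> 'a) \<Rightarrow> 'a" where
  "levi_civita M T g x v Y = (THE u. u \<in> T x \<and>
     (\<forall>X Z. tangent_field M T X \<and> tangent_field M T Z \<and> X x = v
        \<longrightarrow> 2 * g x u (Z x) = koszul M g X Y Z x))"

text \<open>
  The Levi-Civita covariant derivative \<open>D\<^sub>t V\<close> of a vector field \<open>V\<close> along a curve \<open>c\<close> in \<open>M\<close>. It is
  determined by \<open>D\<^sub>t (Z \<circ> c) = \<nabla>\<^bsub>c'\<^esub> Z\<close> and compatibility with the metric,
  \<open>(g(V, Z \<circ> c))' = g(D\<^sub>t V, Z \<circ> c) + g(V, \<nabla>\<^bsub>c'\<^esub> Z)\<close>, for all vector fields \<open>Z\<close> on \<open>M\<close>.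
\<close>

definition covariant_derivative_along ::
    "'a::euclidean_space set \<Rightarrow> ('a \<Rightarrow> 'a set) \<Rightarrow> ('a \<Rightarrow> 'a \<Rightarrow> 'a \<Rightarrow> real) \<Rightarrow>
     (real \<Rightarrow> 'a) \<Rightarrow> (real \<Rightarrow> 'a) \<Rightarrow> real \<Rightarrow> 'a" where
  "covariant_derivative_along M T g c V t = (THE u. u \<in> T (c t) \<and>
     (\<forall>Z. tangent_field M T Z \<longrightarrow>
        deriv (\<lambda>s. g (c s) (V s) (Z (c s))) t =
          g (c t) u (Z (c t))
        + g (c t) (V t) (levi_civita M T g (c t) (vector_derivative c (at t)) Z)))"

text \<open>Geodesics are defined on the whole real line, as is appropriate for complete \<open>M\<close>.\<close>

definition geodesic ::
    "'a::euclidean_space set \<Rightarrow> ('a \<Rightarrow> 'a set) \<Rightarrow> ('a \<Rightarrow> 'a \<Rightarrow> 'a \<Rightarrow> real) \<Rightarrow>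
     (real \<Rightarrow> 'a) \<Rightarrow> bool" where
  "geodesic M T g c \<longleftrightarrow> smooth c \<and> (\<forall>t. c t \<in> M) \<and>
     (\<forall>t. covariant_derivative_along M T g c (\<lambda>s. vector_derivative c (at s)) t = 0)"

definition geodesic_from ::
    "'a::euclidean_space set \<Rightarrow> ('a \<Rightarrow> 'a set) \<Rightarrow> ('a \<Rightarrow> 'a \<Rightarrow> 'a \<Rightarrow> real) \<Rightarrow>
     'a \<Rightarrow> 'a \<Rightarrow> real \<Rightarrow> 'a" where
  "geodesic_from M T g x \<xi> =
     (THE c. geodesic M T g c \<and> c 0 = x \<and> vector_derivative c (at 0) = \<xi>)"

definition cut_time ::
    "'a::euclidean_space set \<Rightarrow> ('a \<Rightarrow> 'a set) \<Rightarrow> ('a \<Rightarrow> 'a \<Rightarrow> 'a \<Rightarrow> real) \<Rightarrow>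
     'a \<Rightarrow> 'a \<Rightarrow> ereal" where
  "cut_time M T g x \<xi> =
     Sup {ereal t | t. t > 0 \<and> riemannian_dist M g x (geodesic_from M T g x \<xi> t) = t}"

definition injectivity_radius_at ::
    "'a::euclidean_space set \<Rightarrow> ('a \<Rightarrow> 'a set) \<Rightarrow> ('a \<Rightarrow> 'a \<Rightarrow> 'a \<Rightarrow> real) \<Rightarrow> 'a \<Rightarrow> ereal" where
  "injectivity_radius_at M T g x = Inf {cut_time M T g x \<xi> | \<xi>. \<xi> \<in> T x \<and> sqrt (g x \<xi> \<xi>) = 1}"

definition injectivity_radius ::
    "'a::euclidean_space set \<Rightarrow> ('a \<Rightarrow> 'a set) \<Rightarrow> ('a \<Rightarrow> 'a \<Rightarrow> 'a \<Rightarrow> real) \<Rightarrow> ereal" where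
  "injectivity_radius M T g = Inf {injectivity_radius_at M T g x | x. x \<in> M}"

section \<open>The Stiefel manifold\<close>

text \<open>
  The \<open>n\<close> rows are indexed by \<open>'p + 'q\<close> with \<open>p = CARD('p)\<close> and \<open>n - p = CARD('q)\<close>: the
  first \<open>p\<close> rows by the left summand, the last \<open>n - p\<close> rows by the right one. Since types are
  nonempty this covers exactly the pairs with \<open>1 \<le> p < n\<close>.
\<close>

definition stack :: "real^'p^'p \<Rightarrow> real^'p^'q::finite \<Rightarrow> real^'p^('p + 'q)" where
  "stack A H = (\<chi> i. case i of Inl j \<Rightarrow> A $ j | Inr k \<Rightarrow> H $ k)"

definition I_np :: "real^'p^('p + 'q::finite)" where
  "I_np = stack (mat 1) 0"

definition skew_symmetric :: "real^'p^'p \<Rightarrow> bool" where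
  "skew_symmetric A \<longleftrightarrow> transpose A = - A"

definition stiefel :: "(real^'p^('p + 'q::finite)) set" where
  "stiefel = {X. transpose X ** X = mat 1}"

definition stiefel_tangent :: "real^'p^('p + 'q::finite) \<Rightarrow> (real^'p^('p + 'q)) set" where
  "stiefel_tangent X =
     {Q ** stack A H | Q A H. orthogonal_matrix Q \<and> X = Q ** I_np \<and> skew_symmetric A}"

text \<open>Well-defined, because the value does not depend on the choice of \<open>Q\<close>.\<close>

definition stiefel_metric ::
    "real \<Rightarrow> real^'p^('p + 'q::finite) \<Rightarrow> real^'p^('p + 'q) \<Rightarrow> real^'p^('p + 'q) \<Rightarrow> real" where
  "stiefel_metric \<beta> X \<xi>a \<xi>b = (THE r. \<exists>Q Aa Ha Ab Hb.
     orthogonal_matrix Q \<and> X = Q ** I_np \<and> skew_symmetric Aa \<and> skew_symmetric Ab \<and>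
     \<xi>a = Q ** stack Aa Ha \<and> \<xi>b = Q ** stack Ab Hb \<and>
     r = \<beta> * trace (transpose Aa ** Ab) + trace (transpose Ha ** Hb))"

definition stiefel_inj :: "'p::finite itself \<Rightarrow> 'q::finite itself \<Rightarrow> real \<Rightarrow> ereal" where
  "stiefel_inj _ _ \<beta> =
     injectivity_radius (stiefel :: (real^'p^('p + 'q)) set) stiefel_tangent (stiefel_metric \<beta>)"

definition t_r :: real where
  "t_r = (LEAST t. t > 0 \<and> sin t / t + cos t = 0)"

end

theory Submission
  imports Defs
begin

text \<open>
  In the ambient form \<open>g\<^sub>X(u, w) = u \<bullet> w - (1 - \<beta>) (X\<^sup>T u) \<bullet> (X\<^sup>T w)\<close> of the metric, left multiplication by
  skew matrices gives Killing fields which span the tangent spaces. Hence a curve is a geodesic iff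
  its momentum is constant, and the momentum determines the velocity, which makes the geodesic
  equation a first-order equation with a locally Lipschitz right-hand side.

  The bound \<open>\<pi>\<close> comes from a closed geodesic of length \<open>2\<pi>\<close>, the rotation of a single column. For
  \<open>p, n - p \<ge> 2\<close> the manifold contains a Berger sphere \<open>S\<^sup>3 \<subseteq> \<complex>\<^sup>2\<close>. Its horizontal geodesic
  \<open>(cos s, sin s)\<close> has length \<open>\<surd>2 s\<close>, and once \<open>s\<close> exceeds the first conjugate value an explicit
  shorter geodesic with the same end points bifurcates from it.

  For the lower bounds at \<open>p = n - 1\<close> and \<open>p = 1\<close>, a path of rotations from \<open>I\<close> to \<open>exp(tP)\<close> moves every
  vector of an orthonormal eigenbasis of \<open>P\<^sup>2\<close> along a path on the unit sphere. The lengths of these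
  paths are at least the rotation angles, and the Cauchy-Schwarz inequality combines them.
\<close>

section \<open>Matrices\<close>

text \<open>\<open>tangent_derivative\<close>, \<open>levi_civita\<close> and
  \<open>covariant_derivative_along\<close> are \<open>THE\<close> terms, so each needs existence
  and uniqueness. Killing fields supply curves and globally smooth test fields through every tangent
  vector; \<open>stiefel_riesz\<close> supplies the representing vectors. The explicit geodesics are
  orbits exp(tP) X whose generator P equals their momentum. This is automatic for \<beta> = 1/2, and
  true for every \<beta> if the velocity v satisfies X^T v = 0. A cut time is a supremum over all t
  with dist = t, so an upper bound needs a shorter path for every later t. Hence the two regimes on
  the Berger sphere: bifurcation for s up to pi, and closing up of the geodesic beyond pi. The
  constant arises because \<omega>^2 + b^2, restricted to cos \<omega> = cos s cos b, has at b = 0 a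
  second derivative of the sign of 1 + s cos s / sin s. It changes sign where sin s + s cos s = 0;
  the factor sqrt 2 is the speed in s. In the lower bounds unit speed means that P has squared norm
  2. The nonzero singular values of a skew matrix come in pairs, so no rotation angle exceeds t, and
  up to t = pi all angles stay in the range of arccos. Weighting each sphere path by its own total
  angle makes Cauchy-Schwarz sharp on the geodesic.\<close>

lemma inner_matrix_conv_trace: "A \<bullet> B = trace (transpose A ** B)" for A B :: "real^'n^'m"
  unfolding inner_vec_def trace_def matrix_matrix_mult_def transpose_def
  by (simp, rule sum.swap)

lemma inner_transpose: "transpose A \<bullet> transpose B = A \<bullet> B" for A B :: "real^'n^'m"
  unfolding inner_vec_def transpose_def by (simp, rule sum.swap)

lemma inner_matrix_mult_left: "(A ** B) \<bullet> C = B \<bullet> (transpose A ** C)"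
  for A :: "real^'k^'m" and B :: "real^'n^'k"
  by (simp add: inner_matrix_conv_trace matrix_transpose_mul matrix_mul_assoc)

lemma inner_matrix_mult_right: "(A ** B) \<bullet> C = A \<bullet> (C ** transpose B)"
  for A :: "real^'k^'m" and B :: "real^'n^'k"
proof -
  have "(A ** B) \<bullet> C = (transpose B ** transpose A) \<bullet> transpose C"
    by (metis inner_transpose matrix_transpose_mul)
  also have "\<dots> = transpose A \<bullet> transpose (C ** transpose B)"
    by (simp add: inner_matrix_mult_left matrix_transpose_mul)
  finally show ?thesis
    by (simp add: inner_transpose)
qed

lemma transpose_add: "transpose (A + B) = transpose A + transpose B"
  and transpose_diff: "transpose (A - B) = transpose A - transpose B"
  and transpose_minus: "transpose (- A) = - transpose A"
  and transpose_scaleR: "transpose (r *\<^sub>R A) = r *\<^sub>R transpose A"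
  and transpose_zero [simp]: "transpose (0 :: real^'n^'m) = 0"
  for A B :: "real^'n^'m"
  by (simp_all add: transpose_def vec_eq_iff)

lemma linear_transpose: "linear (transpose :: real^'n^'m \<Rightarrow> real^'m^'n)"
  by (rule linearI) (simp_all add: transpose_add transpose_scaleR)

lemma bounded_linear_transpose: "bounded_linear (transpose :: real^'n^'m \<Rightarrow> real^'m^'n)"
  using linear_transpose by (simp add: linear_conv_bounded_linear)

lemma bounded_bilinear_matrix_mult:
  "bounded_bilinear ((**) :: real^'k^'m \<Rightarrow> real^'n^'k \<Rightarrow> real^'n^'m)"
  unfolding bilinear_conv_bounded_bilinear [symmetric] bilinear_def
  by (auto intro!: linearI simp: matrix_matrix_mult_def vec_eq_iff sum.distrib algebra_simps sum_distrib_left)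

interpretation matrix_mult: bounded_bilinear "(**) :: real^'k^'m \<Rightarrow> real^'n^'k \<Rightarrow> real^'n^'m"
  by (rule bounded_bilinear_matrix_mult)

lemmas has_vector_derivative_matrix_mult = matrix_mult.has_vector_derivative
lemmas has_vector_derivative_transpose = bounded_linear.has_vector_derivative [OF bounded_linear_transpose]

lemmas matrix_alg_simps = matrix_mult.add_left matrix_mult.add_right matrix_mult.diff_left
  matrix_mult.diff_right matrix_mult.minus_left matrix_mult.minus_right matrix_mult.scaleR_left
  matrix_mult.scaleR_right transpose_add transpose_diff transpose_minus transpose_scaleR
  matrix_transpose_mul matrix_mul_assoc [symmetric]

lemma skew_inner_symmetric:
  fixes A S :: "real^'n^'n"
  assumes "transpose A = - A" "transpose S = S" shows "A \<bullet> S = 0"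
  using inner_transpose [of A S] assms by simp

lemma skew_mult_inner_self:
  fixes P :: "real^'m^'m" and X :: "real^'n^'m"
  assumes "transpose P = - P" shows "(P ** X) \<bullet> X = 0"
proof -
  have "(P ** X) \<bullet> X = - (X \<bullet> (P ** X))"
    by (simp add: inner_matrix_mult_left assms matrix_alg_simps)
  thus ?thesis by (simp add: inner_commute)
qed

lemma skew_inner_vec:
  fixes P :: "real^'m^'m"
  assumes "transpose P = - P" shows "(P *v x) \<bullet> y = - (x \<bullet> (P *v y))"
proof -
  have "P *v x = - (x v* P)"
    unfolding transpose_matrix_vector [symmetric] assms
    by (simp add: matrix_vector_mult_def vec_eq_iff sum_negf)
  thus ?thesis by (simp add: dot_lmul_matrix)
qed

lemma skew_symmetric_1: "CARD('p::finite) = 1 \<Longrightarrow> transpose A = - A \<Longrightarrow> A = 0" for A :: "real^'p^'p"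
proof -
  assume "CARD('p) = 1" and A: "transpose A = - A"
  then obtain a :: 'p where a: "UNIV = {a}" by (metis card_1_singletonE)
  have "A $ i $ j = 0" for i j
  proof -
    have "i = a" "j = a" using a by auto
    moreover have "transpose A $ a $ a = (- A) $ a $ a" using A by simp
    ultimately show ?thesis by (simp add: transpose_def)
  qed
  thus "A = 0" by (simp add: vec_eq_iff)
qed

lemma constant_of_derivative_zero:
  fixes f :: "real \<Rightarrow> 'a::real_normed_vector"
  assumes "\<And>t. (f has_vector_derivative 0) (at t)"
  shows "f t = f (0::real)"
proof -
  obtain c where "\<And>x. x \<in> UNIV \<Longrightarrow> f x = c"
    using has_vector_derivative_zero_constant [of UNIV f] assms by auto
  thus ?thesis by simp
qed

text \<open>For f' = P f with P skew this is conservation of the norm. With f 0 = 0 it gives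
  uniqueness for such linear equations.\<close>

lemma constant_norm_of_orthogonal_derivative:
  fixes f :: "real \<Rightarrow> 'a::real_inner"
  assumes "\<And>t. (f has_vector_derivative f' t) (at t)" "\<And>t. f' t \<bullet> f t = 0"
  shows "f t \<bullet> f t = f 0 \<bullet> f (0::real)"
proof -
  have "((\<lambda>t. f t \<bullet> f t) has_vector_derivative 0) (at t)" for t
    using bounded_bilinear.has_vector_derivative [OF bounded_bilinear_inner assms(1) assms(1)] assms(2)
    by (simp add: inner_commute)
  thus ?thesis by (rule constant_of_derivative_zero)
qed

section \<open>One-parameter groups of rotations\<close>

text \<open>A maximizer e of the Rayleigh quotient on the unit sphere of V is an eigenvector: the
  residual r = f e - l e is orthogonal to e, and moving from e along r would raise the quotient to
  first order.\<close>

lemma self_adjoint_eigenvector: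
  fixes f :: "'a::euclidean_space \<Rightarrow> 'a"
  assumes f: "linear f" "\<And>x y. f x \<bullet> y = x \<bullet> f y"
    and V: "subspace V" "f ` V \<subseteq> V" "V \<noteq> {0}"
  obtains e l where "e \<in> V" "norm e = 1" "f e = l *\<^sub>R e"
proof -
  have V0: "0 \<in> V" using V subspace_0 by blast
  with V(3) obtain v where v: "v \<in> V" "v \<noteq> 0" by blast
  let ?K = "V \<inter> sphere 0 1"
  have K: "compact ?K"
    using compact_Int_closed [OF compact_sphere closed_subspace [OF V(1)]] by (simp add: Int_commute)
  have "(1 / norm v) *\<^sub>R v \<in> ?K"
    using v V(1) by (simp add: subspace_scale)
  hence "?K \<noteq> {}" by blast
  moreover have "continuous_on ?K (\<lambda>x. x \<bullet> f x)"
    using f(1) by (intro continuous_on_inner continuous_on_id linear_continuous_on)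
      (simp add: linear_conv_bounded_linear)
  ultimately obtain e where e: "e \<in> ?K" "\<And>x. x \<in> ?K \<Longrightarrow> x \<bullet> f x \<le> e \<bullet> f e"
    using continuous_attains_sup [OF K] by metis
  define l where "l = e \<bullet> f e"
  have ee: "e \<bullet> e = 1" using e by (simp add: norm_eq_1)
  have le: "x \<bullet> f x \<le> l * (x \<bullet> x)" if "x \<in> V" for x
  proof (cases "x = 0")
    case False
    have "(1 / norm x) *\<^sub>R x \<in> ?K" using that False V(1) by (simp add: subspace_scale)
    from e(2) [OF this] have "(x \<bullet> f x) / (norm x)\<^sup>2 \<le> l"
      using f(1) by (simp add: linear_cmul power2_eq_square l_def)
    thus ?thesis using False by (simp add: field_simps power2_norm_eq_inner)
  qed (use f in \<open>simp add: linear_0\<close>)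
  define r where "r = f e - l *\<^sub>R e"
  have rV: "r \<in> V" using V e by (auto simp: r_def intro!: subspace_diff subspace_scale)
  have "e \<bullet> r = 0" by (simp add: r_def l_def inner_diff_right ee)
  hence re: "r \<bullet> e = 0" by (simp add: inner_commute)
  have rfe: "r \<bullet> f e = r \<bullet> r"
  proof -
    have "f e = r + l *\<^sub>R e" by (simp add: r_def)
    thus ?thesis by (simp add: inner_add_right re)
  qed
  have "r = 0"
  proof (rule ccontr)
    assume "r \<noteq> 0"
    hence rr: "r \<bullet> r > 0" by simp
    define K where "K = l * (r \<bullet> r) - r \<bullet> f r"
    \<comment> \<open>Small enough that the second-order term s * s * K cannot absorb the
      first-order gain 2 * s * (r \<bullet> r); the 1 in the denominator covers K = 0.\<close>
    define s where "s = (r \<bullet> r) / (\<bar>K\<bar> + 1)"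
    have s: "s > 0" using rr by (simp add: s_def)
    have "e + s *\<^sub>R r \<in> V" using V e rV by (auto intro!: subspace_add subspace_scale)
    note le [OF this]
    moreover have "(e + s *\<^sub>R r) \<bullet> (e + s *\<^sub>R r) = 1 + s * s * (r \<bullet> r)"
      using re by (simp add: inner_add_left inner_add_right ee inner_commute [of e r])
    moreover have "e \<bullet> f r = r \<bullet> r"
      using rfe f(2) [of e r] by (simp add: inner_commute)
    hence "(e + s *\<^sub>R r) \<bullet> f (e + s *\<^sub>R r) = l + 2 * s * (r \<bullet> r) + s * s * (r \<bullet> f r)"
      using rfe f(1) by (simp add: linear_add linear_cmul inner_add_left inner_add_right l_def algebra_simps)
    ultimately have "l + 2 * s * (r \<bullet> r) + s * s * (r \<bullet> f r) \<le> l * (1 + s * s * (r \<bullet> r))"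
      by simp
    hence "s * (2 * (r \<bullet> r)) \<le> s * (s * K)" by (simp add: K_def algebra_simps)
    hence "2 * (r \<bullet> r) \<le> s * K" using s by simp
    also have "\<dots> \<le> s * (\<bar>K\<bar> + 1)" using s by (intro mult_left_mono) auto
    also have "\<dots> = r \<bullet> r" by (simp add: s_def)
    finally show False using rr by simp
  qed
  hence "f e = l *\<^sub>R e" by (simp add: r_def)
  with e show ?thesis by (intro that [of e l]) auto
qed

text \<open>Induction on the dimension: split off one eigenvector; by self-adjointness its
  orthogonal complement W in V is again invariant.\<close>

lemma self_adjoint_eigenbasis:
  fixes f :: "'a::euclidean_space \<Rightarrow> 'a"
  assumes f: "linear f" "\<And>x y. f x \<bullet> y = x \<bullet> f y"
    and V: "subspace V" "f ` V \<subseteq> V"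
  shows "\<exists>B. finite B \<and> B \<subseteq> V \<and> pairwise orthogonal B \<and>
    (\<forall>e\<in>B. norm e = 1 \<and> (\<exists>l. f e = l *\<^sub>R e)) \<and> V \<subseteq> span B"
  using V
proof (induction "dim V" arbitrary: V rule: less_induct)
  case less
  show ?case
  proof (cases "V = {0}")
    case True
    thus ?thesis by (intro exI [of _ "{}"]) auto
  next
    case False
    then obtain e l where e: "e \<in> V" "norm e = 1" "f e = l *\<^sub>R e"
      using self_adjoint_eigenvector [OF f less.prems] by blast
    have ee: "e \<bullet> e = 1" using e by (simp add: norm_eq_1)
    define W where "W = {x \<in> V. x \<bullet> e = 0}"
    have "V \<inter> {x. e \<bullet> x = 0} = W" by (auto simp: W_def inner_commute)
    hence W: "subspace W"
      using subspace_inter [OF less.prems(1) subspace_hyperplane [of e]] by metis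
    have "f x \<bullet> e = 0" if "x \<bullet> e = 0" for x
      using that e(3) f(2) by simp
    hence fW: "f ` W \<subseteq> W" using less.prems by (auto simp: W_def)
    have "e \<notin> W" using ee by (simp add: W_def)
    moreover have "W \<subseteq> V" by (auto simp: W_def)
    ultimately have "W \<subset> V" using e by blast
    hence "dim W < dim V"
      using dim_psubset [of W V] W less.prems(1) by (metis span_eq_iff)
    from less.hyps [OF this W fW] obtain B where B: "finite B" "B \<subseteq> W" "pairwise orthogonal B"
      "\<forall>e\<in>B. norm e = 1 \<and> (\<exists>l. f e = l *\<^sub>R e)" "W \<subseteq> span B" by blast
    show ?thesis
    proof (intro exI [of _ "insert e B"] conjI)
      show "pairwise orthogonal (insert e B)"
        using B(2,3) by (auto simp: pairwise_insert orthogonal_def W_def inner_commute)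
      show "V \<subseteq> span (insert e B)"
      proof
        fix x assume x: "x \<in> V"
        have "x - (x \<bullet> e) *\<^sub>R e \<in> W"
          using x e less.prems(1) by (auto simp: W_def inner_diff_left ee intro!: subspace_diff subspace_scale)
        hence "x - (x \<bullet> e) *\<^sub>R e \<in> span (insert e B)"
          using B(5) span_mono [of B "insert e B"] by blast
        from span_add [OF this span_scale [OF span_base [of e "insert e B"], of "x \<bullet> e"]]
        show "x \<in> span (insert e B)" by simp
      qed
    qed (use B e less.prems in \<open>auto simp: W_def\<close>)
  qed
qed

text \<open>\<open>E t\<close> is exp(tP), described by its initial value problem instead of a
  series, with skewness of P built in.\<close>

definition skew_flow :: "real^'m^'m \<Rightarrow> (real \<Rightarrow> real^'m^'m) \<Rightarrow> bool" where
  "skew_flow P E \<longleftrightarrow> transpose P = - P \<and> (\<forall>t. (E has_vector_derivative P ** E t) (at t)) \<and> E 0 = mat 1"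

text \<open>P has in general no real eigenbasis, but its square is self-adjoint. By skewness the
  eigenvalue at a unit vector e equals minus the squared norm of P e.\<close>

lemma skew_eigenbasis:
  fixes P :: "real^'m^'m"
  assumes P: "transpose P = - P"
  obtains B where "finite B" "pairwise orthogonal B" "\<And>e. e \<in> B \<Longrightarrow> norm e = 1"
    "\<And>x. (\<Sum>e\<in>B. (x \<bullet> e) *\<^sub>R e) = x"
    "\<And>e. e \<in> B \<Longrightarrow> P *v (P *v e) = - (norm (P *v e))\<^sup>2 *\<^sub>R e"
proof -
  have "linear (\<lambda>x. P *v (P *v x))"
    using linear_compose [of "(*v) P" "(*v) P"] by (simp add: o_def)
  moreover have "(P *v (P *v x)) \<bullet> y = x \<bullet> (P *v (P *v y))" for x y
    by (simp add: skew_inner_vec [OF P])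
  ultimately obtain B where B: "finite B" "pairwise orthogonal B"
    "\<forall>e\<in>B. norm e = 1 \<and> (\<exists>l. P *v (P *v e) = l *\<^sub>R e)" "UNIV \<subseteq> span B"
    using self_adjoint_eigenbasis [of "\<lambda>x. P *v (P *v x)" UNIV] by auto
  show thesis
  proof (rule that [of B])
    show "(\<Sum>e\<in>B. (x \<bullet> e) *\<^sub>R e) = x" for x
      using orthonormal_basis_expand [of B x] B by auto
    show "P *v (P *v e) = - (norm (P *v e))\<^sup>2 *\<^sub>R e" if e: "e \<in> B" for e
    proof -
      obtain l where l: "P *v (P *v e) = l *\<^sub>R e" and "norm e = 1" using B e by blast
      have "(norm (P *v e))\<^sup>2 = - (e \<bullet> (P *v (P *v e)))"
        by (simp add: power2_norm_eq_inner skew_inner_vec [OF P])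
      also have "\<dots> = - l" using \<open>norm e = 1\<close> by (simp add: l norm_eq_1)
      finally show ?thesis using l by simp
    qed
  qed (use B in auto)
qed

text \<open>On the plane of e and P e the exponential is the rotation by the angle t * \<theta> e.
  Applying these rotations to the rank-one projections \<open>O' e\<close> and summing gives a
  closed formula for exp(tP).\<close>

lemma skew_flow_exists:
  fixes P :: "real^'m^'m"
  assumes P: "transpose P = - P"
  shows "\<exists>E. skew_flow P E"
proof -
  obtain B where B': "finite B" "pairwise orthogonal B" "\<And>e. e \<in> B \<Longrightarrow> norm e = 1"
    "\<And>x. (\<Sum>e\<in>B. (x \<bullet> e) *\<^sub>R e) = x"
    "\<And>e. e \<in> B \<Longrightarrow> P *v (P *v e) = - (norm (P *v e))\<^sup>2 *\<^sub>R e"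
    by (rule skew_eigenbasis [OF P]) blast
  note B = B'(1,4,5)
  define O' :: "real^'m \<Rightarrow> real^'m^'m" where "O' e = matrix (\<lambda>x. (x \<bullet> e) *\<^sub>R e)" for e
  have O': "O' e *v x = (x \<bullet> e) *\<^sub>R e" for e x
    unfolding O'_def by (rule matrix_works)
      (auto intro!: linearI simp: inner_add_left algebra_simps linear_matrix_vector_mul_eq)
  define \<theta> where "\<theta> e = norm (P *v e)" for e
  \<comment> \<open>For \<open>\<theta> e = 0\<close> the quotient is 0 by division by zero, which
    is harmless because then \<open>P ** O' e = 0\<close>.\<close>
  define E where "E t = (\<Sum>e\<in>B. cos (t * \<theta> e) *\<^sub>R O' e + (sin (t * \<theta> e) / \<theta> e) *\<^sub>R (P ** O' e))" for t
  have PPO: "P ** (P ** O' e) = - (\<theta> e)\<^sup>2 *\<^sub>R O' e" if "e \<in> B" for e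
  proof (subst matrix_eq, rule)
    fix x
    show "(P ** (P ** O' e)) *v x = (- (\<theta> e)\<^sup>2 *\<^sub>R O' e) *v x"
      unfolding scaleR_matrix_vector_assoc [symmetric] matrix_vector_mul_assoc [symmetric] O'
        matrix_vector_mult_scaleR B(3) [OF that] \<theta>_def
      by simp
  qed
  have PO: "P ** O' e = 0" if "\<theta> e = 0" for e
    using that by (subst matrix_eq)
      (simp add: matrix_vector_mul_assoc [symmetric] O' matrix_vector_mult_scaleR \<theta>_def)
  have "E 0 = mat 1"
  proof (subst matrix_eq, rule)
    fix x
    have "E 0 *v x = (\<Sum>e\<in>B. O' e *v x)"
      by (simp add: E_def) (induction B rule: infinite_finite_induct; simp add: matrix_vector_mult_add_rdistrib)
    also have "\<dots> = x" by (simp add: O' B)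
    finally show "E 0 *v x = mat 1 *v x" by simp
  qed
  moreover have "(E has_vector_derivative P ** E t) (at t)" for t
  proof -
    have eq: "P ** E t = (\<Sum>e\<in>B. (- \<theta> e * sin (t * \<theta> e)) *\<^sub>R O' e + cos (t * \<theta> e) *\<^sub>R (P ** O' e))"
      unfolding E_def matrix_mult.sum_right
      by (rule sum.cong) (auto simp: matrix_mult.add_right matrix_mult.scaleR_right PPO power2_eq_square)
    have "((\<lambda>t. cos (t * \<theta> e) *\<^sub>R O' e + (sin (t * \<theta> e) / \<theta> e) *\<^sub>R (P ** O' e))
        has_vector_derivative (- \<theta> e * sin (t * \<theta> e)) *\<^sub>R O' e + cos (t * \<theta> e) *\<^sub>R (P ** O' e)) (at t)" for e
      by (cases "\<theta> e = 0")
        (auto simp: PO intro!: derivative_eq_intros simp flip: scaleR_minus_left)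
    thus ?thesis unfolding eq unfolding E_def by (rule has_vector_derivative_sum)
  qed
  ultimately show ?thesis using P unfolding skew_flow_def by blast
qed

lemma skew_flowD:
  assumes "skew_flow P E"
  shows "transpose P = - P" "\<And>t. (E has_vector_derivative P ** E t) (at t)" "E 0 = mat 1"
  using assms unfolding skew_flow_def by auto

lemma skew_flow_orthogonal:
  assumes "skew_flow P E" shows "transpose (E t) ** E t = mat 1"
proof -
  note E = skew_flowD [OF assms]
  have "((\<lambda>t. transpose (E t) ** E t) has_vector_derivative 0) (at t)" for t
    using has_vector_derivative_matrix_mult [OF has_vector_derivative_transpose [OF E(2)] E(2)]
    by (simp add: E(1) matrix_alg_simps)
  from constant_of_derivative_zero [OF this] show ?thesis by (simp add: E(3))
qed

text \<open>The commutator solves y' = P y and vanishes at 0; its norm is conserved because P is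
  skew.\<close>

lemma skew_flow_commute:
  assumes "skew_flow P E" shows "P ** E t = E t ** P"
proof -
  note E = skew_flowD [OF assms]
  let ?F = "\<lambda>t. P ** E t - E t ** P"
  have "(?F has_vector_derivative P ** ?F t) (at t)" for t
    by (auto intro!: derivative_eq_intros E bounded_linear.has_vector_derivative [OF matrix_mult.bounded_linear_right]
        bounded_linear.has_vector_derivative [OF matrix_mult.bounded_linear_left] simp: matrix_alg_simps)
  from constant_norm_of_orthogonal_derivative [OF this, of t] skew_mult_inner_self [OF E(1)]
  have "?F t \<bullet> ?F t = ?F 0 \<bullet> ?F 0" by blast
  thus ?thesis by (simp add: E(3))
qed

text \<open>The orbit of e is the rotation in the plane of e and P e: the difference of the two
  solves y' = P y from 0. So e and its image enclose the angle t * norm (P e), up to multiples of 2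
  pi and sign.\<close>

lemma skew_flow_eigenvector:
  assumes E: "skew_flow P E" and e: "norm e = 1" "P *v (P *v e) = - (norm (P *v e))\<^sup>2 *\<^sub>R e"
  shows "e \<bullet> (E t *v e) = cos (t * norm (P *v e))"
proof -
  note D = skew_flowD [OF E]
  define \<theta> where "\<theta> = norm (P *v e)"
  let ?f = "\<lambda>t. E t *v e - (cos (t * \<theta>) *\<^sub>R e + (sin (t * \<theta>) / \<theta>) *\<^sub>R (P *v e))"
  have d: "((\<lambda>t. E t *v e) has_vector_derivative P *v (E t *v e)) (at t)" for t
    using bounded_linear.has_vector_derivative [OF _ D(2), of "\<lambda>A. A *v e" t]
    by (simp add: matrix_vector_mul_assoc linear_conv_bounded_linear [symmetric] linear_iff
        matrix_vector_mult_add_rdistrib scaleR_matrix_vector_assoc)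
  have "(?f has_vector_derivative P *v ?f t) (at t)" for t
  proof (cases "\<theta> = 0")
    case True
    hence "P *v e = 0" by (simp add: \<theta>_def)
    thus ?thesis using True by (auto intro!: derivative_eq_intros d simp: matrix_vector_mult_diff_distrib)
  next
    case False
    thus ?thesis using e(2) unfolding \<theta>_def [symmetric]
      by (auto intro!: derivative_eq_intros d simp: matrix_vector_mult_diff_distrib matrix_vector_right_distrib
          matrix_vector_mult_scaleR power2_eq_square algebra_simps)
  qed
  moreover have "(P *v x) \<bullet> x = 0" for x
    using skew_inner_vec [OF D(1), of x x] by (simp add: inner_commute)
  ultimately have "?f t \<bullet> ?f t = ?f 0 \<bullet> ?f 0"
    using constant_norm_of_orthogonal_derivative [of ?f "\<lambda>t. P *v ?f t"] by blast
  hence *: "E t *v e = cos (t * \<theta>) *\<^sub>R e + (sin (t * \<theta>) / \<theta>) *\<^sub>R (P *v e)"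
    by (simp add: D(3))
  have "e \<bullet> (P *v e) = 0"
    using skew_inner_vec [OF D(1), of e e] by (simp add: inner_commute)
  thus ?thesis unfolding * using e(1) by (simp add: inner_add_right norm_eq_1 \<theta>_def)
qed

section \<open>Tangent spaces and metric of the Stiefel manifold\<close>

lemma sum_UNIV_Plus:
  "(\<Sum>i\<in>UNIV. f i) = (\<Sum>j\<in>UNIV. f (Inl j)) + (\<Sum>k\<in>UNIV. f (Inr k))"
  for f :: "'p::finite + 'q::finite \<Rightarrow> 'a::comm_monoid_add"
  unfolding UNIV_Plus_UNIV [symmetric] by (subst sum.Plus) auto

lemma stack_nth [simp]: "stack A H $ Inl j = A $ j" "stack A H $ Inr k = H $ k"
  by (simp_all add: stack_def)

lemma transpose_stack_mult:
  "transpose (stack A H) ** stack B K = transpose A ** B + transpose H ** K"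
  for H K :: "real^'p^'q::finite"
  by (simp add: vec_eq_iff matrix_matrix_mult_def transpose_def sum_UNIV_Plus)

lemma inner_stack: "stack A H \<bullet> stack B K = A \<bullet> B + H \<bullet> K" for H K :: "real^'p^'q::finite"
  by (simp add: inner_vec_def sum_UNIV_Plus)

lemma stack_split: "stack (transpose I_np ** Y) (\<chi> k. Y $ Inr k) = Y" for Y :: "real^'p^('p + 'q::finite)"
proof -
  have "(transpose I_np ** Y) $ j = Y $ Inl j" for j
    by (simp add: vec_eq_iff I_np_def matrix_matrix_mult_def transpose_def sum_UNIV_Plus mat_def
        if_distrib [where f = "\<lambda>x. x * _"] cong: if_cong)
  hence "stack (transpose I_np ** Y) (\<chi> k. Y $ Inr k) $ i = Y $ i" for i
    by (cases i) auto
  thus ?thesis by (simp add: vec_eq_iff)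
qed

lemma stiefelD: "X \<in> stiefel \<Longrightarrow> transpose X ** X = mat 1"
  by (simp add: stiefel_def)

lemma stiefel_cancel: "X \<in> stiefel \<Longrightarrow> transpose X ** (X ** Y) = Y"
  for X :: "real^'p^('p + 'q::finite)" and Y :: "real^'r^'p"
  by (simp add: matrix_mul_assoc stiefelD)

lemma I_np_stiefel: "I_np \<in> stiefel"
  by (simp add: stiefel_def I_np_def transpose_stack_mult)

text \<open>The columns of X are extended by an orthonormal basis of their orthogonal complement.
  Tangent spaces and metric are defined through such frames Q, so without one they would be empty or
  unspecified.\<close>

lemma stiefel_frame:
  fixes X :: "real^'p^('p + 'q::finite)"
  assumes X: "X \<in> stiefel"
  obtains Q where "orthogonal_matrix Q" "X = Q ** I_np"
proof -
  have col: "column i X \<bullet> column j X = (if i = j then 1 else 0)" for i j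
    using stiefelD [OF X] by (simp add: matrix_mult_transpose_dot_column vec_eq_iff mat_def)
  define S where "S = span (range (\<lambda>j. column j X))"
  have inj: "inj (\<lambda>j. column j X)"
  proof (rule injI)
    fix i j assume "column i X = column j X"
    hence "column i X \<bullet> column j X = column i X \<bullet> column i X" by simp
    thus "i = j" by (simp add: col split: if_splits)
  qed
  have "pairwise orthogonal (range (\<lambda>j. column j X))"
    using col by (auto simp: pairwise_def orthogonal_def)
  moreover have "0 \<notin> range (\<lambda>j. column j X)"
  proof
    assume "0 \<in> range (\<lambda>j. column j X)"
    then obtain j where "column j X = 0" by auto
    thus False using col [of j j] by simp
  qed
  ultimately have "independent (range (\<lambda>j. column j X))"
    by (rule pairwise_orthogonal_independent)
  hence dimS: "dim S = CARD('p)"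
    unfolding S_def dim_span by (simp add: dim_eq_card_independent card_image [OF inj])
  define V where "V = {y \<in> UNIV. \<forall>x \<in> S. orthogonal x y}"
  have "dim V + dim S = dim (UNIV :: (real^('p+'q)) set)"
    unfolding V_def by (rule dim_subspace_orthogonal_to_vectors) (auto simp: S_def)
  hence dimV: "dim V = CARD('q)" using dimS by simp
  have "subspace V"
    by (auto simp: V_def subspace_def orthogonal_clauses)
  then obtain B where B: "B \<subseteq> V" "pairwise orthogonal B" "\<And>x. x \<in> B \<Longrightarrow> norm x = 1"
     "independent B" "card B = dim V" "span B = V"
    by (rule orthonormal_basis_subspace) blast
  have "finite B" using B by (simp add: independent_imp_finite)
  then obtain f where f: "bij_betw f (UNIV :: 'q set) B"
    using finite_same_card_bij [of "UNIV :: 'q set" B] B(5) dimV by auto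
  define Q :: "real^('p+'q)^('p+'q)" where
    "Q = (\<chi> i j. case j of Inl a \<Rightarrow> X $ i $ a | Inr b \<Rightarrow> f b $ i)"
  have Qcol: "column (Inl a) Q = column a X" "column (Inr b) Q = f b" for a b
    by (simp_all add: Q_def column_def vec_eq_iff)
  have fB: "f b \<in> B" for b using f by (auto simp: bij_betw_def)
  have ff: "f b \<bullet> f b' = (if b = b' then 1 else 0)" for b b'
  proof (cases "b = b'")
    case True thus ?thesis using B(3) [OF fB] by (simp add: norm_eq_1)
  next
    case False
    hence "f b \<noteq> f b'" using f by (auto simp: bij_betw_def inj_on_def)
    thus ?thesis using B(2) fB False by (auto simp: pairwise_def orthogonal_def)
  qed
  have fc: "column a X \<bullet> f b = 0" for a b
  proof -
    have "column a X \<in> S" by (auto simp: S_def intro: span_base)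
    thus ?thesis using fB B(1) by (auto simp: V_def orthogonal_def)
  qed
  have "transpose Q ** Q = mat 1"
    unfolding matrix_mult_transpose_dot_column
  proof (simp add: vec_eq_iff mat_def, intro allI)
    fix i j show "(i = j \<longrightarrow> column j Q \<bullet> column j Q = 1) \<and> (i \<noteq> j \<longrightarrow> column i Q \<bullet> column j Q = 0)"
      by (cases i; cases j) (auto simp: Qcol col ff fc inner_commute [of "f _" "column _ _"])
  qed
  moreover have "X = Q ** I_np"
    by (simp add: vec_eq_iff I_np_def matrix_matrix_mult_def sum_UNIV_Plus Q_def mat_def
        if_distrib [where f = "\<lambda>x. _ * x"] cong: if_cong)
  ultimately show thesis using that by (simp add: orthogonal_matrix)
qed

text \<open>The A-block of a tangent vector v is X^T v whatever the frame, and the H-block enters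
  only through the full inner product. This makes the ambient formula for the metric independent of
  Q.\<close>

lemma frame_stack:
  fixes Q :: "real^('p::finite+'q::finite)^('p+'q)"
  assumes "orthogonal_matrix Q" "X = Q ** I_np"
  shows "Q ** stack (transpose X ** v) (\<chi> k. (transpose Q ** v) $ Inr k) = v"
    and "transpose X ** (Q ** stack A H) = A"
    and "(Q ** stack A H) \<bullet> (Q ** stack B K) = A \<bullet> B + H \<bullet> K"
proof -
  have QQ: "Q ** transpose Q = mat 1" "transpose Q ** Q = mat 1"
    using assms by (auto simp: orthogonal_matrix_def)
  have [simp]: "transpose Q ** (Q ** Y) = Y" for Y :: "real^'p^('p+'q)"
    by (simp add: matrix_mul_assoc QQ)
  have "stack (transpose X ** v) (\<chi> k. (transpose Q ** v) $ Inr k) = transpose Q ** v"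
    using stack_split [of "transpose Q ** v"] by (simp add: assms matrix_transpose_mul matrix_mul_assoc)
  thus "Q ** stack (transpose X ** v) (\<chi> k. (transpose Q ** v) $ Inr k) = v"
    by (simp add: matrix_mul_assoc QQ)
  show "transpose X ** (Q ** stack A H) = A"
    by (simp add: assms matrix_transpose_mul matrix_mul_assoc [symmetric])
      (simp add: I_np_def transpose_stack_mult)
  show "(Q ** stack A H) \<bullet> (Q ** stack B K) = A \<bullet> B + H \<bullet> K"
    by (simp add: inner_matrix_mult_left inner_stack)
qed

lemma stiefel_tangent_iff:
  assumes "X \<in> stiefel"
  shows "v \<in> stiefel_tangent X \<longleftrightarrow> transpose (transpose X ** v) = - (transpose X ** v)"
proof
  assume "v \<in> stiefel_tangent X"
  then obtain Q A H where "v = Q ** stack A H" "orthogonal_matrix Q" "X = Q ** I_np" "skew_symmetric A"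
    unfolding stiefel_tangent_def by blast
  thus "transpose (transpose X ** v) = - (transpose X ** v)"
    by (metis frame_stack(2) skew_symmetric_def)
next
  assume v: "transpose (transpose X ** v) = - (transpose X ** v)"
  obtain Q where Q: "orthogonal_matrix Q" "X = Q ** I_np" using stiefel_frame [OF assms] .
  show "v \<in> stiefel_tangent X"
    unfolding stiefel_tangent_def
    using frame_stack(1) [OF Q, of v] Q v unfolding skew_symmetric_def mem_Collect_eq by metis
qed

definition stiefel_form :: "real \<Rightarrow> real^'p^('p + 'q::finite) \<Rightarrow> real^'p^('p + 'q) \<Rightarrow> real^'p^('p + 'q) \<Rightarrow> real" where
  "stiefel_form \<beta> X u w = u \<bullet> w - (1 - \<beta>) * ((transpose X ** u) \<bullet> (transpose X ** w))"

lemma stiefel_metric_eq: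
  assumes X: "X \<in> stiefel" and u: "u \<in> stiefel_tangent X" and w: "w \<in> stiefel_tangent X"
  shows "stiefel_metric \<beta> X u w = stiefel_form \<beta> X u w"
  unfolding stiefel_metric_def
proof (rule the_equality)
  obtain Q where Q: "orthogonal_matrix Q" "X = Q ** I_np" using stiefel_frame [OF X] .
  let ?H = "\<lambda>v. \<chi> k. (transpose Q ** v) $ Inr k"
  have "stiefel_form \<beta> X u w = \<beta> * trace (transpose (transpose X ** u) ** (transpose X ** w)) +
      trace (transpose (?H u) ** ?H w)"
    using frame_stack(3) [OF Q, of "transpose X ** u" "?H u" "transpose X ** w" "?H w"]
    unfolding stiefel_form_def frame_stack(1) [OF Q]
    by (simp add: inner_matrix_conv_trace algebra_simps)
  thus "\<exists>Q Aa Ha Ab Hb. orthogonal_matrix Q \<and> X = Q ** I_np \<and> skew_symmetric Aa \<and> skew_symmetric Ab \<and>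
     u = Q ** stack Aa Ha \<and> w = Q ** stack Ab Hb \<and>
     stiefel_form \<beta> X u w = \<beta> * trace (transpose Aa ** Ab) + trace (transpose Ha ** Hb)"
    using Q u w frame_stack(1) [OF Q] unfolding stiefel_tangent_iff [OF X] skew_symmetric_def by metis
next
  fix r
  assume "\<exists>Q Aa Ha Ab Hb. orthogonal_matrix Q \<and> X = Q ** I_np \<and> skew_symmetric Aa \<and> skew_symmetric Ab \<and>
     u = Q ** stack Aa Ha \<and> w = Q ** stack Ab Hb \<and>
     r = \<beta> * trace (transpose Aa ** Ab) + trace (transpose Ha ** Hb)"
  then obtain Q Aa Ha Ab Hb where Q: "orthogonal_matrix Q" "X = Q ** I_np"
    and *: "u = Q ** stack Aa Ha" "w = Q ** stack Ab Hb"
     "r = \<beta> * trace (transpose Aa ** Ab) + trace (transpose Ha ** Hb)" by blast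
  show "r = stiefel_form \<beta> X u w"
    unfolding stiefel_form_def *(1,2) frame_stack(2,3) [OF Q] *(3)
    by (simp add: inner_matrix_conv_trace algebra_simps)
qed

lemma stiefel_metric_indep:
  assumes "CARD('p) = 1"
  shows "stiefel_metric \<beta> = (stiefel_metric \<gamma> :: real^'p^('p + 'q::finite) \<Rightarrow> _)"
proof -
  have "\<beta> * trace (transpose A ** B) = \<gamma> * trace (transpose A ** B)"
    if "skew_symmetric A" for A B :: "real^'p^'p"
    using skew_symmetric_1 [OF assms, of A] that
    by (simp add: skew_symmetric_def trace_def)
  thus ?thesis unfolding stiefel_metric_def by (intro ext) (metis (no_types, lifting))
qed

lemma stiefel_tangentD:
  assumes "X \<in> stiefel" "v \<in> stiefel_tangent X"
  shows "transpose v ** X = - (transpose X ** v)"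
  using assms(2) unfolding stiefel_tangent_iff [OF assms(1)] by (simp add: matrix_transpose_mul)

lemma killing_tangent:
  assumes X: "X \<in> stiefel" and W: "transpose W = - W"
  shows "W ** X \<in> stiefel_tangent X"
  unfolding stiefel_tangent_iff [OF X] by (simp add: matrix_alg_simps W)

lemma tangent_killing:
  assumes X: "X \<in> stiefel" and v: "v \<in> stiefel_tangent X"
  obtains W where "transpose W = - W" "W ** X = v"
proof
  note vX = stiefel_tangentD [OF X v]
  \<comment> \<open>Since v^T X = - X^T v, the first two terms send X to v + X X^T v; the third
    removes the surplus and keeps the matrix skew.\<close>
  let ?W = "v ** transpose X - X ** transpose v - X ** (transpose X ** (v ** transpose X))"
  have "X ** (transpose v ** (X ** transpose X)) = - (X ** (transpose X ** (v ** transpose X)))"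
    by (subst matrix_mul_assoc [of "transpose v"]) (simp add: vX matrix_alg_simps)
  thus "transpose ?W = - ?W" by (simp add: matrix_alg_simps)
  show "?W ** X = v"
    by (simp add: matrix_alg_simps vX stiefelD [OF X])
qed

lemma stiefel_tangent_subspace:
  assumes X: "X \<in> stiefel" shows "subspace (stiefel_tangent X)"
  unfolding subspace_def by (auto simp: stiefel_tangent_iff [OF X] matrix_alg_simps)

lemma stiefel_form_commute: "stiefel_form \<beta> X u w = stiefel_form \<beta> X w u"
  by (simp add: stiefel_form_def inner_commute)

lemma stiefel_form_linear:
  "stiefel_form \<beta> X (u + u') w = stiefel_form \<beta> X u w + stiefel_form \<beta> X u' w"
  "stiefel_form \<beta> X (r *\<^sub>R u) w = r * stiefel_form \<beta> X u w"
  "stiefel_form \<beta> X (u - u') w = stiefel_form \<beta> X u w - stiefel_form \<beta> X u' w"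
  "stiefel_form \<beta> X u (w + w') = stiefel_form \<beta> X u w + stiefel_form \<beta> X u w'"
  "stiefel_form \<beta> X u (r *\<^sub>R w) = r * stiefel_form \<beta> X u w"
  "stiefel_form \<beta> X u (w - w') = stiefel_form \<beta> X u w - stiefel_form \<beta> X u w'"
  by (simp_all add: stiefel_form_def matrix_alg_simps inner_add_left inner_add_right inner_diff_left
      inner_diff_right algebra_simps)

text \<open>Splits v into X X^T v and the part orthogonal to the columns of X, weighted by \<beta>
  and 1. Definiteness for every \<beta> > 0 can be read off from this form.\<close>

lemma stiefel_form_self:
  assumes X: "X \<in> stiefel"
  shows "stiefel_form \<beta> X v v = \<beta> * ((transpose X ** v) \<bullet> (transpose X ** v)) +
    (v - X ** (transpose X ** v)) \<bullet> (v - X ** (transpose X ** v))"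
proof -
  have "v \<bullet> (X ** (transpose X ** v)) = (transpose X ** v) \<bullet> (transpose X ** v)"
    by (simp add: inner_commute [of v] inner_matrix_mult_left [of X])
  moreover have "(X ** (transpose X ** v)) \<bullet> (X ** (transpose X ** v)) = (transpose X ** v) \<bullet> (transpose X ** v)"
    by (simp add: inner_matrix_mult_left [of X] stiefel_cancel [OF X])
  ultimately show ?thesis
    by (simp add: stiefel_form_def inner_diff_left inner_diff_right inner_commute algebra_simps)
qed

lemma stiefel_form_nonneg:
  assumes "X \<in> stiefel" "\<beta> > 0" shows "stiefel_form \<beta> X v v \<ge> 0"
  unfolding stiefel_form_self [OF assms(1)] using assms(2) by simp

lemma stiefel_form_definite:
  assumes "X \<in> stiefel" "\<beta> > 0" "stiefel_form \<beta> X v v = 0" shows "v = 0"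
proof -
  have "\<beta> * ((transpose X ** v) \<bullet> (transpose X ** v)) \<ge> 0"
    "(v - X ** (transpose X ** v)) \<bullet> (v - X ** (transpose X ** v)) \<ge> 0"
    using assms(2) by simp_all
  hence "\<beta> * ((transpose X ** v) \<bullet> (transpose X ** v)) = 0"
    "(v - X ** (transpose X ** v)) \<bullet> (v - X ** (transpose X ** v)) = 0"
    using assms(3) unfolding stiefel_form_self [OF assms(1)] by linarith+
  thus ?thesis using assms(2) by simp
qed

lemma stiefel_form_ext:
  assumes X: "X \<in> stiefel" "\<beta> > 0" and u: "u \<in> stiefel_tangent X" "u' \<in> stiefel_tangent X"
    and eq: "\<And>z. z \<in> stiefel_tangent X \<Longrightarrow> stiefel_form \<beta> X u z = stiefel_form \<beta> X u' z"
  shows "u = u'"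
proof -
  have "u - u' \<in> stiefel_tangent X"
    using stiefel_tangent_subspace [OF X(1)] u by (rule subspace_diff)
  from eq [OF this] have "stiefel_form \<beta> X (u - u') (u - u') = 0"
    by (simp add: stiefel_form_linear)
  from stiefel_form_definite [OF X this] show ?thesis by simp
qed

lemma linear_functional_inner:
  fixes l :: "'a::euclidean_space \<Rightarrow> real"
  assumes "linear l" obtains L where "\<And>z. l z = L \<bullet> z"
  by (rule that [of "adjoint l 1"]) (simp add: adjoint_works [OF assms] inner_commute)

text \<open>Write l as the inner product with L. Against tangent vectors only the skew part S of X^T
  L counts in the column space of X, and dividing it by \<beta> compensates its weight in the
  metric. This is the existence half for the \<open>THE\<close> terms of the connection.\<close>

lemma stiefel_riesz:
  fixes X :: "real^'p^('p + 'q::finite)"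
  assumes X: "X \<in> stiefel" "\<beta> > 0" and l: "linear l"
  obtains u where "u \<in> stiefel_tangent X" "\<And>z. z \<in> stiefel_tangent X \<Longrightarrow> stiefel_form \<beta> X u z = l z"
proof -
  obtain L where L: "\<And>z. l z = L \<bullet> z" using linear_functional_inner [OF l] by blast
  define S where "S = (1/2) *\<^sub>R (transpose X ** L - transpose L ** X)"
  define u where "u = (1/\<beta>) *\<^sub>R (X ** S) + (L - X ** (transpose X ** L))"
  have S: "transpose S = - S" by (simp add: S_def matrix_alg_simps algebra_simps)
  have Xu: "transpose X ** u = (1/\<beta>) *\<^sub>R S"
    by (simp add: u_def matrix_mult.add_right matrix_mult.diff_right matrix_mult.scaleR_right stiefel_cancel [OF X(1)])
  show thesis
  proof
    show "u \<in> stiefel_tangent X"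
      by (simp add: stiefel_tangent_iff [OF X(1)] Xu transpose_scaleR S)
    fix z assume z: "z \<in> stiefel_tangent X"
    define A where "A = transpose X ** z"
    have A: "transpose A = - A" using z by (simp add: A_def stiefel_tangent_iff [OF X(1)])
    have "(transpose X ** L + transpose (transpose X ** L)) \<bullet> A = 0"
      using skew_inner_symmetric [OF A, of "transpose X ** L + transpose (transpose X ** L)"]
      by (simp add: inner_commute transpose_add add.commute)
    hence XLA: "(transpose X ** L) \<bullet> A = S \<bullet> A"
      by (simp add: S_def inner_diff_left inner_add_left matrix_transpose_mul)
    have "u \<bullet> z = (1/\<beta>) * (S \<bullet> A) + L \<bullet> z - (transpose X ** L) \<bullet> A"
      by (simp add: u_def inner_add_left inner_diff_left inner_matrix_mult_left [of X] A_def)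
    thus "stiefel_form \<beta> X u z = l z"
      unfolding stiefel_form_def Xu A_def [symmetric] XLA L using X(2) by (simp add: field_simps)
  qed
qed

section \<open>The Levi-Civita connection\<close>

lemma C_upto_const: "C_upto k (\<lambda>x. c)"
proof (induction k arbitrary: c)
  case (Suc k)
  have "frechet_derivative (\<lambda>x. c) (at x) = (\<lambda>v. 0)" for x :: 'a
    by (rule frechet_derivative_at [symmetric]) (rule has_derivative_const)
  thus ?case using Suc by (simp add: frechet_derivative_const)
qed simp

lemma smooth_bounded_linear:
  assumes "bounded_linear f" shows "smooth f"
proof -
  have d: "(f has_derivative f) (at x)" for x
    by (rule bounded_linear.has_derivative [OF assms has_derivative_ident])
  have "C_upto k f" for k
  proof (cases k)
    case 0
    thus ?thesis using has_derivative_continuous [OF d] by (simp add: continuous_on_eq_continuous_at)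
  next
    case (Suc j)
    thus ?thesis using d frechet_derivative_at [OF d, symmetric] C_upto_const
      by (auto simp: differentiable_def)
  qed
  thus ?thesis by (simp add: smooth_def)
qed

lemma smooth_has_derivative:
  assumes "smooth f" shows "(f has_derivative frechet_derivative f (at x)) (at x)"
proof -
  have "C_upto 1 f" using assms by (simp add: smooth_def)
  thus ?thesis by (simp add: frechet_derivative_works)
qed

lemma smooth_curve_derivative:
  fixes c :: "real \<Rightarrow> 'a::real_normed_vector"
  assumes "smooth c" shows "(c has_vector_derivative vector_derivative c (at t)) (at t)"
proof -
  have "C_upto 1 c" using assms by (simp add: smooth_def)
  thus ?thesis by (simp add: vector_derivative_works)
qed

lemma smooth_curve_derivative2:
  fixes c :: "real \<Rightarrow> 'a::real_normed_vector"
  assumes "smooth c"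
  obtains a where "\<And>t. ((\<lambda>t. vector_derivative c (at t)) has_vector_derivative a t) (at t)"
proof -
  have "C_upto 2 c" using assms by (simp add: smooth_def)
  hence "(\<lambda>t. frechet_derivative c (at t) 1) differentiable at t" for t
    by (simp add: numeral_2_eq_2)
  moreover have "frechet_derivative c (at t) 1 = vector_derivative c (at t)" for t
    using frechet_derivative_at [OF smooth_curve_derivative [OF assms, unfolded has_vector_derivative_def]]
    by (metis scaleR_one)
  ultimately show thesis
    using that [of "\<lambda>t. vector_derivative (\<lambda>t. vector_derivative c (at t)) (at t)"]
    by (simp add: vector_derivative_works)
qed

lemma stiefel_curve_tangent:
  assumes c: "(c has_vector_derivative v) (at t)" and ev: "\<forall>\<^sub>F s in at t. c s \<in> stiefel" and ct: "c t \<in> stiefel"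
  shows "v \<in> stiefel_tangent (c t)"
proof -
  have "((\<lambda>s. transpose (c s) ** c s) has_vector_derivative (transpose (c t) ** v + transpose v ** c t)) (at t)"
    using has_vector_derivative_matrix_mult [OF has_vector_derivative_transpose [OF c] c] .
  moreover have "((\<lambda>s. transpose (c s) ** c s) has_vector_derivative 0) (at t)"
    unfolding has_vector_derivative_def
    by (rule has_derivative_transform_eventually [where f = "\<lambda>s. mat 1"])
      (use ev ct in \<open>auto elim!: eventually_mono simp: stiefelD\<close>)
  ultimately have "transpose (c t) ** v + transpose v ** c t = 0"
    by (rule vector_derivative_unique_at)
  thus ?thesis unfolding stiefel_tangent_iff [OF ct]
    by (simp add: matrix_transpose_mul add_eq_0_iff)
qed

lemma stiefel_flow:
  assumes E: "skew_flow W E" and X: "X \<in> stiefel"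
  shows "((\<lambda>t. E t ** X) has_vector_derivative W ** (E t ** X)) (at t)" "E 0 ** X = X" "E t ** X \<in> stiefel"
proof -
  show "((\<lambda>t. E t ** X) has_vector_derivative W ** (E t ** X)) (at t)"
    using bounded_linear.has_vector_derivative [OF matrix_mult.bounded_linear_left skew_flowD(2) [OF E]]
    by (simp add: matrix_mul_assoc)
  show "E 0 ** X = X" by (simp add: skew_flowD [OF E])
  have "transpose (E t) ** (E t ** X) = X"
    by (simp add: matrix_mul_assoc skew_flow_orthogonal [OF E])
  thus "E t ** X \<in> stiefel"
    using X by (simp add: stiefel_def matrix_alg_simps)
qed

lemma stiefel_curve_exists:
  assumes X: "X \<in> stiefel" and v: "v \<in> stiefel_tangent X"
  obtains c :: "real \<Rightarrow> _" where "c 0 = X" "\<And>s. c s \<in> stiefel" "(c has_vector_derivative v) (at 0)"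
proof -
  obtain W where W: "transpose W = - W" "W ** X = v" using tangent_killing [OF X v] .
  obtain E where E: "skew_flow W E" using skew_flow_exists [OF W(1)] by blast
  note * = stiefel_flow [OF E X]
  show thesis
    using that [of "\<lambda>t. E t ** X"] * *(1) [of 0] W(2) by simp
qed

text \<open>\<open>tangent_derivative\<close> quantifies over all curves with velocity v, so its
  value is determined only because at least one such curve exists; the flow of a Killing field
  provides it.\<close>

lemma tangent_derivative_eq:
  assumes X: "X \<in> stiefel" and v: "v \<in> stiefel_tangent X"
    and d: "\<And>c. c 0 = X \<Longrightarrow> (\<And>s. c s \<in> stiefel) \<Longrightarrow> (c has_vector_derivative v) (at 0) \<Longrightarrow>
       ((\<lambda>s. f (c s)) has_real_derivative d) (at (0::real))"
  shows "tangent_derivative stiefel f X v = d"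
  unfolding tangent_derivative_def
proof (rule the_equality)
  obtain c where c: "c 0 = X" "\<And>s. c s \<in> stiefel" "(c has_vector_derivative v) (at (0::real))"
    using stiefel_curve_exists [OF X v] by blast
  fix d'
  assume "\<forall>c. c 0 = X \<and> (\<forall>s. c s \<in> stiefel) \<and> (c has_vector_derivative v) (at 0) \<longrightarrow>
     ((\<lambda>s. f (c s)) has_real_derivative d') (at 0)"
  hence "((\<lambda>s. f (c s)) has_real_derivative d') (at 0)" using c by blast
  with d [OF c] show "d' = d" by (rule DERIV_unique [symmetric])
qed (use d in blast)

text \<open>The derivative of \<open>stiefel_form\<close> with respect to the base point X in
  direction z, with u and w held fixed.\<close>

definition stiefel_form_deriv ::
    "real \<Rightarrow> real^'p^('p + 'q::finite) \<Rightarrow> real^'p^('p + 'q) \<Rightarrow> real^'p^('p + 'q) \<Rightarrow> real^'p^('p + 'q) \<Rightarrow> real" where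
  "stiefel_form_deriv \<beta> X z u w = - (1 - \<beta>) *
     ((transpose z ** u) \<bullet> (transpose X ** w) + (transpose X ** u) \<bullet> (transpose z ** w))"

lemma has_derivative_stiefel_form:
  assumes c: "(c has_vector_derivative c') (at t)" and U: "(U has_vector_derivative U') (at t)"
    and W: "(W has_vector_derivative W') (at t)"
  shows "((\<lambda>s. stiefel_form \<beta> (c s) (U s) (W s)) has_real_derivative
    stiefel_form \<beta> (c t) U' (W t) + stiefel_form \<beta> (c t) (U t) W' + stiefel_form_deriv \<beta> (c t) c' (U t) (W t)) (at t)"
proof -
  note d1 = has_vector_derivative_matrix_mult [OF has_vector_derivative_transpose [OF c] U]
  note d2 = has_vector_derivative_matrix_mult [OF has_vector_derivative_transpose [OF c] W]
  note i = bounded_bilinear.has_vector_derivative [OF bounded_bilinear_inner]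
  have "((\<lambda>s. stiefel_form \<beta> (c s) (U s) (W s)) has_vector_derivative
     (U t \<bullet> W' + U' \<bullet> W t) - (1 - \<beta>) *\<^sub>R ((transpose (c t) ** U t) \<bullet> (transpose (c t) ** W' + transpose c' ** W t)
       + (transpose (c t) ** U' + transpose c' ** U t) \<bullet> (transpose (c t) ** W t))) (at t)"
    unfolding stiefel_form_def real_scaleR_def [symmetric]
    by (intro has_vector_derivative_diff i U W bounded_linear.has_vector_derivative [OF bounded_linear_scaleR_right] d1 d2)
  thus ?thesis
    unfolding has_real_derivative_iff_has_vector_derivative
    by (rule has_vector_derivative_eq_rhs)
      (simp add: stiefel_form_def stiefel_form_deriv_def inner_add_left inner_add_right algebra_simps)
qed

abbreviation stiefel_field :: "(real^'p^('p + 'q::finite) \<Rightarrow> real^'p^('p + 'q)) \<Rightarrow> bool" where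
  "stiefel_field \<equiv> tangent_field stiefel stiefel_tangent"

lemma stiefel_fieldD:
  assumes "stiefel_field Y"
  shows "X \<in> stiefel \<Longrightarrow> Y X \<in> stiefel_tangent X"
    and "(Y has_derivative frechet_derivative Y (at X)) (at X)"
  using assms smooth_has_derivative by (auto simp: tangent_field_def)

lemma killing_field: "transpose W = - W \<Longrightarrow> stiefel_field (\<lambda>X. W ** X)"
  by (simp add: tangent_field_def killing_tangent smooth_bounded_linear matrix_mult.bounded_linear_right)

text \<open>Provides enough globally smooth tangent fields to test equality of tangent vectors at a
  point, as the uniqueness halves of the \<open>THE\<close> terms demand.\<close>

lemma field_through:
  assumes "X \<in> stiefel" "v \<in> stiefel_tangent X"
  obtains Z where "stiefel_field Z" "Z X = v"
  using tangent_killing [OF assms] killing_field by metis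

lemma stiefel_field_along:
  fixes c :: "real \<Rightarrow> _"
  assumes "stiefel_field Y" "(c has_vector_derivative v) (at t)"
  shows "((\<lambda>s. Y (c s)) has_vector_derivative frechet_derivative Y (at (c t)) v) (at t)"
proof -
  have "(Y \<circ> c has_derivative frechet_derivative Y (at (c t)) \<circ> (\<lambda>s. s *\<^sub>R v)) (at t)"
    using assms(2) stiefel_fieldD(2) [OF assms(1)] unfolding has_vector_derivative_def
    by (intro diff_chain_at) auto
  thus ?thesis
    using linear_cmul [OF has_derivative_linear [OF stiefel_fieldD(2) [OF assms(1)]]]
    by (simp add: has_vector_derivative_def o_def)
qed

lemma tangent_derivative_metric:
  assumes X: "X \<in> stiefel" "v \<in> stiefel_tangent X" and Y: "stiefel_field Y" and Z: "stiefel_field Z"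
  shows "tangent_derivative stiefel (\<lambda>y. stiefel_metric \<beta> y (Y y) (Z y)) X v =
    stiefel_form \<beta> X (frechet_derivative Y (at X) v) (Z X) + stiefel_form \<beta> X (Y X) (frechet_derivative Z (at X) v)
    + stiefel_form_deriv \<beta> X v (Y X) (Z X)"
proof (rule tangent_derivative_eq [OF X])
  fix c :: "real \<Rightarrow> _" assume c: "c 0 = X" "\<And>s. c s \<in> stiefel" "(c has_vector_derivative v) (at 0)"
  show "((\<lambda>s. stiefel_metric \<beta> (c s) (Y (c s)) (Z (c s))) has_real_derivative
    stiefel_form \<beta> X (frechet_derivative Y (at X) v) (Z X) + stiefel_form \<beta> X (Y X) (frechet_derivative Z (at X) v)
    + stiefel_form_deriv \<beta> X v (Y X) (Z X)) (at 0)"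
    using has_derivative_stiefel_form [OF c(3) stiefel_field_along [OF Y c(3)] stiefel_field_along [OF Z c(3)], of \<beta>]
    by (simp add: c(1) stiefel_metric_eq [OF c(2) stiefel_fieldD(1) [OF Y c(2)] stiefel_fieldD(1) [OF Z c(2)]])
qed

text \<open>Differentiating the skewness of X^T Y along Z, and of X^T Z along Y, produces the same
  mixed terms, which cancel in the difference. Tangency matters because
  \<open>stiefel_metric\<close> agrees with \<open>stiefel_form\<close> only on tangent
  vectors.\<close>

lemma lie_bracket_tangent:
  fixes X :: "real^'a^('a + 'b::finite)"
  assumes X: "X \<in> stiefel" and Y: "stiefel_field Y" and Z: "stiefel_field Z"
  shows "lie_bracket Y Z X \<in> stiefel_tangent X"
proof -
  have *: "transpose v ** Y X + transpose X ** frechet_derivative Y (at X) v +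
      transpose (transpose v ** Y X + transpose X ** frechet_derivative Y (at X) v) = 0"
    if v: "v \<in> stiefel_tangent X" and Y: "stiefel_field Y" for v Y
  proof -
    obtain c where c: "c 0 = X" "\<And>s. c s \<in> stiefel" "(c has_vector_derivative v) (at (0::real))"
      using stiefel_curve_exists [OF X v] by blast
    note d = has_vector_derivative_matrix_mult [OF has_vector_derivative_transpose [OF c(3)] stiefel_field_along [OF Y c(3)]]
    note d' = has_vector_derivative_add [OF d has_vector_derivative_transpose [OF d]]
    have "transpose (c s) ** Y (c s) + transpose (transpose (c s) ** Y (c s)) = 0" for s
      using stiefel_fieldD(1) [OF Y c(2)] unfolding stiefel_tangent_iff [OF c(2)] by simp
    hence "((\<lambda>s. transpose (c s) ** Y (c s) + transpose (transpose (c s) ** Y (c s))) has_vector_derivative 0) (at 0)"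
      by simp
    from vector_derivative_unique_at [OF d' this] show ?thesis by (simp add: c(1) add.commute)
  qed
  have group: "r + s - (u + v) = 0" if "p + r + (q + s) = 0" "q + u + (p + v) = 0"
    for p q r s u v :: "real^'a^'a"
  proof -
    have "r + s - (u + v) = (p + r + (q + s)) - (q + u + (p + v))" by simp
    thus ?thesis using that by simp
  qed
  define A where "A = frechet_derivative Z (at X) (Y X)"
  define B where "B = frechet_derivative Y (at X) (Z X)"
  have "transpose X ** A + transpose A ** X - (transpose X ** B + transpose B ** X) = 0"
    by (rule group) (use * [OF stiefel_fieldD(1) [OF Y X] Z] * [OF stiefel_fieldD(1) [OF Z X] Y]
        in \<open>simp_all add: A_def B_def matrix_alg_simps\<close>)
  thus ?thesis
    unfolding stiefel_tangent_iff [OF X] lie_bracket_def A_def [symmetric] B_def [symmetric]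
    by (simp add: matrix_alg_simps algebra_simps)
qed

text \<open>The brackets cancel the derivatives of X and Z and double that of Y. What remains
  depends on X and Z only through their values at x, the last three terms being Christoffel symbols
  of the first kind.\<close>

lemma stiefel_koszul:
  assumes x: "x \<in> stiefel" and X: "stiefel_field X" and Y: "stiefel_field Y" and Z: "stiefel_field Z"
  shows "koszul stiefel (stiefel_metric \<beta>) X Y Z x =
    2 * stiefel_form \<beta> x (frechet_derivative Y (at x) (X x)) (Z x) + stiefel_form_deriv \<beta> x (X x) (Y x) (Z x)
    + stiefel_form_deriv \<beta> x (Y x) (X x) (Z x) - stiefel_form_deriv \<beta> x (Z x) (X x) (Y x)"
  unfolding koszul_def
  by (simp add: tangent_derivative_metric [OF x stiefel_fieldD(1) [OF _ x]] X Y Z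
      stiefel_metric_eq [OF x lie_bracket_tangent [OF x] stiefel_fieldD(1) [OF _ x]])
    (simp add: lie_bracket_def stiefel_form_linear stiefel_form_commute [of \<beta> x "X x"] stiefel_form_commute [of \<beta> x "Y x"])

lemma stiefel_form_deriv_linear:
  "linear (\<lambda>z. stiefel_form_deriv \<beta> X z u w)" "linear (\<lambda>w. stiefel_form_deriv \<beta> X z u w)"
  "linear (\<lambda>w. stiefel_form \<beta> X u w)"
  by (auto intro!: linearI simp: stiefel_form_deriv_def stiefel_form_def matrix_alg_simps inner_add_left inner_add_right algebra_simps)

lemma stiefel_form_deriv_commute: "stiefel_form_deriv \<beta> X z u w = stiefel_form_deriv \<beta> X z w u"
  by (simp add: stiefel_form_deriv_def inner_commute)

text \<open>The right-hand side is linear in z, so \<open>stiefel_riesz\<close> represents it by a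
  tangent vector; fields through v and through every z show that no other vector satisfies Koszul's
  formula.\<close>

lemma stiefel_levi_civita:
  fixes x :: "real^'p^('p + 'q::finite)"
  assumes x: "x \<in> stiefel" "v \<in> stiefel_tangent x" and Y: "stiefel_field Y" and \<beta>: "\<beta> > 0"
  defines "D \<equiv> levi_civita stiefel stiefel_tangent (stiefel_metric \<beta>) x v Y"
  shows "D \<in> stiefel_tangent x"
    and "z \<in> stiefel_tangent x \<Longrightarrow> 2 * stiefel_form \<beta> x D z =
      2 * stiefel_form \<beta> x (frechet_derivative Y (at x) v) z + stiefel_form_deriv \<beta> x v (Y x) z
      + stiefel_form_deriv \<beta> x (Y x) v z - stiefel_form_deriv \<beta> x z v (Y x)"
proof -
  let ?l = "\<lambda>z. stiefel_form \<beta> x (frechet_derivative Y (at x) v) z + (1/2) *\<^sub>R (stiefel_form_deriv \<beta> x v (Y x) z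
      + stiefel_form_deriv \<beta> x (Y x) v z - stiefel_form_deriv \<beta> x z v (Y x))"
  have "linear ?l"
    by (intro linear_compose_add linear_compose_sub linear_compose_scale_right stiefel_form_deriv_linear)
  from stiefel_riesz [OF x(1) \<beta> this]
  obtain u where u: "u \<in> stiefel_tangent x" "\<And>z. z \<in> stiefel_tangent x \<Longrightarrow> stiefel_form \<beta> x u z = ?l z" by blast
  have "D = u"
    unfolding D_def levi_civita_def
  proof (rule the_equality, intro conjI allI impI)
    fix X Z :: "real^'p^('p + 'q) \<Rightarrow> real^'p^('p + 'q)"
    assume XZ: "stiefel_field X \<and> stiefel_field Z \<and> X x = v"
    hence Z: "Z x \<in> stiefel_tangent x" using stiefel_fieldD(1) x(1) by blast
    show "2 * stiefel_metric \<beta> x u (Z x) = koszul stiefel (stiefel_metric \<beta>) X Y Z x"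
      using XZ by (simp add: stiefel_koszul [OF x(1) _ Y] stiefel_metric_eq [OF x(1) u(1) Z] u(2) [OF Z] algebra_simps)
  next
    fix u' assume u': "u' \<in> stiefel_tangent x \<and> (\<forall>X Z. stiefel_field X \<and> stiefel_field Z \<and> X x = v \<longrightarrow>
       2 * stiefel_metric \<beta> x u' (Z x) = koszul stiefel (stiefel_metric \<beta>) X Y Z x)"
    obtain X where X: "stiefel_field X" "X x = v" using field_through [OF x] .
    show "u' = u"
    proof (rule stiefel_form_ext [OF x(1) \<beta> _ u(1)])
      fix z assume z: "z \<in> stiefel_tangent x"
      obtain Z where Z: "stiefel_field Z" "Z x = z" using field_through [OF x(1) z] .
      have "2 * stiefel_metric \<beta> x u' (Z x) = koszul stiefel (stiefel_metric \<beta>) X Y Z x"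
        using u' X Z by blast
      thus "stiefel_form \<beta> x u' z = stiefel_form \<beta> x u z"
        unfolding u(2) [OF z] using u' X Z z
        by (simp add: stiefel_koszul [OF x(1) _ Y] stiefel_metric_eq [OF x(1)] algebra_simps)
    qed (use u' in blast)
  qed (rule u(1))
  thus "D \<in> stiefel_tangent x" "z \<in> stiefel_tangent x \<Longrightarrow> 2 * stiefel_form \<beta> x D z =
      2 * stiefel_form \<beta> x (frechet_derivative Y (at x) v) z + stiefel_form_deriv \<beta> x v (Y x) z
      + stiefel_form_deriv \<beta> x (Y x) v z - stiefel_form_deriv \<beta> x z v (Y x)"
    using u by simp_all
qed

section \<open>Geodesics and their momentum\<close>

text \<open>The moment map of left multiplication by orthogonal matrices: the skew matrix whose
  inner product with a skew W is 2 g(v, W X), see \<open>stiefel_form_killing\<close>.\<close>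

definition stiefel_momentum :: "real \<Rightarrow> real^'p^('p + 'q::finite) \<Rightarrow> real^'p^('p + 'q) \<Rightarrow> real^('p + 'q)^('p + 'q)" where
  "stiefel_momentum \<beta> X v = v ** transpose X - X ** transpose v
     - (2 * (1 - \<beta>)) *\<^sub>R (X ** (transpose X ** (v ** transpose X)))"

lemma stiefel_momentum_skew:
  assumes X: "X \<in> stiefel" and v: "v \<in> stiefel_tangent X"
  shows "transpose (stiefel_momentum \<beta> X v) = - stiefel_momentum \<beta> X v"
proof -
  have "X ** (transpose v ** (X ** transpose X)) = - (X ** (transpose X ** (v ** transpose X)))"
    by (subst matrix_mul_assoc [of "transpose v"]) (simp add: stiefel_tangentD [OF X v] matrix_alg_simps)
  thus ?thesis by (simp add: stiefel_momentum_def matrix_alg_simps)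
qed

lemma stiefel_form_killing:
  assumes X: "X \<in> stiefel" and v: "v \<in> stiefel_tangent X" and W: "transpose W = - W"
  shows "2 * stiefel_form \<beta> X v (W ** X) = stiefel_momentum \<beta> X v \<bullet> W"
proof -
  have 1: "v \<bullet> (W ** X) = (v ** transpose X) \<bullet> W"
    using inner_matrix_mult_right [of W X v] inner_commute by metis
  have "(X ** transpose v) \<bullet> W = transpose (v ** transpose X) \<bullet> transpose (transpose W)"
    by (simp add: matrix_transpose_mul)
  also have "\<dots> = - ((v ** transpose X) \<bullet> W)"
    unfolding inner_transpose by (simp add: W)
  finally have 2: "(X ** transpose v) \<bullet> W = - ((v ** transpose X) \<bullet> W)" .
  have "(X ** (transpose X ** (v ** transpose X))) \<bullet> W = (X ** (transpose X ** v)) \<bullet> (W ** X)"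
    using inner_matrix_mult_right [of "X ** (transpose X ** v)" "transpose X" W] by (simp add: matrix_mul_assoc)
  also have "\<dots> = (transpose X ** v) \<bullet> (transpose X ** (W ** X))"
    by (rule inner_matrix_mult_left)
  finally show ?thesis
    by (simp add: stiefel_form_def stiefel_momentum_def inner_diff_left 1 2)
qed

text \<open>The functional \<open>l\<close> below is \<open>z \<mapsto> g(D\<^sub>t c', z)\<close>.\<close>

lemma covariant_derivative_velocity_eq_0_iff:
  fixes c :: "real \<Rightarrow> real^'p^('p + 'q::finite)"
  assumes \<beta>: "\<beta> > 0" and c: "\<And>s. c s \<in> stiefel" "\<And>s. (c has_vector_derivative v s) (at s)"
    and a: "(v has_vector_derivative a) (at t)"
  defines "l \<equiv> \<lambda>z. stiefel_form \<beta> (c t) a z + stiefel_form_deriv \<beta> (c t) (v t) (v t) z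
    - (1/2) *\<^sub>R stiefel_form_deriv \<beta> (c t) z (v t) (v t)"
  shows "covariant_derivative_along stiefel stiefel_tangent (stiefel_metric \<beta>) c v t = 0 \<longleftrightarrow>
    (\<forall>z \<in> stiefel_tangent (c t). l z = 0)"
proof -
  let ?D = "covariant_derivative_along stiefel stiefel_tangent (stiefel_metric \<beta>) c v t"
  have vT: "v s \<in> stiefel_tangent (c s)" for s
    by (rule stiefel_curve_tangent [OF c(2)]) (use c(1) in auto)
  have vd: "vector_derivative c (at t) = v t" by (rule vector_derivative_at [OF c(2)])
  have "linear l"
    unfolding l_def
    by (intro linear_compose_add linear_compose_sub linear_compose_scale_right stiefel_form_deriv_linear)
  from stiefel_riesz [OF c(1) \<beta> this]
  obtain u where u: "u \<in> stiefel_tangent (c t)" "\<And>z. z \<in> stiefel_tangent (c t) \<Longrightarrow> stiefel_form \<beta> (c t) u z = l z" by blast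
  have key: "deriv (\<lambda>s. stiefel_metric \<beta> (c s) (v s) (Z (c s))) t =
      l (Z (c t)) + stiefel_metric \<beta> (c t) (v t) (levi_civita stiefel stiefel_tangent (stiefel_metric \<beta>) (c t) (v t) Z)"
    if Z: "stiefel_field Z" for Z
  proof -
    note ZT = stiefel_fieldD(1) [OF Z c(1)]
    note lc = stiefel_levi_civita [OF c(1) [of t] vT [of t] Z \<beta>]
    have "deriv (\<lambda>s. stiefel_metric \<beta> (c s) (v s) (Z (c s))) t =
       stiefel_form \<beta> (c t) a (Z (c t)) + stiefel_form \<beta> (c t) (v t) (frechet_derivative Z (at (c t)) (v t))
       + stiefel_form_deriv \<beta> (c t) (v t) (v t) (Z (c t))"
      unfolding stiefel_metric_eq [OF c(1) vT ZT]
      by (intro DERIV_imp_deriv has_derivative_stiefel_form c(2) a stiefel_field_along [OF Z])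
    thus ?thesis
      using lc(2) [OF vT]
      unfolding stiefel_metric_eq [OF c(1) vT lc(1)] l_def stiefel_form_commute [of \<beta> "c t" "v t"]
        stiefel_form_deriv_commute [of \<beta> "c t" "v t" "v t" "Z (c t)"] by simp
  qed
  have "?D = u"
    unfolding covariant_derivative_along_def vd
  proof (rule the_equality, intro conjI allI impI)
    fix Z :: "real^'p^('p + 'q) \<Rightarrow> real^'p^('p + 'q)" assume Z: "stiefel_field Z"
    show "deriv (\<lambda>s. stiefel_metric \<beta> (c s) (v s) (Z (c s))) t = stiefel_metric \<beta> (c t) u (Z (c t)) +
        stiefel_metric \<beta> (c t) (v t) (levi_civita stiefel stiefel_tangent (stiefel_metric \<beta>) (c t) (v t) Z)"
      using stiefel_fieldD(1) [OF Z c(1)]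
      by (simp add: key [OF Z] stiefel_metric_eq [OF c(1) u(1)] u(2))
  next
    fix u' assume u': "u' \<in> stiefel_tangent (c t) \<and> (\<forall>Z. stiefel_field Z \<longrightarrow>
       deriv (\<lambda>s. stiefel_metric \<beta> (c s) (v s) (Z (c s))) t = stiefel_metric \<beta> (c t) u' (Z (c t)) +
        stiefel_metric \<beta> (c t) (v t) (levi_civita stiefel stiefel_tangent (stiefel_metric \<beta>) (c t) (v t) Z))"
    show "u' = u"
    proof (rule stiefel_form_ext [OF c(1) \<beta> _ u(1)])
      fix z assume z: "z \<in> stiefel_tangent (c t)"
      obtain Z where Z: "stiefel_field Z" "Z (c t) = z" using field_through [OF c(1) z] .
      have "stiefel_metric \<beta> (c t) u' (Z (c t)) = l (Z (c t))"
        using u' Z(1) key [OF Z(1)] by simp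
      thus "stiefel_form \<beta> (c t) u' z = stiefel_form \<beta> (c t) u z"
        using u' z by (simp add: Z(2) u(2) [OF z] stiefel_metric_eq [OF c(1)])
    qed (use u' in blast)
  qed (rule u(1))
  moreover have "u = 0 \<longleftrightarrow> (\<forall>z \<in> stiefel_tangent (c t). l z = 0)"
  proof
    assume "u = 0"
    thus "\<forall>z \<in> stiefel_tangent (c t). l z = 0"
      using u(2) by (simp add: stiefel_form_def)
  next
    assume "\<forall>z \<in> stiefel_tangent (c t). l z = 0"
    thus "u = 0"
      by (intro stiefel_form_ext [OF c(1) \<beta> u(1) subspace_0 [OF stiefel_tangent_subspace [OF c(1)]]])
        (simp add: u(2), simp add: stiefel_form_def)
  qed
  ultimately show ?thesis by simp
qed

text \<open>Noether's theorem and its converse: the pairing of the velocity with a Killing field W c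
  has derivative g(D_t c', W c), and the vectors W c fill the tangent space.\<close>

lemma stiefel_geodesic_iff:
  fixes c :: "real \<Rightarrow> real^'p^('p + 'q::finite)"
  assumes \<beta>: "\<beta> > 0" and smooth: "smooth c" and c: "\<And>s. c s \<in> stiefel" "\<And>s. (c has_vector_derivative v s) (at s)"
  shows "geodesic stiefel stiefel_tangent (stiefel_metric \<beta>) c \<longleftrightarrow>
    (\<forall>t. stiefel_momentum \<beta> (c t) (v t) = stiefel_momentum \<beta> (c 0) (v 0))"
proof -
  have vd: "(\<lambda>s. vector_derivative c (at s)) = v"
    using vector_derivative_at [OF c(2)] by blast
  obtain a where a: "\<And>t. (v has_vector_derivative a t) (at t)"
    using smooth_curve_derivative2 [OF smooth] unfolding vd by blast
  have vT: "v s \<in> stiefel_tangent (c s)" for s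
    by (rule stiefel_curve_tangent [OF c(2)]) (use c(1) in auto)
  define l where "l t z = stiefel_form \<beta> (c t) (a t) z + stiefel_form_deriv \<beta> (c t) (v t) (v t) z
    - (1/2) *\<^sub>R stiefel_form_deriv \<beta> (c t) z (v t) (v t)" for t z
  have geo: "geodesic stiefel stiefel_tangent (stiefel_metric \<beta>) c \<longleftrightarrow>
      (\<forall>t. \<forall>z \<in> stiefel_tangent (c t). l t z = 0)"
    using covariant_derivative_velocity_eq_0_iff [OF \<beta> c a]
    by (simp add: geodesic_def smooth c(1) vd l_def)
  \<comment> \<open>The form is invariant under rotations, so the terms in which W acts on the
    velocity cancel half of the base point derivative; the rest is exactly
    \<open>l t\<close>.\<close>
  have dm: "((\<lambda>s. stiefel_form \<beta> (c s) (v s) (W ** c s)) has_real_derivative l t (W ** c t)) (at t)"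
    if W: "transpose W = - W" for W t
  proof -
    have "v t \<bullet> (W ** v t) = 0"
      using skew_mult_inner_self [OF W] by (simp add: inner_commute)
    hence "stiefel_form \<beta> (c t) (v t) (W ** v t) + (1/2) * stiefel_form_deriv \<beta> (c t) (W ** c t) (v t) (v t) = 0"
      by (simp add: stiefel_form_def stiefel_form_deriv_def matrix_alg_simps W inner_commute algebra_simps)
    thus ?thesis
      by (intro DERIV_cong [OF has_derivative_stiefel_form [OF c(2) [of t] a [of t]
          bounded_linear.has_vector_derivative [OF matrix_mult.bounded_linear_right [of W] c(2) [of t]], of \<beta>]])
        (simp add: l_def algebra_simps)
  qed
  show ?thesis
  proof
    assume "geodesic stiefel stiefel_tangent (stiefel_metric \<beta>) c"
    hence l: "l t z = 0" if "z \<in> stiefel_tangent (c t)" for t z using geo that by blast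
    show "\<forall>t. stiefel_momentum \<beta> (c t) (v t) = stiefel_momentum \<beta> (c 0) (v 0)"
    proof
      fix t
      \<comment> \<open>The change of momentum is itself used as the Killing matrix, which makes its
        norm vanish.\<close>
      let ?W = "stiefel_momentum \<beta> (c t) (v t) - stiefel_momentum \<beta> (c 0) (v 0)"
      have W: "transpose ?W = - ?W"
        by (simp add: transpose_diff stiefel_momentum_skew c(1) vT)
      have "((\<lambda>s. stiefel_form \<beta> (c s) (v s) (?W ** c s)) has_vector_derivative 0) (at s)" for s
        using dm [OF W, of s] l [OF killing_tangent [OF c(1) W]]
        by (simp add: has_real_derivative_iff_has_vector_derivative)
      from constant_of_derivative_zero [OF this, of t]
      have "stiefel_momentum \<beta> (c t) (v t) \<bullet> ?W = stiefel_momentum \<beta> (c 0) (v 0) \<bullet> ?W"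
        using stiefel_form_killing [OF c(1) vT W, of \<beta>] by (metis mult_left_cancel zero_neq_numeral)
      hence "?W \<bullet> ?W = 0" by (simp add: inner_diff_left)
      thus "stiefel_momentum \<beta> (c t) (v t) = stiefel_momentum \<beta> (c 0) (v 0)" by simp
    qed
  next
    assume m: "\<forall>t. stiefel_momentum \<beta> (c t) (v t) = stiefel_momentum \<beta> (c 0) (v 0)"
    show "geodesic stiefel stiefel_tangent (stiefel_metric \<beta>) c"
      unfolding geo
    proof (intro allI ballI)
      fix t z assume "z \<in> stiefel_tangent (c t)"
      then obtain W where W: "transpose W = - W" "W ** c t = z" using tangent_killing [OF c(1)] by metis
      have "stiefel_form \<beta> (c s) (v s) (W ** c s) = (1/2) * (stiefel_momentum \<beta> (c 0) (v 0) \<bullet> W)" for s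
        using stiefel_form_killing [OF c(1) vT W(1), of \<beta> s] m [rule_format, of s] by simp
      hence "(\<lambda>s. stiefel_form \<beta> (c s) (v s) (W ** c s)) = (\<lambda>s. (1/2) * (stiefel_momentum \<beta> (c 0) (v 0) \<bullet> W))"
        by (rule ext)
      hence "((\<lambda>s. stiefel_form \<beta> (c s) (v s) (W ** c s)) has_real_derivative 0) (at t)"
        by (simp only: DERIV_const)
      from DERIV_unique [OF dm [OF W(1)] this] show "l t z = 0" by (simp add: W(2))
    qed
  qed
qed

text \<open>P X = v + (2 \<beta> - 1) X X^T v, hence X^T P X = 2 \<beta> X^T v, and this can be
  solved for v. The correction vanishes for \<beta> = 1/2.\<close>

lemma velocity_of_momentum:
  assumes X: "X \<in> stiefel" and v: "v \<in> stiefel_tangent X" and \<beta>: "\<beta> > 0"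
  defines "P \<equiv> stiefel_momentum \<beta> X v"
  shows "v = P ** X + ((1 - 2 * \<beta>) / (2 * \<beta>)) *\<^sub>R (X ** (transpose X ** (P ** X)))"
proof -
  have "P ** X = v + X ** (transpose X ** v) - (2 * (1 - \<beta>)) *\<^sub>R (X ** (transpose X ** v))"
    by (simp add: P_def stiefel_momentum_def matrix_alg_simps stiefelD [OF X] stiefel_tangentD [OF X v])
  moreover have "2 * \<beta> - 1 = 1 - 2 * (1 - \<beta>)" by simp
  ultimately have PX: "P ** X = v + (2 * \<beta> - 1) *\<^sub>R (X ** (transpose X ** v))"
    by (simp only: scaleR_left_diff_distrib scaleR_one add_diff_eq)
  have "transpose X ** (P ** X) = transpose X ** v + (2 * \<beta> - 1) *\<^sub>R (transpose X ** v)"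
    unfolding PX by (simp add: matrix_mult.add_right matrix_mult.scaleR_right stiefel_cancel [OF X])
  also have "\<dots> = (2 * \<beta>) *\<^sub>R (transpose X ** v)"
    using scaleR_left_distrib [of 1 "2 * \<beta> - 1" "transpose X ** v"] by simp
  finally show ?thesis using \<beta> by (simp add: PX matrix_mult.scaleR_right flip: scaleR_add_left)
qed

section \<open>Uniqueness of geodesics by a Gronwall estimate\<close>

lemma norm_matrix_mult_le: "norm (A ** B) \<le> norm A * norm B" for A :: "real^'k^'m" and B :: "real^'n^'k"
proof -
  have entry: "(A ** B) $ i $ j = row i A \<bullet> column j B" for i j
    by (simp add: matrix_matrix_mult_def row_def column_def inner_vec_def)
  have "(A ** B) \<bullet> (A ** B) = (\<Sum>i\<in>UNIV. \<Sum>j\<in>UNIV. (row i A \<bullet> column j B)\<^sup>2)"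
    by (simp add: inner_vec_def [of "A ** B"] inner_vec_def [of "(A ** B) $ _"] entry power2_eq_square)
  also have "\<dots> \<le> (\<Sum>i\<in>UNIV. \<Sum>j\<in>UNIV. (row i A \<bullet> row i A) * (column j B \<bullet> column j B))"
    by (intro sum_mono Cauchy_Schwarz_ineq)
  also have "\<dots> = (\<Sum>i\<in>UNIV. row i A \<bullet> row i A) * (\<Sum>j\<in>UNIV. column j B \<bullet> column j B)"
    by (simp add: sum_product)
  also have "(\<Sum>i\<in>UNIV. row i A \<bullet> row i A) = A \<bullet> A"
    by (simp add: inner_vec_def [of A] row_def)
  also have "(\<Sum>j\<in>UNIV. column j B \<bullet> column j B) = transpose B \<bullet> transpose B"
    unfolding inner_vec_def [of "transpose B" "transpose B"] by (simp add: column_def transpose_def)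
  finally have "(norm (A ** B))\<^sup>2 \<le> (norm A * norm B)\<^sup>2"
    by (simp add: power2_norm_eq_inner power_mult_distrib inner_transpose)
  thus ?thesis by (rule power2_le_imp_le) simp
qed

lemma norm_transpose: "norm (transpose A) = norm A" for A :: "real^'n^'m"
  by (simp add: norm_eq_sqrt_inner inner_transpose)

lemma norm_stiefel: "X \<in> stiefel \<Longrightarrow> norm X = sqrt CARD('p)" for X :: "real^'p^('p + 'q::finite)"
  by (simp add: norm_eq_sqrt_inner inner_matrix_conv_trace stiefelD trace_def mat_def)

text \<open>Gronwall's argument: exp(-2Ks) times the squared norm of f is nonincreasing and starts
  at 0.\<close>

lemma derivative_bound_imp_zero_right:
  fixes f :: "real \<Rightarrow> 'a::real_inner"
  assumes f: "\<And>t. (f has_vector_derivative f' t) (at t)" "\<And>t. norm (f' t) \<le> K * norm (f t)" "f 0 = 0"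
    and t: "t \<ge> 0"
  shows "f t = 0"
proof -
  let ?h = "\<lambda>s. exp (- 2 * K * s) * (f s \<bullet> f s)"
  have "\<exists>y. (?h has_real_derivative y) (at s) \<and> y \<le> 0" for s
  proof (intro exI conjI)
    have "((\<lambda>s. f s \<bullet> f s) has_real_derivative (f s \<bullet> f' s + f' s \<bullet> f s)) (at s)"
      using bounded_bilinear.has_vector_derivative [OF bounded_bilinear_inner f(1) f(1)]
      by (simp add: has_real_derivative_iff_has_vector_derivative)
    thus "(?h has_real_derivative (- 2 * K * exp (- 2 * K * s) * (f s \<bullet> f s)
        + exp (- 2 * K * s) * (f s \<bullet> f' s + f' s \<bullet> f s))) (at s)"
      by (auto intro!: derivative_eq_intros)
    have "f s \<bullet> f' s \<le> norm (f s) * norm (f' s)" by (rule norm_cauchy_schwarz)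
    also have "\<dots> \<le> norm (f s) * (K * norm (f s))" by (intro mult_left_mono f) simp
    finally have "f s \<bullet> f' s \<le> K * (f s \<bullet> f s)"
      by (simp add: power2_norm_eq_inner [symmetric] power2_eq_square algebra_simps)
    hence "exp (- 2 * K * s) * (2 * (f s \<bullet> f' s - K * (f s \<bullet> f s))) \<le> 0"
      by (intro mult_nonneg_nonpos) auto
    thus "- 2 * K * exp (- 2 * K * s) * (f s \<bullet> f s) + exp (- 2 * K * s) * (f s \<bullet> f' s + f' s \<bullet> f s) \<le> 0"
      by (simp add: inner_commute [of "f' s"] algebra_simps)
  qed
  hence "?h t \<le> ?h 0" by (intro DERIV_nonpos_imp_nonincreasing [OF t]) blast
  hence "f t \<bullet> f t \<le> 0" by (simp add: f(3) mult_le_0_iff)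
  hence "f t \<bullet> f t = 0" by (rule order_antisym) simp
  thus ?thesis by simp
qed

lemma derivative_bound_imp_zero:
  fixes f :: "real \<Rightarrow> 'a::real_inner"
  assumes f: "\<And>t. (f has_vector_derivative f' t) (at t)" "\<And>t. norm (f' t) \<le> K * norm (f t)" "f 0 = 0"
  shows "f t = 0"
proof (cases "t \<ge> 0")
  case True thus ?thesis using derivative_bound_imp_zero_right [OF f] by blast
next
  case False
  have "((\<lambda>s. f (- s)) has_vector_derivative - f' (- s)) (at s)" for s
    using vector_diff_chain_at [OF has_vector_derivative_minus [OF has_vector_derivative_id] f(1)] by (simp add: o_def)
  from derivative_bound_imp_zero_right [OF this, of K "- t"] f False show ?thesis by simp
qed

text \<open>The initial data fix the momentum P, so both geodesics solve the same equation c' =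
  F(c). F is cubic, but Lipschitz on the Stiefel manifold, where all matrices have norm sqrt
  p.\<close>

lemma stiefel_geodesic_unique:
  fixes c d :: "real \<Rightarrow> real^'p^('p + 'q::finite)"
  assumes \<beta>: "\<beta> > 0" and c: "geodesic stiefel stiefel_tangent (stiefel_metric \<beta>) c"
    and d: "geodesic stiefel stiefel_tangent (stiefel_metric \<beta>) d"
    and init: "c 0 = d 0" "vector_derivative c (at 0) = vector_derivative d (at 0)"
  shows "c = d"
proof
  fix t
  define P where "P = stiefel_momentum \<beta> (c 0) (vector_derivative c (at 0))"
  define m where "m = (1 - 2 * \<beta>) / (2 * \<beta>)"
  define F where "F X = P ** X + m *\<^sub>R (X ** (transpose X ** (P ** X)))" for X :: "real^'p^('p + 'q)"
  have ode: "(c has_vector_derivative F (c t)) (at t)" "c t \<in> stiefel"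
    if c: "geodesic stiefel stiefel_tangent (stiefel_metric \<beta>) c"
      and P: "stiefel_momentum \<beta> (c 0) (vector_derivative c (at 0)) = P" for c t
  proof -
    have cM: "smooth c" "c t \<in> stiefel" for t using c by (auto simp: geodesic_def)
    note cd = smooth_curve_derivative [OF cM(1)]
    have vT: "vector_derivative c (at t) \<in> stiefel_tangent (c t)" for t
      by (rule stiefel_curve_tangent [OF cd]) (use cM in auto)
    have "stiefel_momentum \<beta> (c t) (vector_derivative c (at t)) = P"
      using stiefel_geodesic_iff [OF \<beta> cM cd] c P by simp
    with velocity_of_momentum [OF cM(2) vT \<beta>, of t]
    have "vector_derivative c (at t) = F (c t)" by (simp add: F_def m_def)
    thus "(c has_vector_derivative F (c t)) (at t)" "c t \<in> stiefel" using cd cM by metis+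
  qed
  have cP: "stiefel_momentum \<beta> (c 0) (vector_derivative c (at 0)) = P"
    and dP: "stiefel_momentum \<beta> (d 0) (vector_derivative d (at 0)) = P"
    by (simp_all add: P_def init)
  define r where "r = sqrt (real CARD('p))"
  have Lip: "norm (F X - F Y) \<le> (norm P * (1 + 3 * \<bar>m\<bar> * r\<^sup>2)) * norm (X - Y)"
    if X: "X \<in> stiefel" and Y: "Y \<in> stiefel" for X Y
  proof -
    \<comment> \<open>Telescopes the cubic term, replacing one factor X by Y at a time.\<close>
    have eq: "F X - F Y = P ** (X - Y) + m *\<^sub>R ((X - Y) ** (transpose X ** (P ** X))
        + Y ** (transpose (X - Y) ** (P ** X)) + Y ** (transpose Y ** (P ** (X - Y))))"
      by (simp add: F_def matrix_alg_simps algebra_simps)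
    have r: "norm X = r" "norm Y = r" using X Y norm_stiefel by (auto simp: r_def)
    have nPr: "norm (P ** Z) \<le> norm P * norm Z" for Z :: "real^'p^('p + 'q)" by (rule norm_matrix_mult_le)
    have 1: "norm ((X - Y) ** (transpose X ** (P ** X))) \<le> norm (X - Y) * (r * (norm P * r))"
      by (rule order_trans [OF norm_matrix_mult_le], intro mult_left_mono,
          rule order_trans [OF norm_matrix_mult_le], unfold norm_transpose, intro mult_mono)
        (use nPr [of X] r in auto)
    have 2: "norm (Y ** (transpose (X - Y) ** (P ** X))) \<le> r * (norm (X - Y) * (norm P * r))"
      by (rule order_trans [OF norm_matrix_mult_le], intro mult_mono,
          simp add: r, rule order_trans [OF norm_matrix_mult_le], unfold norm_transpose, intro mult_left_mono)
        (use nPr [of X] r in auto)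
    have 3: "norm (Y ** (transpose Y ** (P ** (X - Y)))) \<le> r * (r * (norm P * norm (X - Y)))"
      by (rule order_trans [OF norm_matrix_mult_le], intro mult_mono,
          simp add: r, rule order_trans [OF norm_matrix_mult_le], unfold norm_transpose, intro mult_mono)
        (use nPr [of "X - Y"] r in auto)
    let ?s = "(X - Y) ** (transpose X ** (P ** X)) + Y ** (transpose (X - Y) ** (P ** X))
        + Y ** (transpose Y ** (P ** (X - Y)))"
    have "norm ?s \<le> norm ((X - Y) ** (transpose X ** (P ** X))) + norm (Y ** (transpose (X - Y) ** (P ** X)))
        + norm (Y ** (transpose Y ** (P ** (X - Y))))"
      by (rule norm_triangle_le [OF add_right_mono [OF norm_triangle_ineq]])
    hence "norm ?s \<le> 3 * (r\<^sup>2 * norm P * norm (X - Y))"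
      using 1 2 3 by (simp add: power2_eq_square algebra_simps)
    hence "\<bar>m\<bar> * norm ?s \<le> \<bar>m\<bar> * (3 * (r\<^sup>2 * norm P * norm (X - Y)))"
      by (rule mult_left_mono) simp
    moreover have "norm (F X - F Y) \<le> norm P * norm (X - Y) + \<bar>m\<bar> * norm ?s"
      unfolding eq by (rule norm_triangle_le) (use nPr [of "X - Y"] in simp)
    ultimately show ?thesis by (simp add: algebra_simps)
  qed
  have "(\<lambda>t. c t - d t) t = 0"
  proof (rule derivative_bound_imp_zero)
    show "((\<lambda>t. c t - d t) has_vector_derivative (F (c t) - F (d t))) (at t)" for t
      by (intro has_vector_derivative_diff ode c d cP dP)
    show "norm (F (c t) - F (d t)) \<le> (norm P * (1 + 3 * \<bar>m\<bar> * r\<^sup>2)) * norm (c t - d t)" for t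
      by (intro Lip ode c d cP dP)
  qed (simp add: init)
  thus "c t = d t" by simp
qed

lemma stiefel_geodesic_from_eq:
  assumes \<beta>: "\<beta> > 0" and c: "geodesic stiefel stiefel_tangent (stiefel_metric \<beta>) c"
    and init: "c 0 = X" "(c has_vector_derivative v) (at 0)"
  shows "geodesic_from stiefel stiefel_tangent (stiefel_metric \<beta>) X v = c"
  unfolding geodesic_from_def
  by (rule the_equality) (use assms vector_derivative_at [OF init(2)] stiefel_geodesic_unique [OF \<beta>] in auto)


section \<open>Geodesics that are orbits of one-parameter groups\<close>

lemma smooth_linear_ode:
  fixes c :: "real \<Rightarrow> real^'p^'m"
  assumes "\<And>t. (c has_vector_derivative P ** c t) (at t)" shows "smooth c"
proof -
  \<comment> \<open>Generalizing to A ** c makes the family closed under differentiation, as the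
    derivative is (A ** P) ** c.\<close>
  have "C_upto k (\<lambda>t. A ** c t)" for k and A :: "real^'m^'m"
  proof (induction k arbitrary: A)
    case 0
    have "isCont (\<lambda>t. A ** c t) t" for t
      using bounded_linear.has_vector_derivative [OF matrix_mult.bounded_linear_right assms]
      by (rule has_vector_derivative_continuous)
    thus ?case by (simp add: continuous_on_eq_continuous_at)
  next
    case (Suc k)
    have d: "((\<lambda>t. A ** c t) has_derivative (\<lambda>s. s *\<^sub>R (A ** (P ** c t)))) (at t)" for t
      using bounded_linear.has_vector_derivative [OF matrix_mult.bounded_linear_right assms]
      by (simp add: has_vector_derivative_def)
    have "C_upto k (\<lambda>t. (s *\<^sub>R (A ** P)) ** c t)" for s by (rule Suc.IH)
    moreover have "frechet_derivative (\<lambda>t. A ** c t) (at t) s = (s *\<^sub>R (A ** P)) ** c t" for s t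
      unfolding frechet_derivative_at [OF d, symmetric] by (simp add: matrix_mult.scaleR_left matrix_mul_assoc)
    ultimately show ?case using differentiableI [OF d] by simp
  qed
  from this [of _ "mat 1"] show ?thesis by (simp add: smooth_def)
qed

lemma stiefel_momentum_rotate:
  fixes X v :: "real^'p^('p + 'q::finite)" and E :: "real^('p + 'q)^('p + 'q)"
  assumes E: "transpose E ** E = mat 1"
  shows "stiefel_momentum \<beta> (E ** X) (E ** v) = E ** (stiefel_momentum \<beta> X v ** transpose E)"
proof -
  have "transpose E ** (E ** Z) = Z" for Z :: "real^('p + 'q)^('p + 'q)"
    by (simp add: matrix_mul_assoc E)
  thus ?thesis by (simp add: stiefel_momentum_def matrix_alg_simps)
qed

text \<open>Along the orbit of X under exp(tP) the momentum is conjugated by exp(tP). Hypothesis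
  \<open>m\<close> says that it starts as P, which commutes with exp(tP), so it stays
  constant.\<close>

lemma stiefel_geodesicI:
  fixes c :: "real \<Rightarrow> real^'p^('p + 'q::finite)"
  assumes \<beta>: "\<beta> > 0" and c0: "c 0 \<in> stiefel" and P: "transpose P = - P" "\<And>t. (c has_vector_derivative P ** c t) (at t)"
    and m: "stiefel_momentum \<beta> (c 0) (P ** c 0) = P"
  shows "geodesic stiefel stiefel_tangent (stiefel_metric \<beta>) c" "c t \<in> stiefel"
proof -
  obtain E where E: "skew_flow P E" using skew_flow_exists [OF P(1)] by blast
  note Ed = stiefel_flow [OF E c0]
  have cE: "c t = E t ** c 0" for t
  proof -
    have "((\<lambda>t. c t - E t ** c 0) has_vector_derivative P ** (c t - E t ** c 0)) (at t)" for t
      using has_vector_derivative_diff [OF P(2) Ed(1)] by (simp add: matrix_mult.diff_right)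
    from derivative_bound_imp_zero [OF this norm_matrix_mult_le, of t] show ?thesis
      by (simp add: Ed(2))
  qed
  show cM: "c t \<in> stiefel" for t using Ed(3) [of t] cE [of t] by metis
  have EE: "E t ** transpose (E t) = mat 1" for t
    using skew_flow_orthogonal [OF E] matrix_left_right_inverse by blast
  have "stiefel_momentum \<beta> (c t) (P ** c t) = E t ** (stiefel_momentum \<beta> (c 0) (P ** c 0) ** transpose (E t))" for t
  proof -
    have PE: "P ** c t = E t ** (P ** c 0)"
      unfolding cE [of t] by (simp add: matrix_mul_assoc skew_flow_commute [OF E])
    show ?thesis
      unfolding PE unfolding cE [of t] by (rule stiefel_momentum_rotate [OF skew_flow_orthogonal [OF E]])
  qed
  hence "stiefel_momentum \<beta> (c t) (P ** c t) = P" for t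
    unfolding m by (simp add: matrix_mul_assoc skew_flow_commute [OF E, symmetric]) (simp add: EE matrix_mul_assoc [symmetric])
  thus "geodesic stiefel stiefel_tangent (stiefel_metric \<beta>) c"
    unfolding stiefel_geodesic_iff [OF \<beta> smooth_linear_ode [OF P(2)] cM P(2)] by simp
qed

section \<open>Lengths of curves and upper bounds for the injectivity radius\<close>

lemma admissible_stiefel_path:
  fixes c :: "real \<Rightarrow> real^'p^('p + 'q::finite)"
  assumes "admissible_path stiefel (stiefel_metric \<beta>) c"
  obtains S where "finite S" "\<And>t. t \<in> {0..1} - S \<Longrightarrow> (c has_vector_derivative vector_derivative c (at t)) (at t)"
    "\<And>t. t \<in> {0..1} - S \<Longrightarrow> vector_derivative c (at t) \<in> stiefel_tangent (c t)"
    "\<And>t. t \<in> {0..1} - S \<Longrightarrow> stiefel_metric \<beta> (c t) (vector_derivative c (at t)) (vector_derivative c (at t))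
        = stiefel_form \<beta> (c t) (vector_derivative c (at t)) (vector_derivative c (at t))"
    "\<And>t. t \<in> {0..1} \<Longrightarrow> c t \<in> stiefel" "continuous_on {0..1} c"
proof -
  have c: "c piecewise_C1_differentiable_on {0..1}" and cM: "t \<in> {0..1} \<Longrightarrow> c t \<in> stiefel" for t
    using assms by (auto simp: admissible_path_def path_image_def)
  obtain S where cont: "continuous_on {0..1} c" and S: "finite S" "c C1_differentiable_on ({0..1} - S)"
    using c unfolding piecewise_C1_differentiable_on_def by blast
  have d: "(c has_vector_derivative vector_derivative c (at t)) (at t)" if "t \<in> {0..1} - S" for t
    using S(2) that unfolding C1_differentiable_on_eq by (simp add: vector_derivative_works)
  \<comment> \<open>The end points are excluded as well: the path is confined to the manifold only
    on the unit interval, so a two-sided derivative at 0 or 1 need not be tangent.\<close>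
  have tan: "vector_derivative c (at t) \<in> stiefel_tangent (c t)" if t: "t \<in> {0..1} - (S \<union> {0,1})" for t
  proof (rule stiefel_curve_tangent [OF d])
    have "open {0<..<1::real}" "t \<in> {0<..<1}" using t by auto
    hence "\<forall>\<^sub>F s in at t. s \<in> {0<..<1}" by (rule eventually_at_in_open')
    thus "\<forall>\<^sub>F s in at t. c s \<in> stiefel" by (rule eventually_mono) (use cM in auto)
  qed (use t cM in auto)
  show thesis
  proof (rule that [of "S \<union> {0,1}"])
    show "stiefel_metric \<beta> (c t) (vector_derivative c (at t)) (vector_derivative c (at t))
        = stiefel_form \<beta> (c t) (vector_derivative c (at t)) (vector_derivative c (at t))" if "t \<in> {0..1} - (S \<union> {0,1})" for t
      using that by (intro stiefel_metric_eq tan cM) auto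
  qed (use S d tan cM cont in auto)
qed

text \<open>Bounds the set of lengths below, so that its infimum is meaningful. At exceptional
  points \<open>stiefel_metric\<close> may be an arbitrary \<open>THE\<close> value; the integrand
  is set to 0 there.\<close>

lemma curve_length_nonneg:
  fixes c :: "real \<Rightarrow> real^'p^('p + 'q::finite)"
  assumes c: "admissible_path stiefel (stiefel_metric \<beta>) c" and \<beta>: "\<beta> > 0"
  shows "0 \<le> curve_length (stiefel_metric \<beta>) c"
proof -
  obtain S where S: "finite S" 
    "\<And>t. t \<in> {0..1} - S \<Longrightarrow> stiefel_metric \<beta> (c t) (vector_derivative c (at t)) (vector_derivative c (at t))
        = stiefel_form \<beta> (c t) (vector_derivative c (at t)) (vector_derivative c (at t))"
    "\<And>t. t \<in> {0..1} \<Longrightarrow> c t \<in> stiefel"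
    using admissible_stiefel_path [OF c] by metis
  let ?f = "\<lambda>t. sqrt (stiefel_metric \<beta> (c t) (vector_derivative c (at t)) (vector_derivative c (at t)))"
  have "?f integrable_on {0..1}" using c by (simp add: admissible_path_def)
  hence "(?f has_integral curve_length (stiefel_metric \<beta>) c) {0..1}"
    unfolding curve_length_def by (rule integrable_integral)
  hence "((\<lambda>t. if t \<in> S then 0 else ?f t) has_integral curve_length (stiefel_metric \<beta>) c) {0..1}"
    by (rule has_integral_spike_finite [OF S(1), rotated]) auto
  thus ?thesis
    by (rule has_integral_nonneg) (use S stiefel_form_nonneg [OF _ \<beta>] in auto)
qed

lemma riemannian_dist_le:
  fixes c :: "real \<Rightarrow> real^'p^('p + 'q::finite)"
  assumes \<beta>: "\<beta> > 0" and c: "\<And>s. c s \<in> stiefel" "\<And>s. (c has_vector_derivative v s) (at s)" "continuous_on {0..1} v"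
    and L: "\<And>s. stiefel_form \<beta> (c s) (v s) (v s) = L\<^sup>2" "L \<ge> 0"
  shows "riemannian_dist stiefel (stiefel_metric \<beta>) (c 0) (c 1) \<le> L"
    and "admissible_path stiefel (stiefel_metric \<beta>) c"
proof -
  have vT: "v s \<in> stiefel_tangent (c s)" for s
    by (rule stiefel_curve_tangent [OF c(2)]) (use c(1) in auto)
  have sp: "sqrt (stiefel_metric \<beta> (c t) (vector_derivative c (at t)) (vector_derivative c (at t))) = L" for t
    using L vector_derivative_at [OF c(2)] by (simp add: stiefel_metric_eq [OF c(1) vT vT])
  have "c C1_differentiable_on {0..1}"
    unfolding C1_differentiable_on_def using c by blast
  thus adm: "admissible_path stiefel (stiefel_metric \<beta>) c"
    unfolding admissible_path_def sp
    using c(1) by (auto simp: path_image_def C1_differentiable_imp_piecewise)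
  have "curve_length (stiefel_metric \<beta>) c = L"
    unfolding curve_length_def sp by simp
  hence "L \<in> {curve_length (stiefel_metric \<beta>) d | d. admissible_path stiefel (stiefel_metric \<beta>) d \<and>
      pathstart d = c 0 \<and> pathfinish d = c 1}"
    using adm by (force simp: pathstart_def pathfinish_def)
  moreover have "bdd_below {curve_length (stiefel_metric \<beta>) d | d. admissible_path stiefel (stiefel_metric \<beta>) d \<and>
      pathstart d = c 0 \<and> pathfinish d = c 1}"
    by (rule bdd_belowI [of _ 0]) (auto intro: curve_length_nonneg \<beta>)
  ultimately show "riemannian_dist stiefel (stiefel_metric \<beta>) (c 0) (c 1) \<le> L"
    unfolding riemannian_dist_def by (rule cInf_lower)
qed

text \<open>\<open>cut_time\<close> is a supremum over all times at which the geodesic realizes the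
  distance, so a strictly shorter connection is demanded for every t > r and not only just beyond
  r.\<close>

lemma stiefel_inj_le:
  fixes c :: "real \<Rightarrow> real^'p^('p + 'q::finite)"
  assumes \<beta>: "\<beta> > 0" and c: "geodesic stiefel stiefel_tangent (stiefel_metric \<beta>) c"
    and v: "(c has_vector_derivative v) (at 0)" "stiefel_form \<beta> (c 0) v v = 1"
    and d: "\<And>t. t > r \<Longrightarrow> riemannian_dist stiefel (stiefel_metric \<beta>) (c 0) (c t) < t"
  shows "stiefel_inj TYPE('p) TYPE('q) \<beta> \<le> ereal r"
proof -
  have cM: "c t \<in> stiefel" for t using c by (simp add: geodesic_def)
  have vT: "v \<in> stiefel_tangent (c 0)"
    by (rule stiefel_curve_tangent [OF v(1)]) (use cM in auto)
  have geo: "geodesic_from stiefel stiefel_tangent (stiefel_metric \<beta>) (c 0) v = c"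
    by (rule stiefel_geodesic_from_eq [OF \<beta> c _ v(1)]) simp
  have "stiefel_inj TYPE('p) TYPE('q) \<beta> \<le> injectivity_radius_at stiefel stiefel_tangent (stiefel_metric \<beta>) (c 0)"
    unfolding stiefel_inj_def injectivity_radius_def by (rule Inf_lower) (use cM in blast)
  also have "\<dots> \<le> cut_time stiefel stiefel_tangent (stiefel_metric \<beta>) (c 0) v"
    unfolding injectivity_radius_at_def
    by (rule Inf_lower) (use vT v(2) in \<open>auto simp: stiefel_metric_eq [OF cM]\<close>)
  also have "\<dots> \<le> ereal r"
    unfolding cut_time_def geo
  proof (rule Sup_least, clarify)
    fix t assume "riemannian_dist stiefel (stiefel_metric \<beta>) (c 0) (c t) = t"
    hence "\<not> t > r" using d by force
    thus "ereal t \<le> ereal r" by simp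
  qed
  finally show ?thesis .
qed

section \<open>Closed geodesics that rotate columns into the orthogonal complement\<close>

lemma reduce_mod_2pi:
  obtains y where "\<bar>y\<bar> \<le> pi" "cos y = cos x" "sin y = sin (x::real)"
proof -
  have "cis x \<noteq> 0" by (rule cis_neq_zero)
  hence "cis (Arg (cis x)) = cis x" by (simp add: cis_Arg sgn_div_norm)
  hence "cos (Arg (cis x)) = cos x" "sin (Arg (cis x)) = sin x"
    by (metis cis.simps)+
  thus thesis using that [of "Arg (cis x)"] Arg_bounded [of "cis x"] by auto
qed

text \<open>H is a partial isometry with initial projection Pi. K is the horizontal tangent vector
  at \<open>I_np\<close> given by H, B the part of \<open>I_np\<close> that will be rotated towards
  K, and R the part that stays fixed.\<close>

locale horizontal_partial_isometry =
  fixes H :: "real^'p^'q::finite" and Pi :: "real^'p^'p" and K B R :: "real^'p^('p + 'q)"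
  assumes HH: "transpose H ** H = Pi" and HP: "H ** Pi = H"
    and K: "K = stack 0 H" and B: "B = I_np ** Pi" and R: "R = I_np - B"
begin

definition rot :: "real \<Rightarrow> real^'p^('p + 'q)" where
  "rot t = cos t *\<^sub>R B + sin t *\<^sub>R K + R"

lemma Pi_sym: "transpose Pi = Pi"
  unfolding HH [symmetric] by (simp add: matrix_transpose_mul)

lemma Pi_idem: "Pi ** Pi = Pi"
  by (metis HH HP matrix_mul_assoc)

lemma prods:
  "transpose I_np ** (I_np :: real^'p^('p + 'q)) = mat 1"
  "transpose K ** K = Pi" "transpose I_np ** K = 0" "transpose K ** I_np = 0" "K ** Pi = K"
proof -
  show I: "transpose I_np ** (I_np :: real^'p^('p + 'q)) = mat 1"
    using I_np_stiefel by (rule stiefelD)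
  show "transpose K ** K = Pi" by (simp add: K transpose_stack_mult HH)
  show IK: "transpose I_np ** K = 0" by (simp add: K I_np_def transpose_stack_mult)
  have "transpose (transpose I_np ** K) = 0" by (simp add: IK)
  thus "transpose K ** I_np = 0" by (simp add: matrix_transpose_mul)
  have "stack 0 (H ** Pi) = stack 0 H ** Pi"
  proof -
    have "stack 0 (H ** Pi) $ i = (stack 0 H ** Pi) $ i" for i
      by (cases i) (simp_all add: matrix_matrix_mult_def vec_eq_iff)
    thus ?thesis by (simp add: vec_eq_iff)
  qed
  thus "K ** Pi = K" by (simp add: K HP)
qed

lemma BKR:
  "transpose B ** B = Pi" "transpose B ** K = 0" "transpose K ** B = 0" "transpose B ** R = 0" "transpose R ** B = 0"
  "transpose K ** R = 0" "transpose R ** K = 0" "transpose R ** R = mat 1 - Pi"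
proof -
  have I: "transpose I_np ** ((I_np :: real^'p^('p + 'q)) ** Z) = Z" for Z :: "real^'p^'p"
    using prods(1) by (simp add: matrix_mul_assoc)
  have K0: "transpose K ** (I_np ** Z) = 0" for Z :: "real^'p^'p"
    using prods(4) by (simp add: matrix_mul_assoc)
  show "transpose B ** B = Pi" "transpose B ** K = 0" "transpose K ** B = 0" "transpose B ** R = 0" "transpose R ** B = 0"
    "transpose K ** R = 0" "transpose R ** K = 0" "transpose R ** R = mat 1 - Pi"
    by (simp_all add: B R matrix_alg_simps I K0 Pi_sym Pi_idem prods)
qed

lemma rot_deriv: "((\<lambda>t. rot (w * t)) has_vector_derivative w *\<^sub>R (cos (w * t) *\<^sub>R K - sin (w * t) *\<^sub>R B)) (at t)"
  unfolding rot_def by (auto intro!: derivative_eq_intros simp: algebra_simps)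

text \<open>P maps B to K and K to -B and annihilates R, so it generates the rotation. Since I_np^T
  K = 0, the momentum of w K is w P for every \<beta>.\<close>

lemma rot_geodesic:
  assumes "\<beta> > 0"
  shows "geodesic stiefel stiefel_tangent (stiefel_metric \<beta>) (\<lambda>t. rot (w * t))" "rot t \<in> stiefel"
proof -
  define P where "P = K ** transpose I_np - I_np ** transpose K"
  have P: "transpose P = - P" by (simp add: P_def matrix_alg_simps)
  have PB: "P ** B = K" "P ** K = - B"
  proof -
    have "transpose I_np ** ((I_np :: real^'p^('p + 'q)) ** Pi) = Pi" "transpose K ** (I_np ** Pi) = 0"
      using prods by (simp_all add: matrix_mul_assoc)
    thus "P ** B = K" "P ** K = - B"
      by (simp_all add: P_def matrix_mult.diff_left matrix_mul_assoc [symmetric] prods B)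
  qed
  have "P ** I_np = K"
    by (simp add: P_def matrix_mult.diff_left matrix_mul_assoc [symmetric] prods)
  hence PR: "P ** R = 0" by (simp add: R matrix_mult.diff_right PB)
  have d: "((\<lambda>t. rot (w * t)) has_vector_derivative (w *\<^sub>R P) ** rot (w * t)) (at t)" for w t
  proof -
    have "(w *\<^sub>R P) ** rot (w * t) = w *\<^sub>R (cos (w * t) *\<^sub>R K - sin (w * t) *\<^sub>R B)"
      by (simp add: rot_def matrix_mult.scaleR_left matrix_mult.scaleR_right matrix_mult.add_right PB PR
          scaleR_diff_right mult.commute)
    thus ?thesis using rot_deriv [of w t] by simp
  qed
  have rot0: "rot 0 = I_np" by (simp add: rot_def) (simp add: R)
  have m: "stiefel_momentum \<beta> (rot (w * 0)) ((w *\<^sub>R P) ** rot (w * 0)) = w *\<^sub>R P" for w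
  proof -
    have "transpose I_np ** (K ** Z) = 0" for Z :: "real^('p + 'q)^'p"
      by (simp add: matrix_mul_assoc prods)
    thus ?thesis
      by (simp add: rot0 \<open>P ** I_np = K\<close> stiefel_momentum_def matrix_alg_simps)
        (simp add: P_def scaleR_diff_right)
  qed
  show "geodesic stiefel stiefel_tangent (stiefel_metric \<beta>) (\<lambda>t. rot (w * t))"
    using stiefel_geodesicI(1) [OF assms, of "\<lambda>t. rot (w * t)", OF _ _ d m]
    by (simp add: rot0 I_np_stiefel P transpose_scaleR)
  show "rot t \<in> stiefel"
    using stiefel_geodesicI(2) [OF assms, of "\<lambda>t. rot (1 * t)", OF _ _ d m]
    by (simp add: rot0 I_np_stiefel P transpose_scaleR)
qed

lemma rot_speed:
  "stiefel_form \<beta> (rot t) (w *\<^sub>R (cos t *\<^sub>R K - sin t *\<^sub>R B)) (w *\<^sub>R (cos t *\<^sub>R K - sin t *\<^sub>R B)) = w\<^sup>2 * trace Pi"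
proof -
  let ?v = "cos t *\<^sub>R K - sin t *\<^sub>R B"
  have "transpose (rot t) ** ?v = 0"
    by (simp add: rot_def matrix_alg_simps BKR prods)
  moreover have "?v \<bullet> ?v = (cos t)\<^sup>2 * (K \<bullet> K) + (sin t)\<^sup>2 * (B \<bullet> B) - 2 * sin t * cos t * (B \<bullet> K)"
    by (simp add: inner_diff_left inner_diff_right inner_commute power2_eq_square algebra_simps)
  hence "?v \<bullet> ?v = trace Pi"
    by (simp add: inner_matrix_conv_trace BKR prods trace_def flip: distrib_right)
  ultimately show ?thesis
    by (simp add: stiefel_form_def matrix_mult.scaleR_right power2_eq_square)
qed

text \<open>The rotation closes up at 2 pi, so the end point is also reached by an angle of absolute
  value at most pi, possibly backwards.\<close>

lemma rot_dist:
  assumes "\<beta> > 0"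
  obtains y where "\<bar>y\<bar> \<le> pi" "cos y = cos x" "sin y = sin x"
    "riemannian_dist stiefel (stiefel_metric \<beta>) (rot 0) (rot x) \<le> \<bar>y\<bar> * sqrt (trace Pi)"
proof -
  obtain y where y: "\<bar>y\<bar> \<le> pi" "cos y = cos x" "sin y = sin x" by (rule reduce_mod_2pi)
  have tr: "trace Pi \<ge> 0" using HH inner_ge_zero [of H] by (simp add: inner_matrix_conv_trace)
  have "riemannian_dist stiefel (stiefel_metric \<beta>) (rot (y * 0)) (rot (y * 1)) \<le> \<bar>y\<bar> * sqrt (trace Pi)"
  proof (rule riemannian_dist_le [OF assms rot_geodesic(2) [OF assms] rot_deriv])
    show "continuous_on {0..1} (\<lambda>s. y *\<^sub>R (cos (y * s) *\<^sub>R K - sin (y * s) *\<^sub>R B))"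
      by (intro continuous_intros)
  qed (use tr in \<open>simp_all add: rot_speed power_mult_distrib\<close>)
  moreover have "rot y = rot x" by (simp add: rot_def y)
  ultimately show thesis using that [OF y] by simp
qed

end

definition unit_matrix :: "'m \<Rightarrow> 'n \<Rightarrow> real^'n::finite^'m::finite" where
  "unit_matrix i j = (\<chi> r s. if r = i \<and> s = j then 1 else 0)"

lemma unit_matrix_mult: "unit_matrix i j ** unit_matrix k l = (if j = k then unit_matrix i l else 0)"
  by (auto simp: unit_matrix_def matrix_matrix_mult_def vec_eq_iff if_distrib [where f = "\<lambda>x. x * _"]
      if_distrib [where f = "\<lambda>x. _ * x"] sum.delta cong: if_cong intro!: sum.neutral)

lemma transpose_unit_matrix: "transpose (unit_matrix i j) = unit_matrix j i"
  by (auto simp: unit_matrix_def transpose_def vec_eq_iff)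

lemma trace_unit_matrix: "trace (unit_matrix i i) = 1"
  by (simp add: unit_matrix_def trace_def)

text \<open>H of rank one rotates a single column at unit speed, and beyond t = pi the opposite
  direction is shorter.\<close>

theorem stiefel_inj_le_pi:
  assumes \<beta>: "\<beta> > 0"
  shows "stiefel_inj TYPE('p::finite) TYPE('q::finite) \<beta> \<le> ereal pi"
proof -
  fix a :: 'p and b :: 'q
  interpret horizontal_partial_isometry "unit_matrix b a" "unit_matrix a a" "stack 0 (unit_matrix b a)"
    "I_np ** unit_matrix a a" "I_np - I_np ** unit_matrix a a :: real^'p^('p + 'q)"
    by unfold_locales (simp_all add: unit_matrix_mult transpose_unit_matrix)
  show ?thesis
  proof (rule stiefel_inj_le [OF \<beta> rot_geodesic(1) [OF \<beta>] rot_deriv])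
    fix t assume t: "t > pi"
    obtain y where "\<bar>y\<bar> \<le> pi"
      "riemannian_dist stiefel (stiefel_metric \<beta>) (rot 0) (rot t) \<le> \<bar>y\<bar> * sqrt (trace (unit_matrix a a))"
      using rot_dist [OF \<beta>] by metis
    thus "riemannian_dist stiefel (stiefel_metric \<beta>) (rot (1 * 0)) (rot (1 * t)) < t"
      using t by (simp add: trace_unit_matrix)
  qed (simp only: rot_speed trace_unit_matrix, simp)
qed

section \<open>The first conjugate point of the canonical metric\<close>

text \<open>Endpoint conditions for the geodesic \<open>exp(u [2ib, -h; h, 0]) (1, 0)\<close> of the Berger sphere, with \<open>\<omega>\<^sup>2 = b\<^sup>2 + h\<^sup>2\<close>,
  to end at \<open>(cos s, sin s)\<close>.\<close>

definition berger_endpoint :: "real \<Rightarrow> real \<Rightarrow> real \<Rightarrow> bool" where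
  "berger_endpoint b \<omega> s \<longleftrightarrow> \<omega> > 0 \<and> b\<^sup>2 \<le> \<omega>\<^sup>2 \<and>
     sin b * cos \<omega> + b / \<omega> * cos b * sin \<omega> = 0 \<and>
     cos b * cos \<omega> - b / \<omega> * sin b * sin \<omega> = cos s \<and>
     sqrt (\<omega>\<^sup>2 - b\<^sup>2) / \<omega> * sin \<omega> = sin s"

text \<open>\<open>J\<close> acts as multiplication by the imaginary unit on the image of \<open>Pi\<close>, so that \<open>emb\<close> below maps the unit
  sphere of \<open>\<complex>\<^sup>2\<close> onto a Berger sphere.\<close>

locale complex_partial_isometry = horizontal_partial_isometry H Pi K B R
  for H :: "real^'p^'q::finite" and Pi K B R +
  fixes J :: "real^'p^'p"
  assumes J: "transpose J = - J" "J ** J = - Pi" "J ** Pi = J" "Pi ** J = J"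
    and tr: "trace Pi = 2"
begin

text \<open>A copy of the complex numbers inside the matrices, with unit Pi and with transposition
  as conjugation.\<close>

definition Zm :: "complex \<Rightarrow> real^'p^'p" where
  "Zm z = Re z *\<^sub>R Pi + Im z *\<^sub>R J"

lemma Zm_adj: "transpose (Zm z) ** Zm w = Zm (cnj z * w)"
  by (simp add: Zm_def matrix_alg_simps J Pi_idem Pi_sym algebra_simps)

lemma Zm_Pi: "Pi ** Zm z = Zm z" "Zm z ** Pi = Zm z"
  by (simp_all add: Zm_def matrix_alg_simps J Pi_idem)

lemma Zm_inner: "Zm z \<bullet> Zm w = 2 * Re (cnj z * w)"
proof -
  have "J \<bullet> Pi = 0" by (rule skew_inner_symmetric [OF J(1) Pi_sym])
  moreover have "Pi \<bullet> Pi = 2" "J \<bullet> J = 2"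
    by (simp_all add: inner_matrix_conv_trace Pi_sym Pi_idem J tr matrix_mult.minus_left)
  ultimately show ?thesis
    by (simp add: Zm_def inner_add_left inner_add_right inner_commute [of Pi J])
qed

lemma linear_Zm: "bounded_linear Zm"
  unfolding linear_conv_bounded_linear [symmetric]
  by (rule linearI) (simp_all add: Zm_def algebra_simps)

definition emb :: "complex \<Rightarrow> complex \<Rightarrow> real^'p^('p + 'q)" where
  "emb z w = B ** Zm z + K ** Zm w + R"

lemma emb_real: "emb (of_real x) (of_real y) = x *\<^sub>R B + y *\<^sub>R K + R"
proof -
  have "B ** Pi = B" by (simp add: B matrix_mul_assoc [symmetric] Pi_idem)
  thus ?thesis by (simp add: emb_def Zm_def matrix_mult.scaleR_right prods)
qed

lemma BKR_mult:
  "transpose B ** (B ** Z) = Pi ** Z" "transpose B ** (K ** Z) = 0" "transpose K ** (B ** Z) = 0"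
  "transpose K ** (K ** Z) = Pi ** Z" "transpose R ** (B ** Z) = 0" "transpose R ** (K ** Z) = 0"
  for Z :: "real^'p^'p"
  by (simp_all add: matrix_mul_assoc BKR prods)

lemma emb_adj:
  "transpose (emb z w) ** (B ** Zm z' + K ** Zm w') = Zm (cnj z * z' + cnj w * w')"
proof -
  have "transpose (emb z w) ** (B ** Zm z' + K ** Zm w') = Zm (cnj z * z') + Zm (cnj w * w')"
    by (simp add: emb_def matrix_alg_simps BKR_mult Zm_Pi) (simp add: Zm_adj)
  thus ?thesis by (simp add: bounded_linear.linear [OF linear_Zm] linear_add)
qed

lemma emb_stiefel:
  assumes "(cmod z)\<^sup>2 + (cmod w)\<^sup>2 = 1" shows "emb z w \<in> stiefel"
proof -
  have 1: "transpose (emb z w) ** R = mat 1 - Pi"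
    by (simp add: emb_def matrix_alg_simps BKR)
  have 2: "cnj z * z + cnj w * w = 1"
    using assms unfolding cmod_power2 by (simp add: complex_eq_iff power2_eq_square)
  have "transpose (emb z w) ** emb z w = transpose (emb z w) ** (B ** Zm z + K ** Zm w) + transpose (emb z w) ** R"
    by (simp add: emb_def [of z w] matrix_mult.add_right)
  also have "\<dots> = mat 1"
    unfolding emb_adj 1 2 by (simp add: Zm_def)
  finally show ?thesis by (simp add: stiefel_def)
qed

text \<open>The Berger metric: twice the round metric, with the squared length along the Hopf fibres
  halved. The first hypothesis is tangency to the unit sphere.\<close>

lemma emb_form:
  assumes "Re (cnj z * z' + cnj w * w') = 0" and v_def: "v = B ** Zm z' + K ** Zm w'"
  shows "stiefel_form (1/2) (emb z w) v v =
    2 * ((cmod z')\<^sup>2 + (cmod w')\<^sup>2) - (Im (cnj z * z' + cnj w * w'))\<^sup>2"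
proof -
  have "v \<bullet> v = Zm z' \<bullet> Zm z' + Zm w' \<bullet> Zm w'"
    by (simp add: v_def inner_add_left inner_add_right inner_matrix_mult_left BKR_mult Zm_Pi)
  moreover define c where "c = cnj z * z' + cnj w * w'"
  have "Zm c \<bullet> Zm c = 2 * (Im c)\<^sup>2"
    using assms(1) unfolding c_def [symmetric] by (simp add: Zm_inner power2_eq_square)
  ultimately show ?thesis
    unfolding stiefel_form_def v_def emb_adj c_def [symmetric] cmod_power2
    by (simp add: Zm_inner cmod_power2 power2_eq_square)
qed

lemma emb_deriv:
  assumes "(z has_vector_derivative z') (at t)" "(w has_vector_derivative w') (at t)"
  shows "((\<lambda>t. emb (z t) (w t)) has_vector_derivative B ** Zm z' + K ** Zm w') (at t)"
  unfolding emb_def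
  by (auto intro!: derivative_eq_intros bounded_linear.has_vector_derivative [OF matrix_mult.bounded_linear_right]
      bounded_linear.has_vector_derivative [OF linear_Zm] assms)

text \<open>Removing the scalar i b from the generator [2ib, -h; h, 0] leaves a matrix with square
  -\<omega>^2, where \<omega>^2 = b^2 + h^2. This gives the closed form of the curve with p =
  b/\<omega> and q = h/\<omega>. Its squared speed is 2(4b^2 + h^2) - (2b)^2 = 2(\<omega>^2 +
  b^2).\<close>

lemma berger_dist:
  assumes bw: "berger_endpoint b \<omega> s"
  shows "riemannian_dist stiefel (stiefel_metric (1/2)) (rot 0) (rot s) \<le> sqrt 2 * sqrt (\<omega>\<^sup>2 + b\<^sup>2)"
proof -
  have \<omega>: "\<omega> > 0" "b\<^sup>2 \<le> \<omega>\<^sup>2" using bw by (auto simp: berger_endpoint_def)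
  define p where "p = b / \<omega>"
  define q where "q = sqrt (\<omega>\<^sup>2 - b\<^sup>2) / \<omega>"
  have b: "b = p * \<omega>" using \<omega> by (simp add: p_def)
  have pq: "p * p + q * q = 1"
    using \<omega> by (simp add: p_def q_def power2_eq_square field_simps)
  let ?C = "\<lambda>u. cos (\<omega> * u)" and ?S = "\<lambda>u. sin (\<omega> * u)"
  have CS: "?C u * ?C u + ?S u * ?S u = 1" for u
    using sin_cos_squared_add2 [of "\<omega> * u"] by (simp add: power2_eq_square)
  define z where "z u = cis (b * u) * Complex (?C u) (p * ?S u)" for u
  \<comment> \<open>The shift by 1 multiplies the second coordinate by the constant phase exp(-ib).
    It keeps the start, where w = 0, and makes the second coordinate of the end point real.\<close>
  define w where "w u = cis (b * (u - 1)) * Complex (q * ?S u) 0" for u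
  define z' where "z' u = cis (b * u) * Complex (- \<omega> * (1 + p * p) * ?S u) (2 * p * \<omega> * ?C u)" for u
  define w' where "w' u = cis (b * (u - 1)) * Complex (q * \<omega> * ?C u) (q * p * \<omega> * ?S u)" for u
  have vdC: "(f has_vector_derivative y) F" if "((\<lambda>t. Re (f t)) has_vector_derivative Re y) F"
    "((\<lambda>t. Im (f t)) has_vector_derivative Im y) F" for f y F
    using that by (simp add: has_vector_derivative_complex_iff has_real_derivative_iff_has_vector_derivative)
  have z'd: "(z has_vector_derivative z' u) (at u)" for u
    unfolding z_def z'_def
    by (rule vdC; simp flip: has_real_derivative_iff_has_vector_derivative)
      (auto intro!: derivative_eq_intros simp: algebra_simps b)
  have w'd: "(w has_vector_derivative w' u) (at u)" for u
    unfolding w_def w'_def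
    by (rule vdC; simp flip: has_real_derivative_iff_has_vector_derivative)
      (auto intro!: derivative_eq_intros simp: algebra_simps b)
  have cc: "cnj (cis x * y) * (cis x * y') = cnj y * y'" for x y y'
  proof -
    have "cnj (cis x * y) * (cis x * y') = (cnj (cis x) * cis x) * (cnj y * y')" by (simp add: mult_ac)
    thus ?thesis by (simp add: cis_cnj cis_mult)
  qed
  have adj: "cnj (z u) * z' u + cnj (w u) * w' u = Complex 0 (2 * b)" for u
  proof -
    have "Re (cnj (z u) * z' u + cnj (w u) * w' u) = 0"
      unfolding z_def z'_def w_def w'_def cc by simp (use pq CS [of u] in algebra)
    moreover have "Im (cnj (z u) * z' u + cnj (w u) * w' u) = 2 * b"
      unfolding z_def z'_def w_def w'_def cc b by simp (use pq CS [of u] in algebra)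
    ultimately show ?thesis by (simp add: complex_eq_iff)
  qed
  have zw: "(cmod (z u))\<^sup>2 + (cmod (w u))\<^sup>2 = 1" for u
    unfolding z_def w_def norm_mult power_mult_distrib cmod_power2
    by simp (use pq CS [of u] in algebra)
  have zw': "2 * ((cmod (z' u))\<^sup>2 + (cmod (w' u))\<^sup>2) - (2 * b)\<^sup>2 = 2 * (\<omega>\<^sup>2 + b\<^sup>2)" for u
    unfolding z'_def w'_def norm_mult power_mult_distrib cmod_power2 b
    by simp (use pq CS [of u] in algebra)
  let ?L = "sqrt 2 * sqrt (\<omega>\<^sup>2 + b\<^sup>2)"
  have "riemannian_dist stiefel (stiefel_metric (1/2)) (emb (z 0) (w 0)) (emb (z 1) (w 1)) \<le> ?L"
  proof (rule riemannian_dist_le [of _ "\<lambda>u. emb (z u) (w u)", OF _ emb_stiefel [OF zw] emb_deriv [OF z'd w'd]])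
    show "continuous_on {0..1} (\<lambda>s. B ** Zm (z' s) + K ** Zm (w' s))"
    proof -
      have "continuous_on {0..1} z'" "continuous_on {0..1} w'"
        unfolding z'_def w'_def Complex_eq cis_conv_exp by (intro continuous_intros)+
      thus ?thesis
        by (intro continuous_on_add bounded_linear.continuous_on [OF matrix_mult.bounded_linear_right]
            bounded_linear.continuous_on [OF linear_Zm])
    qed
    have L2: "?L\<^sup>2 = 2 * (\<omega>\<^sup>2 + b\<^sup>2)" by (simp add: power_mult_distrib)
    show "stiefel_form (1/2) (emb (z u) (w u)) (B ** Zm (z' u) + K ** Zm (w' u)) (B ** Zm (z' u) + K ** Zm (w' u)) = ?L\<^sup>2" for u
      unfolding L2 by (subst emb_form [OF _ refl]; unfold adj) (use zw' [of u] in \<open>simp_all add: algebra_simps\<close>)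
  qed auto
  moreover have "z 0 = of_real (cos 0)" "w 0 = of_real (sin 0)"
    by (simp_all add: z_def w_def complex_eq_iff)
  moreover have "z 1 = of_real (cos s)" "w 1 = of_real (sin s)"
    using bw by (simp_all add: z_def w_def complex_eq_iff berger_endpoint_def p_def q_def algebra_simps)
  ultimately show ?thesis by (simp only: emb_real rot_def)
qed

end

text \<open>Two rows and two columns give H of rank 2, on whose initial space J is a quarter turn.
  The test geodesic is the simultaneous rotation of both columns, at angular speed 1 / sqrt 2
  because the trace of Pi is 2.\<close>

lemma stiefel_inj_canonical_le:
  assumes p: "CARD('p::finite) \<ge> 2" and q: "CARD('q::finite) \<ge> 2" and r: "r > 0"
    and berger: "\<And>s. r < s \<Longrightarrow> s \<le> pi \<Longrightarrow> \<exists>b \<omega>. berger_endpoint b \<omega> s \<and> \<omega>\<^sup>2 + b\<^sup>2 < s\<^sup>2"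
  shows "stiefel_inj TYPE('p) TYPE('q) (1/2) \<le> ereal (r * sqrt 2)"
proof -
  obtain a1 a2 :: 'p where a: "a1 \<noteq> a2"
    using p card_le_Suc0_iff_eq [of "UNIV :: 'p set"] by auto
  obtain b1 b2 :: 'q where b: "b1 \<noteq> b2"
    using q card_le_Suc0_iff_eq [of "UNIV :: 'q set"] by auto
  let ?H = "unit_matrix b1 a1 + unit_matrix b2 a2" and ?Pi = "unit_matrix a1 a1 + unit_matrix a2 a2"
  interpret complex_partial_isometry ?H ?Pi "stack 0 ?H" "I_np ** ?Pi" "I_np - I_np ** ?Pi"
      "unit_matrix a2 a1 - unit_matrix a1 a2"
    using a b a [symmetric] b [symmetric]
    by unfold_locales
      (simp_all add: unit_matrix_mult transpose_unit_matrix matrix_alg_simps trace_add trace_unit_matrix)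
  have w: "((1 / sqrt 2)\<^sup>2 :: real) * trace ?Pi = 1" by (simp add: tr power_divide)
  have \<beta>: "(1/2::real) > 0" by simp
  show ?thesis
  proof (rule stiefel_inj_le [OF \<beta> rot_geodesic(1) [OF \<beta>, of "1 / sqrt 2"] rot_deriv])
    fix t assume t: "t > r * sqrt 2"
    define s where "s = 1 / sqrt 2 * t"
    have st: "t = s * sqrt 2" by (simp add: s_def)
    have s: "s > r" using t by (simp add: st)
    have "riemannian_dist stiefel (stiefel_metric (1/2)) (rot 0) (rot s) < s * sqrt 2"
    proof (cases "s \<le> pi")
      case True
      from berger [OF s this] obtain b \<omega> where bw: "berger_endpoint b \<omega> s" "\<omega>\<^sup>2 + b\<^sup>2 < s\<^sup>2" by blast
      have "sqrt (\<omega>\<^sup>2 + b\<^sup>2) < s"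
        using bw(2) s r by (intro real_less_lsqrt) auto
      hence "sqrt 2 * sqrt (\<omega>\<^sup>2 + b\<^sup>2) < sqrt 2 * s" by (intro mult_strict_left_mono) auto
      thus ?thesis using berger_dist [OF bw(1)] by (simp only: mult.commute [of s])
    next
      case False
      obtain y where "\<bar>y\<bar> \<le> pi"
        "riemannian_dist stiefel (stiefel_metric (1/2)) (rot 0) (rot s) \<le> \<bar>y\<bar> * sqrt (trace ?Pi)"
        using rot_dist [OF \<beta>, of s] by metis
      moreover have "\<bar>y\<bar> * sqrt 2 < s * sqrt 2" using False calculation(1) by simp
      ultimately show ?thesis unfolding tr by linarith
    qed
    thus "riemannian_dist stiefel (stiefel_metric (1/2)) (rot (1 / sqrt 2 * 0)) (rot (1 / sqrt 2 * t)) < t"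
      unfolding s_def [symmetric] st [symmetric] by simp
  qed (simp only: rot_speed w)
qed

section \<open>Lower bounds for lengths\<close>

text \<open>The factor \<open>l < 1\<close> keeps the argument of \<open>arccos\<close> away from the points \<open>1\<close> and \<open>-1\<close>, where \<open>arccos\<close> is not differentiable.\<close>

lemma arccos_sphere_deriv:
  fixes w :: "real \<Rightarrow> 'a::real_inner"
  assumes w: "(w has_vector_derivative w') (at t)" and n: "norm (w t) = 1" "norm e = 1" and orth: "w' \<bullet> w t = 0"
    and l: "0 < l" "l < 1"
  obtains d where "((\<lambda>t. arccos (l * (e \<bullet> w t))) has_real_derivative d) (at t)" "d \<le> norm w'"
proof -
  define x where "x = e \<bullet> w t"
  have x1: "\<bar>x\<bar> \<le> 1" using Cauchy_Schwarz_ineq2 [of e "w t"] n by (simp add: x_def)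
  have lx: "\<bar>l * x\<bar> < 1"
  proof -
    have "\<bar>l * x\<bar> \<le> l * 1" unfolding abs_mult using l x1 by (intro mult_mono) auto
    thus ?thesis using l by simp
  qed
  have pos: "0 < 1 - (l * x)\<^sup>2" using lx by (simp add: abs_square_less_1)
  have ip: "((\<lambda>t. l * (e \<bullet> w t)) has_real_derivative l * (e \<bullet> w')) (at t)"
    using bounded_linear.has_vector_derivative [OF bounded_linear_inner_right w, of e]
    by (intro DERIV_cmult) (simp add: has_real_derivative_iff_has_vector_derivative)
  have "((\<lambda>t. arccos (l * (e \<bullet> w t))) has_real_derivative inverse (- sqrt (1 - (l * x)\<^sup>2)) * (l * (e \<bullet> w'))) (at t)"
    using DERIV_chain2 [OF DERIV_arccos ip] lx by (simp add: x_def abs_less_iff)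
  moreover have "inverse (- sqrt (1 - (l * x)\<^sup>2)) * (l * (e \<bullet> w')) \<le> norm w'"
  proof -
    have "w t \<bullet> w' = 0" using orth by (simp add: inner_commute)
    hence "e \<bullet> w' = (e - x *\<^sub>R w t) \<bullet> w'" by (simp add: inner_diff_left)
    hence "\<bar>e \<bullet> w'\<bar> \<le> norm (e - x *\<^sub>R w t) * norm w'" using Cauchy_Schwarz_ineq2 by metis
    moreover have "(norm (e - x *\<^sub>R w t))\<^sup>2 = 1 - x\<^sup>2"
    proof -
      have "e \<bullet> e = 1" "w t \<bullet> w t = 1" "e \<bullet> w t = x" "w t \<bullet> e = x"
        using n by (auto simp: norm_eq_1 x_def inner_commute)
      thus ?thesis
        unfolding power2_norm_eq_inner by (simp add: inner_diff_left inner_diff_right power2_eq_square)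
    qed
    hence "norm (e - x *\<^sub>R w t) = sqrt (1 - x\<^sup>2)" by (metis norm_ge_zero real_sqrt_unique)
    ultimately have "\<bar>l * (e \<bullet> w')\<bar> \<le> l * (sqrt (1 - x\<^sup>2) * norm w')"
      using l by (simp add: abs_mult)
    also have "l * sqrt (1 - x\<^sup>2) \<le> sqrt (1 - (l * x)\<^sup>2)"
    proof -
      have "l\<^sup>2 \<le> 1" using l by (simp add: power_le_one)
      hence "l\<^sup>2 * (1 - x\<^sup>2) \<le> 1 - (l * x)\<^sup>2" by (simp add: power_mult_distrib algebra_simps)
      hence "sqrt (l\<^sup>2 * (1 - x\<^sup>2)) \<le> sqrt (1 - (l * x)\<^sup>2)" by (rule real_sqrt_le_mono)
      thus ?thesis using l by (simp add: real_sqrt_mult)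
    qed
    hence "l * (sqrt (1 - x\<^sup>2) * norm w') \<le> sqrt (1 - (l * x)\<^sup>2) * norm w'"
      unfolding mult.assoc [symmetric] by (rule mult_right_mono) simp
    finally have "- (l * (e \<bullet> w')) \<le> sqrt (1 - (l * x)\<^sup>2) * norm w'" by linarith
    thus ?thesis using pos by (simp add: field_simps)
  qed
  ultimately show thesis using that by blast
qed

text \<open>A path on the unit sphere is at least as long as the angle between its ends. The paths
  are weighted by these angles \<alpha> i and summed before integrating, so that a pointwise bound
  on the weighted speeds suffices.\<close>

lemma sphere_paths_length:
  fixes w w' :: "'i \<Rightarrow> real \<Rightarrow> 'a::real_inner"
  assumes S: "finite S"
    and cont: "\<And>i. i \<in> I \<Longrightarrow> continuous_on {0..1} (w i)"
    and norm: "\<And>i t. i \<in> I \<Longrightarrow> t \<in> {0..1} \<Longrightarrow> norm (w i t) = 1"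
    and deriv: "\<And>i t. i \<in> I \<Longrightarrow> t \<in> {0..1} - S \<Longrightarrow> (w i has_vector_derivative w' i t) (at t)"
    and \<alpha>: "\<And>i. i \<in> I \<Longrightarrow> 0 \<le> \<alpha> i \<and> \<alpha> i \<le> pi" "\<And>i. i \<in> I \<Longrightarrow> w i 0 \<bullet> w i 1 = cos (\<alpha> i)"
    and bound: "\<And>t. t \<in> {0..1} - S \<Longrightarrow> (\<Sum>i\<in>I. \<alpha> i * norm (w' i t)) \<le> C * \<sigma> t"
    and \<sigma>: "(\<sigma> has_integral L) {0..1}"
  shows "(\<Sum>i\<in>I. (\<alpha> i)\<^sup>2) \<le> C * L"
proof -
  \<comment> \<open>What integration yields when arccos x is replaced by arccos (l x): the angle
    \<alpha> i becomes a difference of end values. At l = 1 this is the sum of the squared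
    angles.\<close>
  define F where "F l = (\<Sum>i\<in>I. \<alpha> i * (arccos (l * cos (\<alpha> i)) - arccos l))" for l
  have le: "F l \<le> C * L" if l: "l \<in> {0<..<1}" for l
  proof -
    let ?S = "S \<union> {0,1}"
    have "\<exists>d. ((\<lambda>t. arccos (l * (w i 0 \<bullet> w i t))) has_real_derivative d) (at t) \<and> d \<le> norm (w' i t)"
      if i: "i \<in> I" and t: "t \<in> {0..1} - ?S" for i t
    proof -
      have "open {0<..<1::real}" "t \<in> {0<..<1}" using t by auto
      hence ev: "\<forall>\<^sub>F s in at t. s \<in> {0<..<1}" by (rule eventually_at_in_open')
      have t': "t \<in> {0..1} - S" using t by auto
      have "((\<lambda>s. w i s \<bullet> w i s) has_vector_derivative (w i t \<bullet> w' i t + w' i t \<bullet> w i t)) (at t)"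
        by (intro bounded_bilinear.has_vector_derivative [OF bounded_bilinear_inner] deriv i t')
      moreover have "((\<lambda>s. w i s \<bullet> w i s) has_vector_derivative 0) (at t)"
        unfolding has_vector_derivative_def
        by (rule has_derivative_transform_eventually [where f = "\<lambda>s. 1"])
          (use ev t' norm [OF i] in \<open>auto elim!: eventually_mono simp: norm_eq_1\<close>)
      ultimately have "w i t \<bullet> w' i t + w' i t \<bullet> w i t = 0" by (rule vector_derivative_unique_at)
      hence "w' i t \<bullet> w i t = 0" by (simp add: inner_commute)
      thus ?thesis
        using arccos_sphere_deriv [OF deriv [OF i t'] norm [OF i] norm [OF i, of 0]] l t by force
    qed
    then obtain d where d: "\<And>i t. i \<in> I \<Longrightarrow> t \<in> {0..1} - ?S \<Longrightarrow>
        ((\<lambda>t. arccos (l * (w i 0 \<bullet> w i t))) has_real_derivative d i t) (at t) \<and> d i t \<le> norm (w' i t)"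
      by metis
    let ?\<Phi> = "\<lambda>t. \<Sum>i\<in>I. \<alpha> i * arccos (l * (w i 0 \<bullet> w i t))"
    let ?\<phi> = "\<lambda>t. \<Sum>i\<in>I. \<alpha> i * d i t"
    have lx: "-1 \<le> l * (w i 0 \<bullet> w i t) \<and> l * (w i 0 \<bullet> w i t) \<le> 1" if "i \<in> I" "t \<in> {0..1}" for i t
    proof -
      have "\<bar>w i 0 \<bullet> w i t\<bar> \<le> 1"
        using Cauchy_Schwarz_ineq2 [of "w i 0" "w i t"] norm that by simp
      hence "\<bar>l * (w i 0 \<bullet> w i t)\<bar> \<le> 1 * 1"
        unfolding abs_mult using l by (intro mult_mono) auto
      thus ?thesis by (simp add: abs_le_iff)
    qed
    have "(?\<phi> has_integral (?\<Phi> 1 - ?\<Phi> 0)) {0..1}"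
    proof (rule fundamental_theorem_of_calculus_strong [of ?S])
      show "continuous_on {0..1} ?\<Phi>"
        by (intro continuous_intros cont) (use lx in auto)
      fix t :: real assume t: "t \<in> {0..1} - ?S"
      have "(?\<Phi> has_real_derivative ?\<phi> t) (at t)"
        by (intro DERIV_sum DERIV_cmult) (use d t in blast)
      thus "(?\<Phi> has_vector_derivative ?\<phi> t) (at t)"
        by (simp add: has_real_derivative_iff_has_vector_derivative)
    qed (use S in auto)
    \<comment> \<open>Speed bounds hold only off the finite set \<open>?S\<close>, so both
      integrands are set to 0 on it before they are compared.\<close>
    hence 1: "((\<lambda>t. if t \<in> ?S then 0 else ?\<phi> t) has_integral (?\<Phi> 1 - ?\<Phi> 0)) {0..1}"
      by (rule has_integral_spike_finite [of ?S, rotated 2]) (use S in auto)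
    have "((\<lambda>t. C * \<sigma> t) has_integral C * L) {0..1}"
      using \<sigma> by (rule has_integral_mult_right)
    hence 2: "((\<lambda>t. if t \<in> ?S then 0 else C * \<sigma> t) has_integral (C * L)) {0..1}"
      by (rule has_integral_spike_finite [of ?S, rotated 2]) (use S in auto)
    have "?\<Phi> 1 - ?\<Phi> 0 \<le> C * L"
    proof (rule has_integral_le [OF 1 2])
      fix t :: real assume t: "t \<in> {0..1}"
      show "(if t \<in> ?S then 0 else ?\<phi> t) \<le> (if t \<in> ?S then 0 else C * \<sigma> t)"
      proof (cases "t \<in> ?S")
        case False
        have "?\<phi> t \<le> (\<Sum>i\<in>I. \<alpha> i * norm (w' i t))"
          by (intro sum_mono mult_left_mono) (use d \<alpha> t False in auto)
        also have "\<dots> \<le> C * \<sigma> t" using bound t False by simp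
        finally show ?thesis using False by simp
      qed simp
    qed
    moreover have "?\<Phi> 1 - ?\<Phi> 0 = F l"
      unfolding F_def sum_subtractf [symmetric] right_diff_distrib [symmetric]
      using norm by (intro sum.cong) (auto simp: \<alpha> norm_eq_1)
    ultimately show ?thesis by simp
  qed
  have "continuous_on {0..1} F"
    unfolding F_def
  proof (intro continuous_intros ballI)
    fix i and l :: real assume "l \<in> {0..1}"
    hence "\<bar>l * cos (\<alpha> i)\<bar> \<le> 1 * 1" unfolding abs_mult by (intro mult_mono) auto
    thus "-1 \<le> l * cos (\<alpha> i) \<and> l * cos (\<alpha> i) \<le> 1" by (simp add: abs_le_iff)
  qed auto
  \<comment> \<open>The bound for l < 1 passes to l = 1 by continuity of arccos on its closed
    domain.\<close>
  hence "continuous_on (closure {0<..<1}) F" by simp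
  from continuous_le_on_closure [OF this _ le] have "F 1 \<le> C * L" by auto
  moreover have "F 1 = (\<Sum>i\<in>I. (\<alpha> i)\<^sup>2)"
    unfolding F_def using \<alpha>(1) by (intro sum.cong) (auto simp: arccos_cos power2_eq_square)
  ultimately show ?thesis by simp
qed

section \<open>Lower bounds for the injectivity radius\<close>

text \<open>For \<beta> = 1/2 all geodesics are orbits exp(tP) X of their momentum, and 2 g(v, v) =
  P \<bullet> P turns unit speed into P \<bullet> P = 2. It then suffices that the distance equals t
  at t = pi: the geodesic itself gives one inequality, \<open>lower\<close> the other.\<close>

lemma stiefel_inj_ge:
  assumes lower: "\<And>(X :: real^'p^('p + 'q::finite)) P E t c. X \<in> stiefel \<Longrightarrow> stiefel_momentum (1/2) X (P ** X) = P \<Longrightarrow>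
      P \<bullet> P = 2 \<Longrightarrow> skew_flow P E \<Longrightarrow> 0 < t \<Longrightarrow> t \<le> pi \<Longrightarrow> admissible_path stiefel (stiefel_metric (1/2)) c \<Longrightarrow>
      c 0 = X \<Longrightarrow> c 1 = E t ** X \<Longrightarrow> t \<le> curve_length (stiefel_metric (1/2)) c"
  shows "stiefel_inj TYPE('p::finite) TYPE('q) (1/2) \<ge> ereal pi"
  unfolding stiefel_inj_def injectivity_radius_def injectivity_radius_at_def
proof (intro Inf_greatest, clarify, intro Inf_greatest, clarify)
  fix X \<xi> :: "real^'p^('p + 'q)"
  assume X: "X \<in> stiefel" and \<xi>: "\<xi> \<in> stiefel_tangent X" "sqrt (stiefel_metric (1/2) X \<xi> \<xi>) = 1"
  define P where "P = stiefel_momentum (1/2) X \<xi>"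
  have P: "transpose P = - P" unfolding P_def by (rule stiefel_momentum_skew [OF X \<xi>(1)])
  obtain E where E: "skew_flow P E" using skew_flow_exists [OF P] by blast
  have PX: "P ** X = \<xi>"
    using velocity_of_momentum [OF X \<xi>(1), of "1/2"] by (simp add: P_def)
  have m: "stiefel_momentum (1/2) X (P ** X) = P" unfolding PX by (simp add: P_def)
  have PP: "P \<bullet> P = 2"
    using stiefel_form_killing [OF X \<xi>(1) P, of "1/2"] \<xi> unfolding PX P_def [symmetric]
    by (simp add: stiefel_metric_eq [OF X])
  note fl = stiefel_flow [OF E X]
  let ?\<gamma> = "\<lambda>t. E t ** X"
  have \<beta>: "(1/2::real) > 0" by simp
  have geo: "geodesic stiefel stiefel_tangent (stiefel_metric (1/2)) ?\<gamma>"
    by (rule stiefel_geodesicI(1) [OF \<beta> _ P fl(1)]) (simp_all add: fl(2) X m)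
  have from_eq: "geodesic_from stiefel stiefel_tangent (stiefel_metric (1/2)) X \<xi> = ?\<gamma>"
    by (rule stiefel_geodesic_from_eq [OF \<beta> geo fl(2)]) (use fl(1) [of 0] fl(2) PX in simp)
  have "riemannian_dist stiefel (stiefel_metric (1/2)) X (?\<gamma> t) = t" if t: "0 < t" "t \<le> pi" for t
  proof (rule order_antisym)
    let ?c = "\<lambda>s. E (t * s) ** X"
    have d: "(?c has_vector_derivative t *\<^sub>R (P ** ?c s)) (at s)" for s
      using vector_diff_chain_at [of "\<lambda>s. t * s" t s ?\<gamma>, OF _ fl(1)]
      by (simp add: o_def has_real_derivative_iff_has_vector_derivative [symmetric])
    have cont: "continuous_on {0..1} (\<lambda>s. t *\<^sub>R (P ** ?c s))"
      by (intro continuous_intros bounded_linear.continuous_on [OF matrix_mult.bounded_linear_right]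
          continuous_at_imp_continuous_on ballI has_vector_derivative_continuous [OF d])
    have sp: "stiefel_form (1/2) (?c s) (t *\<^sub>R (P ** ?c s)) (t *\<^sub>R (P ** ?c s)) = t\<^sup>2" for s
    proof -
      have "\<forall>s. stiefel_momentum (1/2) (?\<gamma> s) (P ** ?\<gamma> s) = stiefel_momentum (1/2) (?\<gamma> 0) (P ** ?\<gamma> 0)"
        using stiefel_geodesic_iff [OF \<beta> _ fl(3) fl(1)] geo by (simp add: geodesic_def)
      hence mm: "stiefel_momentum (1/2) (?\<gamma> s) (P ** ?\<gamma> s) = P" for s by (metis fl(2) m)
      have "2 * stiefel_form (1/2) (?c s) (P ** ?c s) (P ** ?c s) = P \<bullet> P"
        using stiefel_form_killing [OF fl(3) killing_tangent [OF fl(3) P] P, of "1/2" "t * s"] mm by simp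
      thus ?thesis by (simp add: stiefel_form_linear PP power2_eq_square)
    qed
    note dist = riemannian_dist_le [OF \<beta> fl(3) d cont sp]
    show "riemannian_dist stiefel (stiefel_metric (1/2)) X (?\<gamma> t) \<le> t"
      using dist(1) t by (simp add: fl(2))
    show "t \<le> riemannian_dist stiefel (stiefel_metric (1/2)) X (?\<gamma> t)"
      unfolding riemannian_dist_def
    proof (rule cInf_greatest)
      have "curve_length (stiefel_metric (1/2)) ?c \<in> {curve_length (stiefel_metric (1/2)) c | c.
          admissible_path stiefel (stiefel_metric (1/2)) c \<and> pathstart c = X \<and> pathfinish c = ?\<gamma> t}"
        using dist(2) t by (auto simp: pathstart_def pathfinish_def fl(2) intro!: exI [of _ ?c])
      thus "{curve_length (stiefel_metric (1/2)) c | c. admissible_path stiefel (stiefel_metric (1/2)) c \<and>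
          pathstart c = X \<and> pathfinish c = ?\<gamma> t} \<noteq> {}" by blast
    qed (use lower [OF X m PP E t] in \<open>auto simp: pathstart_def pathfinish_def\<close>)
  qed
  hence "ereal pi \<in> {ereal t | t. t > 0 \<and> riemannian_dist stiefel (stiefel_metric (1/2)) X (?\<gamma> t) = t}"
    by (auto intro!: exI [of _ pi])
  thus "ereal pi \<le> cut_time stiefel stiefel_tangent (stiefel_metric (1/2)) X \<xi>"
    unfolding cut_time_def from_eq by (rule Sup_upper)
qed

lemma has_vector_derivative_matrix_vector:
  "(A has_vector_derivative A') (at t) \<Longrightarrow> ((\<lambda>t. A t *v x) has_vector_derivative A' *v x) (at t)"
  for A :: "real \<Rightarrow> real^'n^'m"
  by (rule bounded_linear.has_vector_derivative [of "\<lambda>A. A *v x"])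
    (simp_all add: linear_conv_bounded_linear [symmetric] linear_iff matrix_vector_mult_add_rdistrib scaleR_matrix_vector_assoc)

lemma curve_length_has_integral:
  "admissible_path M g c \<Longrightarrow>
    ((\<lambda>t. sqrt (g (c t) (vector_derivative c (at t)) (vector_derivative c (at t)))) has_integral curve_length g c) {0..1}"
  unfolding admissible_path_def curve_length_def by (simp add: integrable_integral)

lemma norm_matrix_vector_1:
  fixes A :: "real^'p^'n"
  assumes "UNIV = {a :: 'p}" shows "norm (A *v axis a 1) = norm A"
proof -
  have "A \<bullet> A = (A *v axis a 1) \<bullet> (A *v axis a 1)"
    by (simp add: inner_vec_def [of A] inner_vec_def [of "A *v _"] inner_vec_def [of "A $ _"] assms
        matrix_vector_mul_component inner_axis)
  thus ?thesis by (simp add: norm_eq_sqrt_inner)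
qed

text \<open>X^T v is a skew 1x1 matrix, hence 0, so the metric is that of the unit sphere. P has
  rank 2 and turns the single column e at unit rate, and \<open>sphere_paths_length\<close> is
  applied to just one path.\<close>

theorem stiefel_inj_sphere:
  assumes p: "CARD('p::finite) = 1"
  shows "stiefel_inj TYPE('p) TYPE('q::finite) (1/2) \<ge> ereal pi"
proof (rule stiefel_inj_ge)
  fix X :: "real^'p^('p + 'q)" and P E t c
  assume X: "X \<in> stiefel" and m: "stiefel_momentum (1/2) X (P ** X) = P" and PP: "P \<bullet> P = 2" and E: "skew_flow P E"
    and t: "0 < t" "t \<le> pi" and c: "admissible_path stiefel (stiefel_metric (1/2)) c" "c 0 = X" "c 1 = E t ** X"
  obtain a :: 'p where a: "UNIV = {a}" using p by (metis card_1_singletonE)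
  note P = skew_flowD(1) [OF E]
  define e where "e = X *v axis a 1"
  have zero: "transpose Y ** v = 0" if "Y \<in> stiefel" "v \<in> stiefel_tangent Y" for Y v :: "real^'p^('p + 'q)"
    using that skew_symmetric_1 [OF p] stiefel_tangent_iff by blast
  have nX: "norm (Y *v axis a 1) = 1" if "Y \<in> stiefel" for Y :: "real^'p^('p + 'q)"
    using norm_stiefel [OF that] by (simp add: norm_matrix_vector_1 [OF a] p)
  define v where "v = P ** X"
  have vT: "v \<in> stiefel_tangent X" unfolding v_def by (rule killing_tangent [OF X P])
  have Xv: "transpose X ** v = 0" by (rule zero [OF X vT])
  have "2 * stiefel_form (1/2) X v v = P \<bullet> P"
    using stiefel_form_killing [OF X vT P, of "1/2"] m by (simp add: v_def)
  hence "v \<bullet> v = 1" by (simp add: stiefel_form_def Xv PP)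
  hence nv: "norm v = 1" by (simp add: norm_eq_1)
  have vv: "transpose v ** v = mat 1"
  proof -
    have "(transpose v ** v) $ i $ j = mat 1 $ i $ j" for i j
    proof -
      have "i = a" "j = a" using a by auto
      moreover have "trace (transpose v ** v) = 1" using \<open>v \<bullet> v = 1\<close> by (simp add: inner_matrix_conv_trace)
      ultimately show ?thesis by (simp add: trace_def a mat_def)
    qed
    thus ?thesis by (simp add: vec_eq_iff)
  qed
  have PX: "P = v ** transpose X - X ** transpose v"
  proof -
    have "X ** (transpose X ** (v ** transpose X)) = 0"
      by (simp add: matrix_mul_assoc [of "transpose X"] Xv)
    thus ?thesis using m unfolding v_def [symmetric] by (simp add: stiefel_momentum_def)
  qed
  have "transpose X ** v = 0 \<Longrightarrow> P ** v = - X"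
    unfolding PX by (simp add: matrix_mult.diff_left matrix_mul_assoc [symmetric] vv)
  hence Pv: "P ** v = - X" using Xv by blast
  have Pe: "P *v e = v *v axis a 1" by (simp add: e_def v_def matrix_vector_mul_assoc)
  have nPe: "norm (P *v e) = 1" unfolding Pe by (simp add: norm_matrix_vector_1 [OF a] nv)
  have "P *v (P *v e) = (- X) *v axis a 1"
    unfolding Pe matrix_vector_mul_assoc Pv ..
  also have "\<dots> = - e" by (simp add: e_def matrix_vector_mult_def vec_eq_iff sum_negf)
  finally have PPe: "P *v (P *v e) = - (norm (P *v e))\<^sup>2 *\<^sub>R e"
    unfolding nPe by simp
  have eEe: "e \<bullet> (E t *v e) = cos t"
    using skew_flow_eigenvector [OF E nX [OF X, folded e_def] PPe, of t] by (simp add: nPe)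
  obtain S where S: "finite S" "\<And>t. t \<in> {0..1} - S \<Longrightarrow> (c has_vector_derivative vector_derivative c (at t)) (at t)"
    "\<And>t. t \<in> {0..1} - S \<Longrightarrow> vector_derivative c (at t) \<in> stiefel_tangent (c t)"
    "\<And>t. t \<in> {0..1} - S \<Longrightarrow> stiefel_metric (1/2) (c t) (vector_derivative c (at t)) (vector_derivative c (at t))
        = stiefel_form (1/2) (c t) (vector_derivative c (at t)) (vector_derivative c (at t))"
    "\<And>t. t \<in> {0..1} \<Longrightarrow> c t \<in> stiefel" "continuous_on {0..1} c"
    by (rule admissible_stiefel_path [OF c(1)]) blast
  have "(\<Sum>i\<in>{()}. t\<^sup>2) \<le> t * curve_length (stiefel_metric (1/2)) c"
  proof (rule sphere_paths_length [OF S(1), where w = "\<lambda>_ s. c s *v axis a 1"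
        and w' = "\<lambda>_ s. vector_derivative c (at s) *v axis a 1" and \<alpha> = "\<lambda>_. t"])
    show "continuous_on {0..1} (\<lambda>s. c s *v axis a 1)"
      by (rule bounded_linear.continuous_on [OF _ S(6), of "\<lambda>A. A *v axis a 1"])
        (simp add: linear_conv_bounded_linear [symmetric] linear_iff matrix_vector_mult_add_rdistrib scaleR_matrix_vector_assoc)
    show "(c 0 *v axis a 1) \<bullet> (c 1 *v axis a 1) = cos t"
      using eEe by (simp add: c(2,3) e_def matrix_vector_mul_assoc)
    fix s assume s: "s \<in> {0..1} - S"
    have "stiefel_form (1/2) (c s) (vector_derivative c (at s)) (vector_derivative c (at s))
      = (norm (vector_derivative c (at s)))\<^sup>2"
      using zero [OF S(5) S(3) [OF s]] s by (simp add: stiefel_form_def power2_norm_eq_inner)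
    thus "(\<Sum>i\<in>{()}. t * norm (vector_derivative c (at s) *v axis a 1)) \<le>
      t * sqrt (stiefel_metric (1/2) (c s) (vector_derivative c (at s)) (vector_derivative c (at s)))"
      by (simp add: S(4) [OF s] norm_matrix_vector_1 [OF a])
  qed (use S t nX curve_length_has_integral [OF c(1)] in \<open>auto intro: has_vector_derivative_matrix_vector\<close>)
  thus "t \<le> curve_length (stiefel_metric (1/2)) c"
    using t by (simp add: power2_eq_square)
qed

section \<open>Square orthogonal completions\<close>

lemma orthogonal_matrix_inner:
  fixes F :: "real^'n^'n"
  assumes "orthogonal_matrix F" shows "(F *v x) \<bullet> (F *v y) = x \<bullet> y"
proof -
  have "(F *v x) \<bullet> (F *v y) = x \<bullet> (transpose F *v (F *v y))"
    by (subst vector_transpose_matrix [of x F, symmetric]) (rule dot_lmul_matrix)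
  thus ?thesis using assms by (simp only: matrix_vector_mul_assoc orthogonal_matrix matrix_vector_mul_lid)
qed

lemma orthogonal_matrix_norm: "orthogonal_matrix F \<Longrightarrow> norm (F *v x) = norm x" for F :: "real^'n^'n"
  by (simp add: norm_eq_sqrt_inner orthogonal_matrix_inner)

text \<open>Columns of X become rows, so a completion of X is stored transposed; a rotation E of X
  therefore acts on it from the right as E^T.\<close>

definition append_row :: "real^'p^('p + 'q::finite) \<Rightarrow> real^('p + 'q) \<Rightarrow> real^('p + 'q)^('p + 'q)" where
  "append_row X y = (\<chi> s. case s of Inl a \<Rightarrow> column a X | Inr b \<Rightarrow> y)"

text \<open>The generalized cross product of the columns when \<open>CARD('q) = 1\<close>. Being
  polynomial in X, it is differentiable along differentiable curves, which an arbitrarily chosen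
  unit normal would not be.\<close>

definition normal_vector :: "real^'p^('p + 'q::finite) \<Rightarrow> real^('p + 'q)" where
  "normal_vector X = (\<chi> i. det (append_row X (axis i 1)))"

lemma append_row_nth [simp]: "append_row X y $ Inl a = column a X" "append_row X y $ Inr b = y"
  by (simp_all add: append_row_def)

lemma linear_append_row: "linear (\<lambda>z. append_row (fst z) (snd z))"
proof (rule linearI)
  fix z w :: "(real^'p^('p + 'q::finite)) \<times> (real^('p + 'q))" and r :: real
  have "append_row (fst (z + w)) (snd (z + w)) $ s = (append_row (fst z) (snd z) + append_row (fst w) (snd w)) $ s" for s
    by (cases s) (simp_all add: column_def vec_eq_iff)
  thus "append_row (fst (z + w)) (snd (z + w)) = append_row (fst z) (snd z) + append_row (fst w) (snd w)"
    by (simp add: vec_eq_iff)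
  have "append_row (fst (r *\<^sub>R z)) (snd (r *\<^sub>R z)) $ s = (r *\<^sub>R append_row (fst z) (snd z)) $ s" for s
    by (cases s) (simp_all add: column_def vec_eq_iff)
  thus "append_row (fst (r *\<^sub>R z)) (snd (r *\<^sub>R z)) = r *\<^sub>R append_row (fst z) (snd z)"
    by (simp add: vec_eq_iff)
qed

lemma has_vector_derivative_append_row:
  assumes "(X has_vector_derivative X') (at t)" "(y has_vector_derivative y') (at t)"
  shows "((\<lambda>t. append_row (X t) (y t)) has_vector_derivative append_row X' y') (at t)"
  using bounded_linear.has_vector_derivative [OF _ has_vector_derivative_Pair [OF assms], of "\<lambda>z. append_row (fst z) (snd z)"]
    linear_append_row by (simp add: linear_conv_bounded_linear)

lemma continuous_on_det: "continuous_on S A \<Longrightarrow> continuous_on S (\<lambda>t. det (A t))"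
  for A :: "'a::topological_space \<Rightarrow> real^'n^'n"
  unfolding det_def by (intro continuous_intros)

lemma det_differentiable:
  fixes A :: "real \<Rightarrow> real^'n^'n"
  assumes "(A has_vector_derivative A') (at t)"
  shows "(\<lambda>t. det (A t)) differentiable (at t)"
proof -
  have "((\<lambda>t. A t $ i $ j) has_vector_derivative A' $ i $ j) (at t)" for i j
    by (rule bounded_linear.has_vector_derivative [OF bounded_linear_vec_nth
        bounded_linear.has_vector_derivative [OF bounded_linear_vec_nth assms]])
  hence d: "((\<lambda>t. A t $ i $ j) has_derivative (\<lambda>h. h *\<^sub>R A' $ i $ j)) (at t)" for i j
    by (simp add: has_vector_derivative_def)
  have "(\<lambda>t. \<Prod>i\<in>UNIV. A t $ i $ p i) differentiable (at t)" for p
    by (rule differentiableI, rule has_derivative_prod, rule d)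
  thus ?thesis unfolding det_def
    by (intro differentiable_sum differentiable_mult differentiable_const) auto
qed

context
  assumes q1: "CARD('q::finite) = 1"
begin

lemma Inr_unique: "b = (b' :: 'q)"
proof -
  obtain a :: 'q where "UNIV = {a}" using q1 by (rule card_1_singletonE)
  hence "b \<in> {a}" "b' \<in> {a}" by blast+
  thus ?thesis by simp
qed

text \<open>With a single \<open>Inr\<close> index y fills exactly one row, and the determinant is
  linear in that row.\<close>

lemma det_append_row: "det (append_row X y) = normal_vector X \<bullet> y"
  for X :: "real^'p^('p + 'q)"
proof -
  fix b :: 'q
  have eq: "append_row X y = (\<chi> s. if s = Inr b then y else append_row X 0 $ s)" for y
  proof -
    have "append_row X y $ s = (if s = Inr b then y else append_row X 0 $ s)" for s
      by (cases s) (auto simp: Inr_unique [of _ b])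
    thus ?thesis by (simp add: vec_eq_iff)
  qed
  have "linear (\<lambda>y. det (append_row X y))"
  proof (rule linearI)
    show "det (append_row X (y + z)) = det (append_row X y) + det (append_row X z)" for y z
      unfolding eq [of y] eq [of z] eq [of "y + z"] by (rule det_row_add)
    show "det (append_row X (r *\<^sub>R y)) = r *\<^sub>R det (append_row X y)" for y r
      unfolding eq [of y] eq [of "r *\<^sub>R y"] real_scaleR_def det_row_mul [symmetric] scalar_mult_eq_scaleR ..
  qed
  then obtain L where L: "\<And>y. det (append_row X y) = L \<bullet> y" by (rule linear_functional_inner) blast
  have "normal_vector X = L" by (simp add: normal_vector_def L inner_axis vec_eq_iff)
  thus ?thesis by (simp add: L)
qed

lemma normal_vector_column: "normal_vector X \<bullet> column a X = 0" for X :: "real^'p::finite^('p + 'q)"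
proof -
  fix b :: 'q
  have "det (append_row X (column a X)) = 0"
    by (rule det_identical_rows [of "Inl a" "Inr b"]) (simp_all add: row_def vec_eq_iff)
  thus ?thesis by (simp add: det_append_row)
qed

lemma append_row_orthogonal:
  fixes X :: "real^'p^('p + 'q)"
  assumes X: "X \<in> stiefel" and y: "norm y = 1" "\<And>a. y \<bullet> column a X = 0"
  shows "orthogonal_matrix (append_row X y)"
  unfolding orthogonal_matrix_orthonormal_rows
proof (intro conjI allI impI)
  have col: "column i X \<bullet> column j X = (if i = j then 1 else 0)" for i j
    using stiefelD [OF X] by (simp add: matrix_mult_transpose_dot_column vec_eq_iff mat_def)
  have row: "row i (append_row X y) = append_row X y $ i" for i by (simp add: row_def)
  show "norm (row i (append_row X y)) = 1" for i
    unfolding row by (cases i) (simp_all add: y norm_eq_1 col)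
  show "orthogonal (row i (append_row X y)) (row j (append_row X y))" if "i \<noteq> j" for i j
    unfolding row orthogonal_def using that Inr_unique
    by (cases i; cases j) (auto simp: y col inner_commute [of "column _ _" y])
qed

text \<open>In an orthonormal frame that completes X, the normal vector has only its last coordinate
  nonzero; that coordinate is the determinant of an orthogonal matrix up to sign.\<close>

lemma normal_vector_unit:
  fixes X :: "real^'p^('p + 'q)"
  assumes X: "X \<in> stiefel" shows "norm (normal_vector X) = 1"
proof -
  fix b :: 'q
  obtain Q where Q: "orthogonal_matrix Q" "X = Q ** I_np" using stiefel_frame [OF X] .
  define n where "n = column (Inr b) Q"
  have cX: "X $ i $ a = Q $ i $ Inl a" for i a
    unfolding Q(2) by (simp add: I_np_def matrix_matrix_mult_def sum_UNIV_Plus mat_def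
        if_distrib [where f = "\<lambda>x. _ * x"] cong: if_cong)
  have "append_row X n $ s = transpose Q $ s" for s
  proof (cases s)
    case (Inr b')
    thus ?thesis using Inr_unique [of b' b] by (simp add: n_def column_def transpose_def vec_eq_iff)
  qed (simp add: cX column_def transpose_def vec_eq_iff)
  hence eq: "append_row X n = transpose Q" by (simp add: vec_eq_iff)
  have "det (append_row X n) = 1 \<or> det (append_row X n) = -1"
    unfolding eq by (rule det_orthogonal_matrix) (simp add: Q)
  hence dn: "\<bar>normal_vector X \<bullet> n\<bar> = 1" by (auto simp: det_append_row)
  have "norm (transpose Q *v normal_vector X) = norm (normal_vector X)"
    by (rule orthogonal_matrix_norm) (simp add: Q)
  moreover have "(transpose Q *v normal_vector X) $ s = (if s = Inr b then n \<bullet> normal_vector X else 0)" for s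
    unfolding eq [symmetric] matrix_vector_mul_component
    by (cases s) (auto simp: Inr_unique [of _ b] inner_commute [of _ "normal_vector X"] normal_vector_column)
  hence "transpose Q *v normal_vector X = axis (Inr b) (n \<bullet> normal_vector X)"
    by (simp add: vec_eq_iff axis_def)
  moreover have "norm (axis (Inr b) r :: real^('p + 'q)) = \<bar>r\<bar>" for r
    by (simp add: norm_eq_sqrt_inner inner_axis_axis)
  ultimately show ?thesis using dn by (simp add: inner_commute)
qed

lemma completion_orthogonal:
  fixes X :: "real^'p^('p + 'q)"
  assumes "X \<in> stiefel" shows "orthogonal_matrix (append_row X (normal_vector X))"
  by (rule append_row_orthogonal [OF assms normal_vector_unit [OF assms] normal_vector_column])

text \<open>The cross product commutes with rotations. The sign of det E matters: a reflection would
  reverse the normal.\<close>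

lemma normal_vector_rotate:
  fixes X :: "real^'p^('p + 'q)"
  assumes E: "orthogonal_matrix E" "det E = 1"
  shows "append_row (E ** X) (normal_vector (E ** X)) = append_row X (normal_vector X) ** transpose E"
proof -
  have rot: "append_row (E ** X) (E *v y) = append_row X y ** transpose E" for y
  proof -
    have "append_row (E ** X) (E *v y) $ s = (append_row X y ** transpose E) $ s" for s
      by (cases s) (simp_all add: vec_eq_iff column_def matrix_matrix_mult_def matrix_vector_mult_def transpose_def mult.commute)
    thus ?thesis by (simp add: vec_eq_iff)
  qed
  have "normal_vector (E ** X) \<bullet> (E *v y) = (E *v normal_vector X) \<bullet> (E *v y)" for y
    using arg_cong [OF rot [of y], of det] by (simp add: det_append_row det_mul E orthogonal_matrix_inner)
  moreover have "E *v (transpose E *v y) = y" for y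
    using E(1) by (simp only: matrix_vector_mul_assoc orthogonal_matrix_def matrix_vector_mul_lid)
  ultimately have "normal_vector (E ** X) \<bullet> y = (E *v normal_vector X) \<bullet> y" for y by metis
  hence "normal_vector (E ** X) = E *v normal_vector X" by (metis vector_eq_rdot)
  thus ?thesis by (simp add: rot)
qed

end

text \<open>The determinant is continuous in t, takes only the values 1 and -1, and starts at
  1.\<close>

lemma skew_flow_det:
  assumes E: "skew_flow P E" shows "det (E t) = 1"
proof -
  have o: "det (E s) = 1 \<or> det (E s) = -1" for s
    by (rule det_orthogonal_matrix) (simp add: orthogonal_matrix skew_flow_orthogonal [OF E])
  have "connected (range (\<lambda>t. det (E t)))"
    by (intro connected_continuous_image continuous_on_det continuous_at_imp_continuous_on ballI
        has_vector_derivative_continuous [OF skew_flowD(2) [OF E]] connected_UNIV)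
  moreover have "1 \<in> range (\<lambda>t. det (E t))"
    using skew_flowD(3) [OF E] by (metis det_I rangeI)
  ultimately have "0 \<in> range (\<lambda>t. det (E t))" if "det (E t) = -1"
    using that connectedD_interval [of _ "-1" 1 0] by (metis le_numeral_extra(2) neg_le_0_iff_le rangeI zero_le_one)
  moreover have "0 \<notin> range (\<lambda>t. det (E t))"
  proof
    assume "0 \<in> range (\<lambda>t. det (E t))"
    then obtain s where "det (E s) = 0" by auto
    thus False using o [of s] by simp
  qed
  ultimately show ?thesis using o by blast
qed

section \<open>Frobenius norms in orthonormal bases\<close>

lemma norm_orthonormal_expansion:
  fixes x :: "'a::real_inner"
  assumes "\<And>x. (\<Sum>e\<in>B. (x \<bullet> e) *\<^sub>R e) = x"
  shows "x \<bullet> x = (\<Sum>e\<in>B. (x \<bullet> e)\<^sup>2)"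
proof -
  have "x \<bullet> x = x \<bullet> (\<Sum>e\<in>B. (x \<bullet> e) *\<^sub>R e)" by (simp add: assms)
  thus ?thesis by (simp add: inner_sum_right power2_eq_square)
qed

lemma frobenius_orthonormal:
  fixes A :: "real^'n^'m"
  assumes "\<And>x. (\<Sum>e\<in>B. (x \<bullet> e) *\<^sub>R e) = x"
  shows "A \<bullet> A = (\<Sum>e\<in>B. (norm (A *v e))\<^sup>2)"
proof -
  have "A \<bullet> A = (\<Sum>i\<in>UNIV. \<Sum>e\<in>B. (A $ i \<bullet> e)\<^sup>2)"
    by (simp add: inner_vec_def [of A] norm_orthonormal_expansion [OF assms])
  also have "\<dots> = (\<Sum>e\<in>B. \<Sum>i\<in>UNIV. (A $ i \<bullet> e)\<^sup>2)" by (rule sum.swap)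
  also have "\<dots> = (\<Sum>e\<in>B. (norm (A *v e))\<^sup>2)"
    unfolding power2_norm_eq_inner
    by (simp add: inner_vec_def [of "A *v _"] matrix_vector_mul_component power2_eq_square)
  finally show ?thesis .
qed

text \<open>Nonzero singular values of a skew matrix are paired. Expanding P e in the basis gives
  its squared norm once; each coefficient along f is bounded by norm (P f) and the one along e is 0,
  so the term f = e is still available for a second copy.\<close>

lemma skew_norm_le:
  fixes P :: "real^'m^'m"
  assumes P: "transpose P = - P" and B: "finite B" "\<And>x. (\<Sum>e\<in>B. (x \<bullet> e) *\<^sub>R e) = x"
    and e: "e \<in> B" "norm e = 1"
  shows "2 * (norm (P *v e))\<^sup>2 \<le> P \<bullet> P"
proof -
  have "((P *v e) \<bullet> f)\<^sup>2 + (if f = e then (norm (P *v e))\<^sup>2 else 0) \<le> (norm (P *v f))\<^sup>2" if "f \<in> B" for f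
  proof (cases "f = e")
    case True
    have "(P *v e) \<bullet> e = 0" using skew_inner_vec [OF P, of e e] by (simp add: inner_commute)
    thus ?thesis using True by simp
  next
    case False
    have "\<bar>(P *v e) \<bullet> f\<bar> \<le> norm e * norm (P *v f)"
      using Cauchy_Schwarz_ineq2 [of e "P *v f"] by (simp add: skew_inner_vec [OF P])
    thus ?thesis using e False by (simp add: abs_le_square_iff [symmetric])
  qed
  hence "(\<Sum>f\<in>B. ((P *v e) \<bullet> f)\<^sup>2 + (if f = e then (norm (P *v e))\<^sup>2 else 0)) \<le> (\<Sum>f\<in>B. (norm (P *v f))\<^sup>2)"
    by (rule sum_mono)
  moreover have "(\<Sum>f\<in>B. ((P *v e) \<bullet> f)\<^sup>2) = (norm (P *v e))\<^sup>2"
    unfolding power2_norm_eq_inner by (rule norm_orthonormal_expansion [OF B(2), symmetric])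
  ultimately show ?thesis
    using e B(1) by (simp add: sum.distrib frobenius_orthonormal [OF B(2), symmetric])
qed

lemma inner_append_row:
  fixes v :: "real^'p^('p + 'q::finite)"
  assumes "CARD('q) = 1"
  shows "append_row v d \<bullet> append_row v d = v \<bullet> v + d \<bullet> d"
proof -
  have "(\<Sum>a\<in>UNIV. column a v \<bullet> column a v) = transpose v \<bullet> transpose v"
    unfolding inner_vec_def [of "transpose v" "transpose v"] by (simp add: column_def transpose_def)
  thus ?thesis
    by (simp add: inner_vec_def [of "append_row v d" "append_row v d"] sum_UNIV_Plus assms inner_transpose)
qed

text \<open>The canonical metric on \<open>St(n, n-1)\<close> is the pullback of the bi-invariant metric of the rotation
  group, \<open>|F'|\<^sup>2 = 2 g(c', c')\<close> for the completion \<open>F\<close> of \<open>c\<close>.\<close>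

lemma completion_speed:
  fixes c :: "real \<Rightarrow> real^'p^('p + 'q::finite)"
  assumes q1: "CARD('q) = 1" and c: "(c has_vector_derivative v) (at t)" "\<forall>\<^sub>F s in at t. c s \<in> stiefel" "c t \<in> stiefel"
  obtains F' where "((\<lambda>s. append_row (c s) (normal_vector (c s))) has_vector_derivative F') (at t)"
    "F' \<bullet> F' = 2 * stiefel_form (1/2) (c t) v v"
proof -
  define n where "n s = normal_vector (c s)" for s
  have "n differentiable (at t)"
    unfolding differentiable_componentwise_within [of n]
  proof
    fix y :: "real^('p + 'q)"
    have "((\<lambda>s. append_row (c s) y) has_vector_derivative append_row v 0) (at t)"
      by (rule has_vector_derivative_append_row [OF c(1)]) simp
    from det_differentiable [OF this] show "(\<lambda>s. n s \<bullet> y) differentiable (at t)"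
      unfolding det_append_row [OF q1] n_def .
  qed
  then obtain d where d: "(n has_vector_derivative d) (at t)"
    using vector_derivative_works by blast
  have colv: "((\<lambda>s. column a (c s)) has_vector_derivative column a v) (at t)" for a
  proof -
    have "linear (\<lambda>A. column a A :: real^('p + 'q))" by (rule linearI) (simp_all add: column_def vec_eq_iff)
    thus ?thesis using c(1) by (intro bounded_linear.has_vector_derivative [of "column a"])
      (simp_all add: linear_conv_bounded_linear)
  qed
  note ip = bounded_bilinear.has_vector_derivative [OF bounded_bilinear_inner]
  have "((\<lambda>s. n s \<bullet> n s) has_vector_derivative (n t \<bullet> d + d \<bullet> n t)) (at t)"
    by (rule ip [OF d d])
  moreover have "((\<lambda>s. n s \<bullet> n s) has_vector_derivative 0) (at t)"
    unfolding has_vector_derivative_def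
    by (rule has_derivative_transform_eventually [where f = "\<lambda>s. 1"])
      (use c normal_vector_unit [OF q1] in \<open>auto elim!: eventually_mono simp: norm_eq_1 n_def\<close>)
  ultimately have "n t \<bullet> d + d \<bullet> n t = 0" by (rule vector_derivative_unique_at)
  hence nd: "n t \<bullet> d = 0" by (simp add: inner_commute)
  \<comment> \<open>Orthogonality of normal and columns forces the coordinates of d along the
    columns to be minus the normal coordinates of v; thus d and the normal part of v have equal
    norm.\<close>
  have nv: "column a (c t) \<bullet> d = - (n t \<bullet> column a v)" for a
  proof -
    have "((\<lambda>s. n s \<bullet> column a (c s)) has_vector_derivative (n t \<bullet> column a v + d \<bullet> column a (c t))) (at t)"
      by (rule ip [OF d colv])
    moreover have "((\<lambda>s. n s \<bullet> column a (c s)) has_vector_derivative 0) (at t)"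
      by (simp add: n_def normal_vector_column [OF q1])
    ultimately have "n t \<bullet> column a v + d \<bullet> column a (c t) = 0" by (rule vector_derivative_unique_at)
    thus ?thesis by (simp add: inner_commute add_eq_0_iff)
  qed
  let ?F = "append_row (c t) (n t)"
  have F: "orthogonal_matrix ?F"
    unfolding n_def by (rule completion_orthogonal [OF q1 c(3)])
  have expand: "x \<bullet> x = (\<Sum>b\<in>UNIV. (column b (c t) \<bullet> x)\<^sup>2) + (n t \<bullet> x)\<^sup>2" for x
  proof -
    have "x \<bullet> x = (?F *v x) \<bullet> (?F *v x)" by (simp add: orthogonal_matrix_inner [OF F])
    thus ?thesis
      by (simp add: inner_vec_def [of "?F *v x"] matrix_vector_mul_component sum_UNIV_Plus q1 power2_eq_square)
  qed
  have dd: "d \<bullet> d = (\<Sum>a\<in>UNIV. (n t \<bullet> column a v)\<^sup>2)"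
    unfolding expand [of d] by (simp add: nd nv)
  have "v \<bullet> v = (\<Sum>a\<in>UNIV. column a v \<bullet> column a v)"
    unfolding inner_transpose [of v v, symmetric] inner_vec_def [of "transpose v" "transpose v"]
    by (simp add: column_def transpose_def)
  also have "\<dots> = (\<Sum>a\<in>UNIV. \<Sum>b\<in>UNIV. (column b (c t) \<bullet> column a v)\<^sup>2) + d \<bullet> d"
    unfolding dd sum.distrib [symmetric] by (rule sum.cong [OF refl expand])
  also have "(\<Sum>a\<in>UNIV. \<Sum>b\<in>UNIV. (column b (c t) \<bullet> column a v)\<^sup>2) = (transpose (c t) ** v) \<bullet> (transpose (c t) ** v)"
  proof -
    have M: "(transpose (c t) ** v) $ b $ a = column b (c t) \<bullet> column a v" for a b
      by (simp add: matrix_matrix_mult_def transpose_def column_def inner_vec_def)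
    show ?thesis
      unfolding inner_vec_def [of "transpose (c t) ** v" "transpose (c t) ** v"]
      by (subst sum.swap) (simp add: inner_vec_def [of "(transpose (c t) ** v) $ _"] M power2_eq_square)
  qed
  finally have vv: "v \<bullet> v = (transpose (c t) ** v) \<bullet> (transpose (c t) ** v) + d \<bullet> d" .
  show thesis
  proof (rule that)
    show "((\<lambda>s. append_row (c s) (normal_vector (c s))) has_vector_derivative append_row v d) (at t)"
      using has_vector_derivative_append_row [OF c(1) d] by (simp add: n_def)
    show "append_row v d \<bullet> append_row v d = 2 * stiefel_form (1/2) (c t) v v"
      unfolding inner_append_row [OF q1] stiefel_form_def using vv by simp
  qed
qed

text \<open>F(s)^T F(0) is a path of rotations from the identity to exp(tP). Each eigenvector e of
  P^2 travels along a sphere path through the angle t * \<theta> e, and the squares of \<theta> sum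
  to 2. The weighted bound then reads 2 t^2 <= 2 t L with L the length of c.\<close>

theorem stiefel_inj_rotation_group:
  assumes q1: "CARD('q::finite) = 1"
  shows "stiefel_inj TYPE('p::finite) TYPE('q) (1/2) \<ge> ereal pi"
proof (rule stiefel_inj_ge)
  fix X :: "real^'p^('p + 'q)" and P E t c
  assume X: "X \<in> stiefel" and PP: "P \<bullet> P = 2" and E: "skew_flow P E"
    and t: "0 < t" "t \<le> pi" and c: "admissible_path stiefel (stiefel_metric (1/2)) c" "c 0 = X" "c 1 = E t ** X"
  note P = skew_flowD(1) [OF E]
  obtain B where B: "finite B" "pairwise orthogonal B" "\<And>e. e \<in> B \<Longrightarrow> norm e = 1"
    "\<And>x. (\<Sum>e\<in>B. (x \<bullet> e) *\<^sub>R e) = x"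
    "\<And>e. e \<in> B \<Longrightarrow> P *v (P *v e) = - (norm (P *v e))\<^sup>2 *\<^sub>R e"
    by (rule skew_eigenbasis [OF P]) blast
  define \<theta> where "\<theta> e = norm (P *v e)" for e
  have \<theta>2: "(\<Sum>e\<in>B. (\<theta> e)\<^sup>2) = 2"
    using frobenius_orthonormal [OF B(4), of P] PP by (simp add: \<theta>_def)
  have \<theta>1: "\<theta> e \<le> 1" if "e \<in> B" for e
    using skew_norm_le [OF P B(1,4) that B(3) [OF that]] PP abs_square_le_1 [of "\<theta> e"] by (simp add: \<theta>_def)
  obtain S where S: "finite S" "\<And>t. t \<in> {0..1} - S \<Longrightarrow> (c has_vector_derivative vector_derivative c (at t)) (at t)"
    "\<And>t. t \<in> {0..1} - S \<Longrightarrow> stiefel_metric (1/2) (c t) (vector_derivative c (at t)) (vector_derivative c (at t))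
        = stiefel_form (1/2) (c t) (vector_derivative c (at t)) (vector_derivative c (at t))"
    "\<And>t. t \<in> {0..1} \<Longrightarrow> c t \<in> stiefel" "continuous_on {0..1} c"
    by (rule admissible_stiefel_path [OF c(1)]) blast
  define F where "F s = append_row (c s) (normal_vector (c s))" for s
  have F: "orthogonal_matrix (F s)" if "s \<in> {0..1}" for s
    unfolding F_def by (rule completion_orthogonal [OF q1 S(4) [OF that]])
  define \<sigma> where "\<sigma> s = sqrt (stiefel_metric (1/2) (c s) (vector_derivative c (at s)) (vector_derivative c (at s)))" for s
  have "\<exists>F'. (F has_vector_derivative F') (at s) \<and> F' \<bullet> F' = 2 * (\<sigma> s)\<^sup>2" if s: "s \<in> {0..1} - (S \<union> {0,1})" for s
  proof -
    have "open {0<..<1::real}" "s \<in> {0<..<1}" using s by auto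
    hence "\<forall>\<^sub>F r in at s. r \<in> {0<..<1}" by (rule eventually_at_in_open')
    hence ev: "\<forall>\<^sub>F r in at s. c r \<in> stiefel" by (rule eventually_mono) (use S(4) in auto)
    have s': "s \<in> {0..1} - S" and cs: "c s \<in> stiefel" using s S(4) by auto
    have "stiefel_form (1/2) (c s) (vector_derivative c (at s)) (vector_derivative c (at s)) \<ge> 0"
      by (rule stiefel_form_nonneg [OF cs]) simp
    hence "(\<sigma> s)\<^sup>2 = stiefel_form (1/2) (c s) (vector_derivative c (at s)) (vector_derivative c (at s))"
      unfolding \<sigma>_def S(3) [OF s'] by simp
    moreover obtain F' where "(F has_vector_derivative F') (at s)"
      "F' \<bullet> F' = 2 * stiefel_form (1/2) (c s) (vector_derivative c (at s)) (vector_derivative c (at s))"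
      by (rule completion_speed [OF q1 S(2) [OF s'] ev cs, folded F_def])
    ultimately show ?thesis by auto
  qed
  then obtain F' where F': "\<And>s. s \<in> {0..1} - (S \<union> {0,1}) \<Longrightarrow> (F has_vector_derivative F' s) (at s)"
    "\<And>s. s \<in> {0..1} - (S \<union> {0,1}) \<Longrightarrow> F' s \<bullet> F' s = 2 * (\<sigma> s)\<^sup>2" by metis
  have FF0: "transpose (F 0) ** F 0 = mat 1" "F 0 ** transpose (F 0) = mat 1"
    using F [of 0] by (auto simp: orthogonal_matrix_def)
  have \<sigma>0: "\<sigma> s \<ge> 0" if "s \<in> {0..1} - S" for s
    unfolding \<sigma>_def S(3) [OF that] using stiefel_form_nonneg [OF S(4), of s "1/2"] that by simp
  have cont: "continuous_on {0..1} F"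
  proof -
    have "continuous_on {0..1} (\<lambda>s. append_row (c s) y)" for y
      using linear_continuous_on_compose [OF continuous_on_Pair [OF S(5) continuous_on_const] linear_append_row] by simp
    hence "continuous_on {0..1} (\<lambda>s. normal_vector (c s))"
      unfolding normal_vector_def by (intro continuous_on_vec_lambda continuous_on_det)
    thus ?thesis
      unfolding F_def
      using linear_continuous_on_compose [OF continuous_on_Pair [OF S(5)] linear_append_row] by simp
  qed
  have "(\<Sum>e\<in>B. (t * \<theta> e)\<^sup>2) \<le> (2 * t) * curve_length (stiefel_metric (1/2)) c"
  proof (rule sphere_paths_length [where S = "S \<union> {0,1}" and w = "\<lambda>e s. transpose (F s) *v (F 0 *v e)"
        and w' = "\<lambda>e s. transpose (F' s) *v (F 0 *v e)" and \<sigma> = \<sigma>])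
    show "continuous_on {0..1} (\<lambda>s. transpose (F s) *v (F 0 *v e))" for e
    proof -
      have "linear (\<lambda>A. transpose A *v (F 0 *v e))"
        by (rule linearI) (simp_all add: transpose_add transpose_scaleR matrix_vector_mult_add_rdistrib
            scaleR_matrix_vector_assoc del: transpose_matrix_vector)
      thus ?thesis by (rule linear_continuous_on_compose [OF cont])
    qed
    show "norm (transpose (F s) *v (F 0 *v e)) = 1" if "e \<in> B" "s \<in> {0..1}" for e s
      using orthogonal_matrix_norm [of "transpose (F s)" "F 0 *v e"] F [OF that(2)] F [of 0] B(3) [OF that(1)]
      by (simp add: orthogonal_matrix_norm del: transpose_matrix_vector)
    show "((\<lambda>s. transpose (F s) *v (F 0 *v e)) has_vector_derivative transpose (F' s) *v (F 0 *v e)) (at s)"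
      if "s \<in> {0..1} - (S \<union> {0,1})" for e s
      by (rule has_vector_derivative_matrix_vector [OF has_vector_derivative_transpose [OF F'(1) [OF that]]])
    show "0 \<le> t * \<theta> e \<and> t * \<theta> e \<le> pi" if "e \<in> B" for e
      \<comment> \<open>The rates \<open>\<theta> e\<close> are at most 1, so t <= pi keeps every
        angle in the range of arccos.\<close>
      using mult_mono [of t pi "\<theta> e" 1] \<theta>1 [OF that] t by (simp add: \<theta>_def)
    show "(transpose (F 0) *v (F 0 *v e)) \<bullet> (transpose (F 1) *v (F 0 *v e)) = cos (t * \<theta> e)" if "e \<in> B" for e
    proof -
      have "F 1 = F 0 ** transpose (E t)"
        unfolding F_def c(2,3)
        by (rule normal_vector_rotate [OF q1]) (simp_all add: orthogonal_matrix skew_flow_orthogonal [OF E] skew_flow_det [OF E])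
      hence "transpose (F 1) ** F 0 = E t"
        by (simp add: matrix_transpose_mul matrix_mul_assoc [symmetric] FF0)
      thus ?thesis
        using skew_flow_eigenvector [OF E B(3) [OF that] B(5) [OF that], of t]
        by (simp only: matrix_vector_mul_assoc FF0 matrix_vector_mul_lid \<theta>_def)
    qed
    show "(\<Sum>e\<in>B. t * \<theta> e * norm (transpose (F' s) *v (F 0 *v e))) \<le> 2 * t * \<sigma> s"
      if s: "s \<in> {0..1} - (S \<union> {0,1})" for s
    proof -
      let ?A = "transpose (F' s) ** F 0"
      \<comment> \<open>Both factors are Frobenius norms: the squares of \<theta> sum to 2, and the
        squared norm of F' is twice the squared speed. So the weighted sum is at most 2 * \<sigma>
        s.\<close>
      have "(\<Sum>e\<in>B. \<theta> e * norm (?A *v e))\<^sup>2 \<le> (\<Sum>e\<in>B. (\<theta> e)\<^sup>2) * (\<Sum>e\<in>B. (norm (?A *v e))\<^sup>2)"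
        by (rule Cauchy_Schwarz_ineq_sum)
      also have "\<dots> = 2 * (?A \<bullet> ?A)"
        by (simp only: \<theta>2 frobenius_orthonormal [OF B(4), symmetric])
      also have "?A \<bullet> ?A = F' s \<bullet> F' s"
        by (simp add: inner_matrix_mult_right matrix_mul_assoc [symmetric] FF0 inner_transpose)
      also have "2 * (F' s \<bullet> F' s) = (2 * \<sigma> s)\<^sup>2" by (simp add: F'(2) [OF s] power_mult_distrib)
      finally have sq: "(\<Sum>e\<in>B. \<theta> e * norm (?A *v e))\<^sup>2 \<le> (2 * \<sigma> s)\<^sup>2" .
      have "s \<in> {0..1} - S" using s by blast
      from \<sigma>0 [OF this] have "0 \<le> 2 * \<sigma> s" by simp
      with sq have "(\<Sum>e\<in>B. \<theta> e * norm (?A *v e)) \<le> 2 * \<sigma> s" by (rule power2_le_imp_le)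
      hence "t * (\<Sum>e\<in>B. \<theta> e * norm (?A *v e)) \<le> t * (2 * \<sigma> s)"
        using t by (intro mult_left_mono) auto
      moreover have "t * (\<Sum>e\<in>B. \<theta> e * norm (?A *v e)) = (\<Sum>e\<in>B. t * \<theta> e * norm (transpose (F' s) *v (F 0 *v e)))"
        unfolding matrix_vector_mul_assoc sum_distrib_left by (simp only: mult.assoc)
      ultimately show ?thesis by (simp only: mult.assoc mult.left_commute [of t])
    qed
    show "(\<sigma> has_integral curve_length (stiefel_metric (1/2)) c) {0..1}"
      unfolding \<sigma>_def by (rule curve_length_has_integral [OF c(1)])
  qed (use S in auto)
  moreover have "(\<Sum>e\<in>B. (t * \<theta> e)\<^sup>2) = t\<^sup>2 * 2"
    unfolding power_mult_distrib sum_distrib_left [symmetric] \<theta>2 ..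
  ultimately show "t \<le> curve_length (stiefel_metric (1/2)) c"
    using t by (simp add: power2_eq_square)
qed

section \<open>The constant of the canonical metric\<close>

lemma sin_add_id_cos_decreasing:
  assumes "pi / 2 \<le> x" "x < y" "y \<le> pi"
  shows "sin y + y * cos y < sin x + x * cos x"
proof (rule DERIV_neg_imp_decreasing_open [OF \<open>x < y\<close>])
  fix z assume z: "x < z" "z < y"
  have d: "((\<lambda>z. sin z + z * cos z) has_real_derivative (2 * cos z - z * sin z)) (at z)"
    by (auto intro!: derivative_eq_intros)
  have "cos z < 0" using z assms by (intro cos_lt_zero_pi) auto
  moreover have "sin z > 0" using z assms by (intro sin_gt_zero) (use pi_gt_zero in linarith)+
  hence "z * sin z > 0" using z assms pi_gt_zero by (intro mult_pos_pos) linarith+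
  ultimately have "2 * cos z - z * sin z < 0" by linarith
  thus "\<exists>d. ((\<lambda>z. sin z + z * cos z) has_real_derivative d) (at z) \<and> d < 0" using d by blast
qed (auto intro!: continuous_intros)

lemma sin_add_id_cos_pos:
  assumes "0 < x" "x \<le> pi / 2" shows "0 < sin x + x * cos x"
proof (rule add_pos_nonneg)
  show "0 < sin x" using assms pi_gt_zero by (intro sin_gt_zero) linarith+
  show "0 \<le> x * cos x" using assms pi_gt_zero by (intro mult_nonneg_nonneg cos_ge_zero) linarith+
qed

text \<open>Used below to compare sin z with z cos z, so that the sign of \<open>M'\<close> near 0
  reduces to that of sin \<omega> + \<omega> cos \<omega>.\<close>

lemma id_mult_cos_le_sin:
  assumes "0 \<le> x" "x \<le> pi" shows "x * cos x \<le> sin x"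
proof -
  have "\<exists>y. ((\<lambda>z. sin z - z * cos z) has_real_derivative y) (at z) \<and> 0 \<le> y" if "0 \<le> z" "z \<le> x" for z
    by (rule exI [of _ "z * sin z"])
      (use that assms sin_ge_zero [of z] in \<open>auto intro!: derivative_eq_intros mult_nonneg_nonneg\<close>)
  from DERIV_nonneg_imp_nondecreasing [OF assms(1) this] show ?thesis by simp
qed

text \<open>A \<open>LEAST\<close> over the reals needs an attained minimum. The function sin t + t
  cos t is positive up to pi / 2 and strictly decreasing from there to pi, so the zero found between
  x and y is the smallest one.\<close>

lemma t_r_characterization:
  assumes x: "pi / 2 < x" "x < pi" "sin x + x * cos x > 0" and y: "x < y" "y < pi" "sin y + y * cos y < 0"
  shows "x < t_r" "t_r < y" "sin t_r + t_r * cos t_r = 0"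
proof -
  have "\<exists>r\<ge>x. r \<le> y \<and> sin r + r * cos r = 0"
    by (rule IVT2) (use x y in \<open>auto intro!: continuous_intros\<close>)
  then obtain r where r: "x \<le> r" "r \<le> y" "sin r + r * cos r = 0" by blast
  have r0: "r > 0" using r x pi_gt_zero by linarith
  have "t_r = r"
    unfolding t_r_def
  proof (rule Least_equality)
    show "r > 0 \<and> sin r / r + cos r = 0" using r r0 by (simp add: field_simps)
    fix z :: real assume z: "z > 0 \<and> sin z / z + cos z = 0"
    have "sin z = (sin z / z) * z" using z by simp
    moreover have "sin z / z = - cos z" using z by linarith
    ultimately have "sin z = (- cos z) * z" by (simp only:)
    hence zf: "sin z + z * cos z = 0" by simp
    show "r \<le> z"
    proof (rule ccontr)
      assume "\<not> r \<le> z"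
      moreover have "pi / 2 < z" using sin_add_id_cos_pos [of z] zf z by force
      ultimately have "sin r + r * cos r < sin z + z * cos z"
        using r y by (intro sin_add_id_cos_decreasing) auto
      thus False using r zf by simp
    qed
  qed
  thus "x < t_r" "t_r < y" "sin t_r + t_r * cos t_r = 0" using r x y by (auto simp: order_less_le)
qed

text \<open>On the curve \<open>cos \<omega> = cos s cos b\<close>, which contains \<open>(b, \<omega>) = (0, s)\<close>, the endpoint conditions are the
  critical point equation of \<open>\<omega>\<^sup>2 + b\<^sup>2\<close>; for \<open>s\<close> beyond the conjugate value, \<open>b = 0\<close> is not a minimum.\<close>

lemma berger_endpoint_exists:
  assumes r: "pi / 2 < r" "sin r + r * cos r = 0" and s: "r < s" "s \<le> pi"
  shows "\<exists>b \<omega>. berger_endpoint b \<omega> s \<and> \<omega>\<^sup>2 + b\<^sup>2 < s\<^sup>2"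
proof (cases "s = pi")
  case True
  \<comment> \<open>Half a Hopf fibre (h = 0) joins the antipodal points. The case s = pi is
    separate because the argument of arccos below would reach -1.\<close>
  have "berger_endpoint (pi / 2) (pi / 2) s"
    by (simp add: berger_endpoint_def True)
  moreover have "(pi / 2)\<^sup>2 + (pi / 2)\<^sup>2 < s\<^sup>2"
    by (simp add: True power2_eq_square)
  ultimately show ?thesis by blast
next
  case False
  with s have s': "s < pi" by simp
  have cs: "cos s < 0" using r s s' by (intro cos_lt_zero_pi) auto
  have s0: "s > 0" using r s pi_gt_zero by linarith
  have cs1: "cos s > -1" using cos_monotone_0_pi [of s pi] s' s0 by simp
  define w where "w b = arccos (cos s * cos b)" for b
  have arg: "\<bar>cos s * cos b\<bar> < 1" for b
  proof -
    have "\<bar>cos s * cos b\<bar> \<le> \<bar>cos s\<bar> * 1" unfolding abs_mult by (intro mult_left_mono) auto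
    thus ?thesis using cs cs1 by simp
  qed
  hence arg': "-1 < cos s * cos b" "cos s * cos b < 1" for b by (auto simp: abs_less_iff)
  have cw: "cos (w b) = cos s * cos b" for b
    unfolding w_def using arg' [of b] by (intro cos_arccos) auto
  have wb: "0 < w b" "w b < pi" for b
    unfolding w_def using arccos_lt_bounded [OF arg'] by auto
  have sw: "sin (w b) > 0" for b using wb by (rule sin_gt_zero)
  have w0: "w 0 = s" unfolding w_def using s s0 by (simp add: arccos_cos)
  have whalf: "w (pi / 2) = pi / 2" by (simp add: w_def)
  have wge: "pi / 2 \<le> w b" if "0 \<le> b" "b \<le> pi / 2" for b
  proof (rule ccontr)
    assume "\<not> pi / 2 \<le> w b"
    hence "cos (w b) > 0" using wb [of b] by (intro cos_gt_zero_pi) auto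
    moreover have "cos b \<ge> 0" using that by (intro cos_ge_zero) auto
    ultimately show False using cs unfolding cw by (simp add: zero_less_mult_iff)
  qed
  have dw: "(w has_real_derivative cos s * sin b / sin (w b)) (at b)" for b
  proof -
    have "sqrt (1 - (cos s * cos b)\<^sup>2) = sin (w b)"
      unfolding cw [symmetric] using sw [of b] by (simp add: sin_squared_eq [symmetric])
    moreover have "((\<lambda>b. cos s * cos b) has_real_derivative - cos s * sin b) (at b)"
      by (auto intro!: derivative_eq_intros)
    note DERIV_chain2 [where f = arccos and g = "\<lambda>b. cos s * cos b", OF DERIV_arccos [OF arg'] this]
    ultimately show ?thesis
      unfolding w_def [abs_def] by (simp add: divide_inverse mult.commute)
  qed
  define M where "M b = (w b)\<^sup>2 + b\<^sup>2" for b
  define M' where "M' b = 2 * (w b * (cos s * sin b / sin (w b)) + b)" for b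
  have dM: "(M has_real_derivative M' b) (at b)" for b
    unfolding M_def M'_def by (auto intro!: derivative_eq_intros dw simp: algebra_simps)
  have "continuous_on {0..pi/2} M"
    by (intro continuous_at_imp_continuous_on ballI DERIV_isCont [OF dM])
  then obtain b where b: "b \<in> {0..pi/2}" "\<And>y. y \<in> {0..pi/2} \<Longrightarrow> M b \<le> M y"
    using continuous_attains_inf [of "{0..pi/2}" M] by auto
  have M0: "M 0 = s\<^sup>2" by (simp add: M_def w0)
  \<comment> \<open>Close to b = 0 the value w stays above r, where sin w + w cos w < 0; this forces
    \<open>M' < 0\<close>, so M drops below its value s^2 at 0.\<close>
  obtain c where c: "0 < c" "c \<le> pi / 2" "M c < s\<^sup>2"
  proof -
    have "isCont w 0" by (rule DERIV_isCont [OF dw])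
    hence "\<forall>\<^sub>F x in at 0. w x > r"
      unfolding isCont_def using s w0 by (intro order_tendstoD(1)) auto
    then obtain e where e: "e > 0" "\<And>x. x \<noteq> 0 \<Longrightarrow> \<bar>x\<bar> < e \<Longrightarrow> w x > r"
      unfolding eventually_at by (auto simp: dist_real_def)
    define c where "c = min (e / 2) (pi / 2)"
    have c: "0 < c" "c \<le> pi / 2" "c < e" using e pi_gt_zero by (auto simp: c_def min_def)
    have "M c < M 0"
    proof (rule DERIV_neg_imp_decreasing_open [OF c(1)])
      fix z assume z: "0 < z" "z < c"
      have wz: "w z > r" using e(2) [of z] z c by simp
      have "sin (w z) + w z * cos (w z) < 0"
        using sin_add_id_cos_decreasing [of r "w z"] r wz wb [of z] by auto
      hence neg: "z * ((sin (w z) + w z * cos (w z)) / sin (w z)) < 0"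
        using z sw [of z] by (intro mult_pos_neg divide_neg_pos) auto
      have "z * cos z \<le> sin z"
        using z c pi_gt_zero by (intro id_mult_cos_le_sin) linarith+
      hence "cos s * sin z \<le> cos s * (z * cos z)" using cs by (intro mult_left_mono_neg) auto
      hence "w z * (cos s * sin z / sin (w z)) \<le> w z * (z * cos (w z) / sin (w z))"
        using wb [of z] sw [of z] by (intro mult_left_mono divide_right_mono) (auto simp: cw mult_ac)
      hence "w z * (cos s * sin z / sin (w z)) + z \<le> w z * (z * cos (w z) / sin (w z)) + z"
        by (rule add_right_mono)
      also have "\<dots> = z * ((sin (w z) + w z * cos (w z)) / sin (w z))"
        using sw [of z] by (simp add: field_simps)
      also note neg
      finally have "M' z < 0" unfolding M'_def by (rule mult_pos_neg [rotated]) simp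
      thus "\<exists>y. (M has_real_derivative y) (at z) \<and> y < 0" using dM by blast
    qed (intro continuous_at_imp_continuous_on ballI DERIV_isCont [OF dM])
    thus thesis using that c M0 by simp
  qed
  have Mb: "M b < s\<^sup>2" using b(2) [of c] c by auto
  have "b \<noteq> 0" using Mb M0 by auto
  moreover have "b \<noteq> pi / 2"
  proof
    assume bh: "b = pi / 2"
    \<comment> \<open>The other end is no minimum either: M is increasing at pi / 2 because cos s >
      -1.\<close>
    have "M' (pi / 2) = pi * (cos s + 1)" by (simp add: M'_def whalf algebra_simps)
    hence "M' (pi / 2) > 0" using cs1 by simp
    from DERIV_pos_inc_left [OF dM this] obtain d where d: "d > 0" "\<And>h. 0 < h \<Longrightarrow> h < d \<Longrightarrow> M (pi / 2 - h) < M (pi / 2)"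
      by blast
    define h where "h = min (d / 2) (pi / 2)"
    have "0 < h" "h < d" "h \<le> pi / 2" using d pi_gt_zero by (auto simp: h_def min_def)
    thus False using d(2) [of h] b(2) [of "pi / 2 - h"] bh by auto
  qed
  ultimately have bi: "0 < b" "b < pi / 2" using b(1) by auto
  have "M' b = 0"
  proof (rule DERIV_local_min [OF dM])
    show "0 < min b (pi / 2 - b)" using bi by simp
    show "\<forall>y. \<bar>b - y\<bar> < min b (pi / 2 - b) \<longrightarrow> M b \<le> M y"
      using b(2) by (auto simp: abs_less_iff)
  qed
  hence crit: "w b * (cos s * sin b) = - b * sin (w b)"
    using sw [of b] by (simp add: M'_def field_simps)
  have wpos: "w b > 0" by (rule wb)
  \<comment> \<open>The critical point equation turns all three endpoint conditions into identities
    for b and s alone.\<close>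
  have crit': "b / w b * sin (w b) = - cos s * sin b" using crit wpos by (simp add: field_simps)
  have "berger_endpoint b (w b) s"
    unfolding berger_endpoint_def
  proof (intro conjI)
    show "b\<^sup>2 \<le> (w b)\<^sup>2" using wge [of b] bi by (intro power_mono) auto
    have "sin b * cos (w b) + b / w b * cos b * sin (w b) = sin b * (cos s * cos b) + cos b * (b / w b * sin (w b))"
      by (simp add: cw)
    thus "sin b * cos (w b) + b / w b * cos b * sin (w b) = 0"
      unfolding crit' by simp
    have "cos b * cos (w b) - b / w b * sin b * sin (w b) = cos b * (cos s * cos b) - sin b * (b / w b * sin (w b))"
      by (simp add: cw)
    also have "\<dots> = cos s * ((cos b)\<^sup>2 + (sin b)\<^sup>2)" unfolding crit' by algebra
    finally show "cos b * cos (w b) - b / w b * sin b * sin (w b) = cos s" by simp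
    have ge: "(w b)\<^sup>2 - b\<^sup>2 \<ge> 0" using wge [of b] bi by (simp add: power_mono)
    have "(sqrt ((w b)\<^sup>2 - b\<^sup>2) / w b * sin (w b))\<^sup>2 = (sin (w b))\<^sup>2 - (b / w b * sin (w b))\<^sup>2"
      using ge wpos by (simp add: power_mult_distrib power_divide field_simps)
    also have "\<dots> = (1 - (cos s)\<^sup>2 * (cos b)\<^sup>2) - (cos s)\<^sup>2 * (sin b)\<^sup>2"
      unfolding crit' by (simp add: sin_squared_eq [of "w b"] cw power_mult_distrib)
    also have "\<dots> = 1 - (cos s)\<^sup>2 * ((sin b)\<^sup>2 + (cos b)\<^sup>2)" by (simp only: algebra_simps)
    also have "\<dots> = (sin s)\<^sup>2" by (simp add: sin_squared_eq)
    finally have sq: "(sqrt ((w b)\<^sup>2 - b\<^sup>2) / w b * sin (w b))\<^sup>2 = (sin s)\<^sup>2" .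
    have "0 \<le> sqrt ((w b)\<^sup>2 - b\<^sup>2) / w b * sin (w b)"
      using ge wpos sw [of b] by (intro mult_nonneg_nonneg divide_nonneg_pos) auto
    with sq show "sqrt ((w b)\<^sup>2 - b\<^sup>2) / w b * sin (w b) = sin s"
      by (rule power2_eq_imp_eq) (use sin_gt_zero [OF s0 s'] in simp)
  qed (rule wpos)
  thus ?thesis using Mb unfolding M_def by blast
qed

section \<open>Numerical enclosure of the first conjugate value\<close>

lemma pi_bounds_machin: "3.1415926535897932 < pi" "pi < 3.1415926535897933"
  unfolding pi_machin
  using arctan_bounds [of "1/5" 6] arctan_bounds [of "1/239" 2]
  by (simp_all add: eval_nat_numeral)

lemma arctan_third_bounds: "0.32175055439664219 < arctan (1/3)" "arctan (1/3) < 0.32175055439664220"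
  using arctan_bounds [of "1/3" 9] by (simp_all add: eval_nat_numeral)

text \<open>The arctan series is useless near t = 2.03. Passing to 1/t, splitting off arctan (1/2) =
  pi/4 - arctan (1/3), and using the addition theorem leaves only a tiny argument.\<close>

lemma id_add_arctan_eq:
  assumes "2 < t" "t < (3::real)"
  shows "t + arctan t = pi / 4 + t + arctan (1/3) + arctan ((t - 2) / (2 * t + 1))"
proof -
  have "arctan t = pi / 2 - arctan (1 / t)"
    using arctan_inverse [of t] assms by (simp add: inverse_eq_divide)
  moreover have "arctan (1 / t) + arctan ((t - 2) / (2 * t + 1)) = arctan (1/2)"
  proof -
    define N where "N = t * (2 * t + 1)"
    define a where "a = t\<^sup>2 + 1"
    have pos: "N > 0" "a > 0" "t < N" using assms by (simp_all add: N_def a_def add_nonneg_pos)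
    have prod: "1 / t * ((t - 2) / (2 * t + 1)) = (t - 2) / N" by (simp add: N_def)
    have lt: "\<bar>1 / t * ((t - 2) / (2 * t + 1))\<bar> < 1"
      unfolding prod using pos assms by (simp add: abs_less_iff field_simps)
    have num: "1 / t + (t - 2) / (2 * t + 1) = a / N"
      using assms by (simp add: field_simps power2_eq_square N_def a_def)
    have "1 - (t - 2) / N = (N - (t - 2)) / N" using pos by (simp add: diff_divide_distrib)
    also have "N - (t - 2) = 2 * a" by (simp add: N_def a_def power2_eq_square algebra_simps)
    finally have den: "1 - 1 / t * ((t - 2) / (2 * t + 1)) = 2 * a / N" unfolding prod .
    have "(a / N) / (2 * a / N) = 1 / 2" using pos by simp
    note arctan_add_small [OF lt, unfolded num den this]
    thus ?thesis by simp
  qed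
  moreover have "arctan (1/2) + arctan (1/3) = pi / 4"
    using arctan_add_small [of "1/2" "1/3"] by simp
  ultimately show ?thesis by linarith
qed

lemma id_add_arctan_bounds:
  "2.02875783811043 + arctan 2.02875783811043 < pi"
  "pi < 2.02875783811044 + arctan 2.02875783811044"
proof -
  \<comment> \<open>The quotient is about 0.0057, so very few series terms suffice. It is rounded up
    here and rounded down for the other end point of the enclosure.\<close>
  have "arctan ((2.02875783811043 - 2) / (2 * 2.02875783811043 + 1)) < arctan 0.0056861589664748"
    by (simp add: arctan_less_iff)
  also have "\<dots> < 0.005686097685270"
    using arctan_upper_bound [of "0.0056861589664748" 1] by (simp add: eval_nat_numeral)
  finally have 1: "arctan ((2.02875783811043 - 2) / (2 * 2.02875783811043 + 1)) < 0.005686097685270" .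
  have "0.005686097685265 < arctan (0.0056861589664767::real)"
    using arctan_lower_bound [of "0.0056861589664767" 2] by (simp add: eval_nat_numeral)
  also have "arctan 0.0056861589664767 < arctan ((2.02875783811044 - 2) / (2 * 2.02875783811044 + 1))"
    by (simp add: arctan_less_iff)
  finally have 2: "0.005686097685265 < arctan ((2.02875783811044 - 2) / (2 * 2.02875783811044 + 1))" .
  note b = pi_bounds_machin arctan_third_bounds
  show "2.02875783811043 + arctan 2.02875783811043 < pi"
    using id_add_arctan_eq [of "2.02875783811043"] 1 b by simp
  show "pi < 2.02875783811044 + arctan 2.02875783811044"
    using id_add_arctan_eq [of "2.02875783811044"] 2 b by simp
qed

text \<open>Between pi/2 and pi the equation sin t + t cos t = 0 says t = tan (pi - t), that is, t +
  arctan t = pi; both sides of it are monotone, so signs carry over.\<close>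

lemma sin_add_id_cos_sign:
  assumes t: "pi / 2 < t" "t < pi"
  shows "t + arctan t < pi \<Longrightarrow> 0 < sin t + t * cos t" "pi < t + arctan t \<Longrightarrow> sin t + t * cos t < 0"
proof -
  have c: "cos t < 0" using t by (intro cos_lt_zero_pi) auto
  have tan: "tan (pi - t) = - sin t / cos t" by (simp add: tan_def)
  have ar: "arctan (tan (pi - t)) = pi - t" using t by (intro arctan_tan) auto
  show "0 < sin t + t * cos t" if "t + arctan t < pi"
  proof -
    have "arctan t < arctan (tan (pi - t))" using that ar by simp
    hence "t < - sin t / cos t" unfolding arctan_less_iff tan .
    thus ?thesis using c by (simp add: field_simps)
  qed
  show "sin t + t * cos t < 0" if "pi < t + arctan t"
  proof -
    have "arctan (tan (pi - t)) < arctan t" using that ar by simp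
    hence "- sin t / cos t < t" unfolding arctan_less_iff tan .
    thus ?thesis using c by (simp add: field_simps)
  qed
qed

lemma t_r_bounds:
  "2.02875783811043 < t_r" "t_r < 2.02875783811044" "sin t_r + t_r * cos t_r = 0"
proof -
  have b: "pi / 2 < 2.02875783811043" "2.02875783811044 < pi" using pi_bounds_machin by auto
  have "0 < sin 2.02875783811043 + 2.02875783811043 * cos (2.02875783811043 :: real)"
    by (rule sin_add_id_cos_sign(1)) (use b id_add_arctan_bounds in auto)
  moreover have "sin 2.02875783811044 + 2.02875783811044 * cos (2.02875783811044 :: real) < 0"
    by (rule sin_add_id_cos_sign(2)) (use b id_add_arctan_bounds in auto)
  ultimately show "2.02875783811043 < t_r" "t_r < 2.02875783811044" "sin t_r + t_r * cos t_r = 0"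
    using t_r_characterization [of "2.02875783811043" "2.02875783811044"] b by auto
qed

text \<open>The tolerance is half a unit in the last of the 14 printed decimals. The enclosures of
  \<open>t_r\<close>, sqrt 2 and pi are narrow enough to resolve it.\<close>

lemma t_r_approx: "\<bar>t_r * sqrt 2 / pi - 0.91326189159122\<bar> < 5 / 10 ^ 15"
proof -
  have s2: "1.4142135623730950 < sqrt 2" "sqrt 2 < 1.4142135623730951"
    by (rule real_less_rsqrt, simp add: power2_eq_square)
      (rule real_less_lsqrt, simp_all add: power2_eq_square)
  note b = pi_bounds_machin t_r_bounds(1,2)
  have "t_r * sqrt 2 < 2.02875783811044 * 1.4142135623730951"
    using b s2 by (intro mult_strict_mono) auto
  also have "\<dots> < (0.91326189159122 + 5 / 10 ^ 15) * 3.1415926535897932" by simp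
  also have "\<dots> < (0.91326189159122 + 5 / 10 ^ 15) * pi"
    using b by (intro mult_strict_left_mono) auto
  finally have 1: "t_r * sqrt 2 / pi < 0.91326189159122 + 5 / 10 ^ 15"
    by (simp add: divide_less_eq)
  have "(0.91326189159122 - 5 / 10 ^ 15) * pi < (0.91326189159122 - 5 / 10 ^ 15) * 3.1415926535897933"
    using b by (intro mult_strict_left_mono) auto
  also have "\<dots> < 2.02875783811043 * 1.4142135623730950" by simp
  also have "\<dots> < t_r * sqrt 2"
    using b s2 by (intro mult_strict_mono) auto
  finally have 2: "0.91326189159122 - 5 / 10 ^ 15 < t_r * sqrt 2 / pi"
    by (simp add: less_divide_eq)
  show ?thesis using 1 2 unfolding abs_less_iff by linarith
qed

theorem corollary7p2:
  fixes n p :: nat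
  assumes "p = CARD('p::finite)" and "n = CARD('p + 'q::finite)"
  shows
    "(2 \<le> p \<and> p \<le> n - 2 \<longrightarrow>
        stiefel_inj TYPE('p) TYPE('q) (1/2) \<le> ereal (t_r * sqrt 2) \<and>
        \<bar>t_r * sqrt 2 / pi - 0.91326189159122\<bar> < 5 / 10 ^ 15 \<and>
        stiefel_inj TYPE('p) TYPE('q) 1 \<le> ereal pi) \<and>
     (p = n - 1 \<and> n \<ge> 2 \<longrightarrow>
        stiefel_inj TYPE('p) TYPE('q) (1/2) = ereal pi \<and>
        stiefel_inj TYPE('p) TYPE('q) 1 \<le> ereal pi) \<and>
     (p = 1 \<and> n \<ge> 2 \<longrightarrow>
        stiefel_inj TYPE('p) TYPE('q) (1/2) = ereal pi \<and>
        stiefel_inj TYPE('p) TYPE('q) 1 = ereal pi \<and>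
        (\<forall>X \<in> (stiefel :: (real^'p^('p + 'q)) set).
           \<forall>\<xi> \<in> stiefel_tangent X. \<forall>\<eta> \<in> stiefel_tangent X.
             stiefel_metric (1/2) X \<xi> \<eta> = stiefel_metric 1 X \<xi> \<eta>))"
proof -
  have n: "n = CARD('p) + CARD('q)" using assms by simp
  note [simp] = assms(1)
  have r: "pi / 2 < t_r" using t_r_bounds pi_bounds_machin by simp
  hence r0: "t_r > 0" using pi_gt_zero by linarith
  have le: "stiefel_inj TYPE('p) TYPE('q) (1/2) \<le> ereal pi" "stiefel_inj TYPE('p) TYPE('q) 1 \<le> ereal pi"
    by (simp_all add: stiefel_inj_le_pi)
  show ?thesis
  proof (intro conjI impI)
    assume pn: "2 \<le> p \<and> p \<le> n - 2"
    hence "CARD('p) \<ge> 2" "CARD('q) \<ge> 2" using n by auto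
    thus "stiefel_inj TYPE('p) TYPE('q) (1/2) \<le> ereal (t_r * sqrt 2)"
      by (rule stiefel_inj_canonical_le [OF _ _ r0 berger_endpoint_exists [OF r t_r_bounds(3)]])
    show "\<bar>t_r * sqrt 2 / pi - 0.91326189159122\<bar> < 5 / 10 ^ 15" by (rule t_r_approx)
    show "stiefel_inj TYPE('p) TYPE('q) 1 \<le> ereal pi" by (rule le)
  next
    assume "p = n - 1 \<and> n \<ge> 2"
    moreover have "CARD('q) > 0" by simp
    ultimately have "CARD('q) = 1" using n assms(1) by arith
    from stiefel_inj_rotation_group [OF this]
    show "stiefel_inj TYPE('p) TYPE('q) (1/2) = ereal pi" by (intro order_antisym le)
    show "stiefel_inj TYPE('p) TYPE('q) 1 \<le> ereal pi" by (rule le)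
  next
    assume "p = 1 \<and> n \<ge> 2"
    hence p: "CARD('p) = 1" by simp
    have eq: "stiefel_metric (1/2) = (stiefel_metric 1 :: real^'p^('p + 'q) \<Rightarrow> _)"
      by (rule stiefel_metric_indep [OF p])
    show inj: "stiefel_inj TYPE('p) TYPE('q) (1/2) = ereal pi"
      by (intro order_antisym le stiefel_inj_sphere [OF p])
    thus "stiefel_inj TYPE('p) TYPE('q) 1 = ereal pi"
      unfolding stiefel_inj_def eq .
    show "\<forall>X \<in> (stiefel :: (real^'p^('p + 'q)) set). \<forall>\<xi> \<in> stiefel_tangent X. \<forall>\<eta> \<in> stiefel_tangent X.
        stiefel_metric (1/2) X \<xi> \<eta> = stiefel_metric 1 X \<xi> \<eta>"
      by (simp add: eq)
  qed
qed

end
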